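(* Consider the 1/2-equation model (defined in the context) under no-slip or periodic boundary conditions. The following hold. (Positivity) If $k(t^* )>0$ then $k(t)>0$ for all $t\ge t^*$. (Model convergence to the Navier-Stokes equations) There is a $\tau_0=\tau_0(\text{data})>0$, i.e. depending on the problem data, such that for $\tau<\tau_0$, $k(t)\to0$ and $\nu_T\to0$ exponentially in $t$.
   Context: The 1/2-equation model. Let $\Omega$ be the flow domain, $|\Omega|$ its measure, with either no-slip boundary conditions ($v=0$ on $\partial\Omega$) or periodic boundary conditions. Let $\nu>0$ be the kinematic viscosity, $\tau>0$ the time window (averaging time scale), $\mu>0$ a calibration constant ($\mu=0.55$), $\kappa$ the von Karman constant, $L$ a reference length, $y$ the wall normal distance, and $f(x,t)$ a given body force. The unknowns are the velocity $v(x,t)$, the pressure $q(x,t)$ and a scalar function of time only, $k(t)$. The eddy viscosity is $$\nu_T=\sqrt2\,\mu\,k(t)\,\tau\ \text{(periodic)},\qquad \nu_T=\sqrt2\,\mu\,k(t)\Big(\kappa\frac{y}{L}\Big)^2\tau\ \text{(no-slip)},$$ and the model equations are $$v_t+v\cdot\nabla v-\nabla\cdot\big([2\nu+\nu_T]\nabla^s v\big)+\nabla q=f(x,t),\qquad \nabla\cdot v=0,$$ $$\frac{d}{dt}k(t)+\frac{\sqrt2}{2}\tau^{-1}k(t)=\varepsilon(t),\qquad \varepsilon(t):=\frac1{|\Omega|}\int_\Omega\nu_T|\nabla^s v|^2dx,$$ where $\nabla^s v$ is the symmetric part of the gradient $\nabla v$. The velocity is initialized at $t=0$ by $v(x,0)=v_0(x)$,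 and the $k$-equation is initialized at some $t^*\ge0$ by a given value $k(t^* )\neq0$. Standing assumption: the model, under periodic or no-slip boundary conditions, has a solution which is smooth enough for standard energy estimates.
   Formalization: The convergence part assumes the body force f is bounded in L²(Ω) uniformly in time (with f growing like e^t it fails), and, where the model leaves k undefined before t*, k ≥ 0 is required there. *)

theory Defs
  imports "HOL-Analysis.Analysis"
begin

definition grad_matrix :: "(real^'n \<Rightarrow> real^'n) \<Rightarrow> real^'n \<Rightarrow> real^'n^'n"
  where "grad_matrix u x = matrix (frechet_derivative u (at x))"

definition sym_grad :: "(real^'n \<Rightarrow> real^'n) \<Rightarrow> real^'n \<Rightarrow> real^'n^'n"
  where "sym_grad u x = (1 / 2) *\<^sub>R (grad_matrix u x + transpose (grad_matrix u x))"

definition divergence :: "(real^'n \<Rightarrow> real^'n) \<Rightarrow> real^'n \<Rightarrow> real"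
  where "divergence u x = trace (grad_matrix u x)"

definition tensor_divergence :: "(real^'n \<Rightarrow> real^'n^'n) \<Rightarrow> real^'n \<Rightarrow> real^'n"
  where "tensor_divergence S x = (\<chi> i. divergence (\<lambda>z. S z $ i) x)"

definition scalar_grad :: "(real^'n \<Rightarrow> real) \<Rightarrow> real^'n \<Rightarrow> real^'n"
  where "scalar_grad p x = (\<chi> i. frechet_derivative p (at x) (axis i 1))"

text \<open>
  \<open>No_Slip \<Omega>\<close> is a flow in \<open>\<Omega>\<close> with the wall \<open>frontier \<Omega>\<close>.  \<open>Periodic p\<close> is a flow which is
  periodic with period \<open>p $ i\<close> in the direction \<open>i\<close>; its flow domain is one period cell, but
  its fields are functions on the whole space.
\<close>

datatype 'n flow_region = No_Slip "(real^'n) set" | Periodic "real^'n"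

fun flow_domain :: "'n::finite flow_region \<Rightarrow> (real^'n) set" where
  "flow_domain (No_Slip \<Omega>) = \<Omega>"
| "flow_domain (Periodic p) = box 0 p"

fun field_domain :: "'n::finite flow_region \<Rightarrow> (real^'n) set" where
  "field_domain (No_Slip \<Omega>) = \<Omega>"
| "field_domain (Periodic p) = UNIV"

fun valid_region :: "'n::finite flow_region \<Rightarrow> bool" where
  "valid_region (No_Slip \<Omega>) \<longleftrightarrow> open \<Omega> \<and> connected \<Omega> \<and> bounded \<Omega> \<and> \<Omega> \<noteq> {}"
| "valid_region (Periodic p) \<longleftrightarrow> (\<forall>i. p $ i > 0)"

fun boundary_conditions ::
  "'n::finite flow_region \<Rightarrow> (real \<Rightarrow> real^'n \<Rightarrow> real^'n) \<Rightarrow> (real \<Rightarrow> real^'n \<Rightarrow> real) \<Rightarrow> bool" where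
  "boundary_conditions (No_Slip \<Omega>) v q \<longleftrightarrow> (\<forall>t\<ge>0. \<forall>x\<in>frontier \<Omega>. v t x = 0)"
| "boundary_conditions (Periodic p) v q \<longleftrightarrow>
     (\<forall>t\<ge>0. \<forall>x i. v t (x + axis i (p $ i)) = v t x \<and> q t (x + axis i (p $ i)) = q t x)"

text \<open>The wall normal distance \<open>y\<close> is the distance to the boundary of the flow domain.\<close>

fun eddy_viscosity ::
  "'n::finite flow_region \<Rightarrow> real \<Rightarrow> real \<Rightarrow> real \<Rightarrow> real \<Rightarrow> (real \<Rightarrow> real) \<Rightarrow> real \<Rightarrow> real^'n \<Rightarrow> real" where
  "eddy_viscosity (No_Slip \<Omega>) \<mu> \<kappa> L \<tau> k t x =
     sqrt 2 * \<mu> * k t * (\<kappa> * (infdist x (frontier \<Omega>) / L))\<^sup>2 * \<tau>"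
| "eddy_viscosity (Periodic p) \<mu> \<kappa> L \<tau> k t x = sqrt 2 * \<mu> * k t * \<tau>"

text \<open>The norm of \<^typ>\<open>real^'n^'n\<close> is the Frobenius norm.\<close>

definition dissipation_rate ::
  "'n::finite flow_region \<Rightarrow> (real^'n \<Rightarrow> real) \<Rightarrow> (real^'n \<Rightarrow> real^'n) \<Rightarrow> real" where
  "dissipation_rate R \<nu>T u =
     (1 / measure lebesgue (flow_domain R)) *
     (LINT x|lebesgue_on (flow_domain R). \<nu>T x * (norm (sym_grad u x))\<^sup>2)"

text \<open>
  The regularity that the energy estimates use.  In space the velocity is differentiable with
  Lipschitz gradient and the pressure is Lipschitz.  Twice continuously differentiable velocities
  are not assumed: the wall distance has a kink wherever the nearest wall point is not unique, and
  there the second derivatives of the velocity jump in general.  The time \<open>ts\<close>, at which the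
  equation for \<open>k\<close> starts, is left out because the eddy viscosity may jump there.
\<close>

definition model_times :: "real \<Rightarrow> real set"
  where "model_times ts = {0<..} - {ts}"

definition regular_fields ::
  "'n::finite flow_region \<Rightarrow> real \<Rightarrow> (real \<Rightarrow> real^'n \<Rightarrow> real^'n) \<Rightarrow> (real \<Rightarrow> real^'n \<Rightarrow> real) \<Rightarrow> bool" where
  "regular_fields R ts v q \<longleftrightarrow>
     continuous_on ({0..} \<times> closure (field_domain R)) (\<lambda>(t, x). v t x) \<and>
     (\<forall>t\<in>model_times ts. \<forall>x\<in>field_domain R. (\<lambda>s. v s x) differentiable at t) \<and>
     (\<forall>a b. {a..b} \<subseteq> model_times ts \<longrightarrow>
        bounded ((\<lambda>(t, x). vector_derivative (\<lambda>s. v s x) (at t)) ` ({a..b} \<times> flow_domain R))) \<and>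
     (\<forall>t\<in>model_times ts.
        (\<forall>x\<in>field_domain R. v t differentiable at x) \<and>
        (\<exists>C. C-lipschitz_on (field_domain R) (grad_matrix (v t))) \<and>
        (\<exists>C. C-lipschitz_on (field_domain R) (q t)))"

text \<open>
  By Rademacher's theorem Lipschitz functions are differentiable almost everywhere, so the momentum
  equation is meant at almost every point, with all derivatives classical.
\<close>

definition momentum_equation ::
  "'n::finite flow_region \<Rightarrow> real \<Rightarrow> real \<Rightarrow> (real \<Rightarrow> real^'n \<Rightarrow> real) \<Rightarrow> (real \<Rightarrow> real^'n \<Rightarrow> real^'n)
     \<Rightarrow> (real \<Rightarrow> real^'n \<Rightarrow> real^'n) \<Rightarrow> (real \<Rightarrow> real^'n \<Rightarrow> real) \<Rightarrow> bool" where
  "momentum_equation R ts \<nu> \<nu>T f v q \<longleftrightarrow>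
     (\<forall>t\<in>model_times ts. AE x in lebesgue_on (flow_domain R).
        grad_matrix (v t) differentiable at x \<and>
        (\<lambda>z. (2 * \<nu> + \<nu>T t z) *\<^sub>R sym_grad (v t) z) differentiable at x \<and>
        q t differentiable at x \<and>
        vector_derivative (\<lambda>s. v s x) (at t) + grad_matrix (v t) x *v v t x
          - tensor_divergence (\<lambda>z. (2 * \<nu> + \<nu>T t z) *\<^sub>R sym_grad (v t) z) x
          + scalar_grad (q t) x = f t x)"

text \<open>
  The velocity starts at time \<open>0\<close>, the equation for \<open>k\<close> at time \<open>ts\<close> with the value \<open>ks\<close>.  For times
  before \<open>ts\<close> the model has no equation for \<open>k\<close>; all that is required there is that the eddy
  viscosity is not negative.  This includes \<open>k = 0\<close> before \<open>ts\<close>, the Navier-Stokes equations.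
\<close>

definition half_equation_solution ::
  "'n::finite flow_region \<Rightarrow> real \<Rightarrow> real \<Rightarrow> real \<Rightarrow> real \<Rightarrow> (real \<Rightarrow> real^'n \<Rightarrow> real^'n)
     \<Rightarrow> (real^'n \<Rightarrow> real^'n) \<Rightarrow> real \<Rightarrow> real \<Rightarrow> real
     \<Rightarrow> (real \<Rightarrow> real^'n \<Rightarrow> real^'n) \<Rightarrow> (real \<Rightarrow> real^'n \<Rightarrow> real) \<Rightarrow> (real \<Rightarrow> real) \<Rightarrow> bool" where
  "half_equation_solution R \<nu> \<mu> \<kappa> L f v0 ts ks \<tau> v q k \<longleftrightarrow>
     regular_fields R ts v q \<and>
     boundary_conditions R v q \<and>
     (\<forall>x\<in>flow_domain R. v 0 x = v0 x) \<and>
     momentum_equation R ts \<nu> (eddy_viscosity R \<mu> \<kappa> L \<tau> k) f v q \<and>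
     (\<forall>t\<in>model_times ts. \<forall>x\<in>field_domain R. divergence (v t) x = 0) \<and>
     (\<forall>t. 0 \<le> t \<and> t < ts \<longrightarrow> 0 \<le> k t) \<and>
     k ts = ks \<and>
     continuous_on {ts..} k \<and>
     (\<forall>t>ts. k differentiable at t \<and>
        deriv k t + sqrt 2 / 2 * inverse \<tau> * k t =
          dissipation_rate R (eddy_viscosity R \<mu> \<kappa> L \<tau> k t) (v t))"

text \<open>The body force is in \<open>L\<^sup>\<infinity>(0,\<infinity>; L\<^sup>2(\<Omega>))\<close>.\<close>

definition bounded_force ::
  "'n::finite flow_region \<Rightarrow> (real \<Rightarrow> real^'n \<Rightarrow> real^'n) \<Rightarrow> bool" where
  "bounded_force R f \<longleftrightarrow>
     (\<exists>M. \<forall>t\<ge>0. f t \<in> borel_measurable (lebesgue_on (flow_domain R)) \<and>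
        integrable (lebesgue_on (flow_domain R)) (\<lambda>x. (norm (f t x))\<^sup>2) \<and>
        (LINT x|lebesgue_on (flow_domain R). (norm (f t x))\<^sup>2) \<le> M)"

end

theory Submission
  imports Defs
begin

text \<open>
  The equation for \<open>k\<close> is linear, \<open>k' = (b g - a) k\<close> with \<open>a = 1 / (\<surd>2 \<tau>)\<close>, \<open>b = \<surd>2 \<mu> \<tau>\<close> and the
  weighted mean \<open>g \<ge> 0\<close> of the squared symmetric gradient, so \<open>k\<close> keeps its sign.  If the total
  viscosity is at least \<open>\<nu>\<close>, testing the momentum equation with the velocity minus its mean (the
  mean is not controlled by the dissipation in the periodic case) and a Poincare inequality give
  \<open>E' + (\<nu> / 2) \<parallel>\<nabla>\<^sup>s v\<parallel>\<^sup>2 \<le> K\<close> for the energy \<open>E\<close> of the fluctuation, where \<open>K\<close> depends only on the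
  data.  Hence \<open>\<bar>k\<bar> exp (\<beta> E + (a - \<beta> K) t)\<close> is nonincreasing for a \<open>\<beta>\<close> proportional to \<open>\<tau>\<close>, which
  absorbs \<open>b g\<close>; and \<open>a > \<beta> K\<close> for small \<open>\<tau>\<close>.  For \<open>k < 0\<close> the lower bound on the viscosity is kept
  by a continuity argument.

  All integrations by parts are instances of one divergence theorem for Lipschitz fluxes that vanish
  at the wall or are periodic.  It is proved with difference quotients and dominated convergence, so
  no regularity of the boundary and no second derivatives are needed.
\<close>

text \<open>The data give no bound on \<open>g\<close> at a single time. The energy inequality
  controls \<open>g\<close> only through \<open>E'\<close>, so \<open>b g - a\<close> cannot be
  estimated pointwise; the exponent \<open>\<beta> E\<close> trades \<open>g\<close> for a decrease
  of the energy. The size of \<open>\<beta>\<close> comes from matching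
  \<open>\<beta> * (\<nu> / 2)\<close> with \<open>b * W / m\<close>, where \<open>W\<close> bounds
  the wall weight and \<open>m\<close> is the measure of the flow domain. Since \<open>b\<close>
  carries a factor \<open>\<tau>\<close>, so does \<open>\<beta>\<close>, while \<open>a\<close>
  carries \<open>inverse \<tau>\<close>; this opposition produces the threshold. The threshold must
  be fixed before the solution is known, so the energy at time \<open>ts\<close> has to be bounded
  by data: up to \<open>ts\<close> the eddy viscosity is nonnegative and the energy grows at most at
  the rate \<open>K\<close>. The molecular part of the viscosity is \<open>2 * \<nu>\<close>. One
  \<open>\<nu>\<close> is held in reserve against a negative eddy viscosity, half of the other pays
  for the force, and \<open>\<nu> / 2\<close> remains to absorb \<open>g\<close>.\<close>

section \<open>Integrals over Lebesgue sets, their shifts and integrability\<close>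

lemma integral_lebesgue_on_lborel:
  fixes f :: "'a::euclidean_space \<Rightarrow> 'b::{banach, second_countable_topology}"
  assumes "f \<in> borel_measurable borel" "S \<in> sets borel"
  shows "(LINT x|lebesgue_on S. f x) = (LINT x|lborel. indicator S x *\<^sub>R f x)"
proof -
  have "(LINT x|lebesgue_on S. f x) = (LINT x|lebesgue. indicator S x *\<^sub>R f x)"
    using assms by (intro integral_restrict_space) auto
  also have "\<dots> = (LINT x|lborel. indicator S x *\<^sub>R f x)"
    using assms by (intro integral_completion) simp
  finally show ?thesis .
qed

lemma integral_lborel_shift:
  fixes f :: "'a::euclidean_space \<Rightarrow> 'b::{banach, second_countable_topology}"
  assumes [measurable]: "f \<in> borel_measurable borel"
  shows "(LINT x|lborel. f (x + c)) = (LINT x|lborel. f x)"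
proof -
  have "(LINT x|lborel. f x) = (LINT x|distr lborel borel ((+) c). f x)"
    by (simp add: lborel_distr_plus)
  also have "\<dots> = (LINT x|lborel. f (c + x))"
    by (intro integral_distr) auto
  finally show ?thesis by (simp add: add.commute)
qed

lemma integrable_bounded_continuous:
  fixes f :: "'a::euclidean_space \<Rightarrow> 'b::euclidean_space"
  assumes "A \<in> lmeasurable" "continuous_on A f" "\<And>x. x \<in> A \<Longrightarrow> norm (f x) \<le> B"
  shows "integrable (lebesgue_on A) f"
proof -
  interpret finite_measure "lebesgue_on A"
    using assms(1) by (rule finite_measure_lebesgue_on)
  show ?thesis
    using assms by (intro integrable_const_bound[where B=B] AE_I2)
      (auto intro: continuous_imp_measurable_on_sets_lebesgue)
qed

subsection \<open>Periodic functions\<close>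

text \<open>For positive periods the translates of the half-open cell tile the space without
  overlap, so a shifted cell can be cut and reassembled exactly.\<close>

definition half_open_cell :: "real^'n \<Rightarrow> (real^'n) set"
  where "half_open_cell p = {x. \<forall>j. 0 \<le> x$j \<and> x$j < p$j}"

lemma half_open_cell_borel [measurable]: "half_open_cell p \<in> sets borel"
proof -
  have "half_open_cell p = (\<Inter>j. {x. 0 \<le> x$j} \<inter> {x. x$j < p$j})"
    by (auto simp: half_open_cell_def)
  also have "\<dots> \<in> sets borel"
    by (intro sets.countable_INT'') 
      (auto intro!: sets.Int borel_closed borel_open closed_Collect_le open_Collect_less continuous_intros)
  finally show ?thesis .
qed

text \<open>The half-open cell lies between \<open>box 0 p\<close> and \<open>cbox 0 p\<close>,
  which have the same measure.\<close>

lemma integral_box_eq_half_open_cell: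
  fixes f :: "real^'n \<Rightarrow> 'b::{banach, second_countable_topology}"
  assumes [measurable]: "f \<in> borel_measurable borel"
  shows "(LINT x|lebesgue_on (box 0 p). f x)
     = (LINT x|lborel. indicator (half_open_cell p) x *\<^sub>R f x)"
proof -
  have "AE x in lborel. x \<notin> cbox 0 p - box 0 p"
  proof (rule AE_not_in)
    have "emeasure lborel (cbox 0 p - box 0 p) = emeasure lborel (cbox 0 p) - emeasure lborel (box 0 p)"
      by (rule emeasure_Diff) (auto simp: box_subset_cbox emeasure_lborel_box_eq)
    then show "cbox 0 p - box 0 p \<in> null_sets lborel"
      by (auto simp: null_sets_def emeasure_lborel_cbox_eq emeasure_lborel_box_eq)
  qed
  then have "AE x in lborel. indicator (box 0 p) x *\<^sub>R f x = indicator (half_open_cell p) x *\<^sub>R f x"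
  proof eventually_elim
    case (elim x)
    have "x \<in> box 0 p \<Longrightarrow> x \<in> half_open_cell p"
      by (auto simp: half_open_cell_def mem_box_cart less_imp_le)
    moreover have "x \<in> half_open_cell p \<Longrightarrow> x \<in> cbox 0 p"
      by (auto simp: half_open_cell_def mem_box_cart less_imp_le)
    ultimately show ?case using elim by (auto simp: indicator_def)
  qed
  then show ?thesis
    by (subst integral_lebesgue_on_lborel) (auto intro!: integral_cong_AE)
qed

text \<open>The shifted cell meets the original one in \<open>A\<close>, and the slab that sticks
  out is \<open>A'\<close> moved by one period. Periodicity brings the slab back, and
  \<open>A\<close> and \<open>A'\<close> together are the cell.\<close>

lemma integral_cell_shift_axis:
  fixes F :: "real^'n \<Rightarrow> 'b::euclidean_space"
  assumes cont: "continuous_on UNIV F"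
    and per: "\<And>x i. F (x + axis i (p$i)) = F x"
    and h: "0 \<le> h" "h \<le> p$i"
  shows "(LINT x|lebesgue_on (box 0 p). F (x + h *\<^sub>R axis i 1)) = (LINT x|lebesgue_on (box 0 p). F x)"
proof -
  let ?C = "half_open_cell p"
  have [measurable]: "F \<in> borel_measurable borel"
    by (rule borel_measurable_continuous_onI[OF cont])
  obtain B where B: "\<And>x. x \<in> cbox (- (2 *\<^sub>R p)) (2 *\<^sub>R p) \<Longrightarrow> norm (F x) \<le> B"
    using compact_imp_bounded[OF compact_continuous_image[OF continuous_on_subset[OF cont]], of "cbox (- (2 *\<^sub>R p)) (2 *\<^sub>R p)"]
    by (auto simp: bounded_iff)
  define A where "A = {x \<in> ?C. h \<le> x$i}"
  define A' where "A' = {x \<in> ?C. x$i < h}"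
  define G where "G x = indicator A' (x - axis i (p$i)) *\<^sub>R F x" for x
  have half: "{x::real^'n. h \<le> x$i} \<in> sets borel" "{x::real^'n. x$i < h} \<in> sets borel"
    by (auto intro!: borel_closed borel_open closed_Collect_le open_Collect_less continuous_intros)
  have A[measurable]: "A \<in> sets borel" "A' \<in> sets borel"
  proof -
    have "A = ?C \<inter> {x. h \<le> x$i}" "A' = ?C \<inter> {x. x$i < h}" by (auto simp: A_def A'_def)
    then show "A \<in> sets borel" "A' \<in> sets borel" using half by (simp_all add: sets.Int)
  qed
  have sub: "?C \<subseteq> cbox (- (2 *\<^sub>R p)) (2 *\<^sub>R p)"
  proof
    fix x assume "x \<in> ?C"
    then have *: "0 \<le> x$j" "x$j < p$j" for j by (auto simp: half_open_cell_def)
    have "- (2 * p$j) \<le> x$j \<and> x$j \<le> 2 * p$j" for j using *[of j] by linarith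
    then show "x \<in> cbox (- (2 *\<^sub>R p)) (2 *\<^sub>R p)" by (simp add: mem_box_cart)
  qed
  have intg: "integrable lborel (\<lambda>x. indicator S x *\<^sub>R F x)" if "S \<in> sets borel" "S \<subseteq> ?C" for S
  proof (rule Bochner_Integration.integrable_bound)
    show "integrable lborel (\<lambda>x. indicator (cbox (- (2 *\<^sub>R p)) (2 *\<^sub>R p)) x *\<^sub>R B)"
      by (intro integrable_scaleR_left impI integrable_real_indicator)
        (use emeasure_bounded_finite[OF bounded_cbox] in auto)
    show "(\<lambda>x. indicator S x *\<^sub>R F x) \<in> borel_measurable lborel" using that by measurable
    show "AE x in lborel. norm (indicator S x *\<^sub>R F x) \<le> norm (indicator (cbox (- (2 *\<^sub>R p)) (2 *\<^sub>R p)) x *\<^sub>R B)"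
      using that sub B by (intro AE_I2) (fastforce simp: indicator_def)
  qed
  have perd: "F (x - axis i (p$i)) = F x" for x using per[of "x - axis i (p$i)" i] by simp
  have G_eq: "G x = (\<lambda>x. indicator A' x *\<^sub>R F x) (x - axis i (p$i))" for x
    by (simp add: G_def perd)
  have iG: "integrable lborel G"
  proof -
    have "integrable (distr lborel borel ((+) (- axis i (p$i)))) (\<lambda>x. indicator A' x *\<^sub>R F x)"
      using intg[of A'] by (simp only: lborel_distr_plus) (auto simp: A'_def)
    then have "integrable lborel (\<lambda>x. (\<lambda>x. indicator A' x *\<^sub>R F x) (- axis i (p$i) + x))"
      by (subst (asm) integrable_distr_eq) auto
    then show ?thesis by (rule back_subst[where P="integrable lborel"]) (auto simp: G_eq fun_eq_iff)
  qed
  have split: "indicator ?C (x - h *\<^sub>R axis i 1) *\<^sub>R F x = indicator A x *\<^sub>R F x + G x" for x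
  proof -
    have "(x - h *\<^sub>R axis i 1 \<in> ?C) \<longleftrightarrow> (x \<in> A \<or> x - axis i (p$i) \<in> A')"
      "\<not> (x \<in> A \<and> x - axis i (p$i) \<in> A')"
    proof -
      have ax: "(x - h *\<^sub>R axis i 1)$j = x$j - (if j = i then h else 0)"
        "(x - axis i (p$i))$j = x$j - (if j = i then p$i else 0)" for j
        by (simp_all add: axis_def)
      have split_all: "(\<forall>j. P j) \<longleftrightarrow> P i \<and> (\<forall>j. j \<noteq> i \<longrightarrow> P j)" for P by metis
      have 1: "(x - h *\<^sub>R axis i 1 \<in> ?C) \<longleftrightarrow> (0 \<le> x$i - h \<and> x$i - h < p$i) \<and> (\<forall>j. j \<noteq> i \<longrightarrow> 0 \<le> x$j \<and> x$j < p$j)"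
        unfolding half_open_cell_def mem_Collect_eq ax by (subst split_all) simp
      have 2: "x \<in> A \<longleftrightarrow> (h \<le> x$i \<and> 0 \<le> x$i \<and> x$i < p$i) \<and> (\<forall>j. j \<noteq> i \<longrightarrow> 0 \<le> x$j \<and> x$j < p$j)"
        unfolding A_def half_open_cell_def mem_Collect_eq by (subst split_all) blast
      have 3: "x - axis i (p$i) \<in> A' \<longleftrightarrow> (x$i - p$i < h \<and> 0 \<le> x$i - p$i \<and> x$i - p$i < p$i) \<and> (\<forall>j. j \<noteq> i \<longrightarrow> 0 \<le> x$j \<and> x$j < p$j)"
        unfolding A'_def half_open_cell_def mem_Collect_eq ax by (subst split_all) auto
      \<comment> \<open>In the coordinate \<open>i\<close> the interval from \<open>h\<close> to
        \<open>h + p $ i\<close> is cut at \<open>p $ i\<close>. Because of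
        \<open>h \<le> p $ i\<close>, one period is enough to bring the second piece back.\<close>
      have r: "(0 \<le> x$i - h \<and> x$i - h < p$i) \<longleftrightarrow> (h \<le> x$i \<and> 0 \<le> x$i \<and> x$i < p$i) \<or> (x$i - p$i < h \<and> 0 \<le> x$i - p$i \<and> x$i - p$i < p$i)"
        using h by argo
      show "(x - h *\<^sub>R axis i 1 \<in> ?C) \<longleftrightarrow> (x \<in> A \<or> x - axis i (p$i) \<in> A')"
        unfolding 1 2 3 r by blast
      show "\<not> (x \<in> A \<and> x - axis i (p$i) \<in> A')" unfolding 2 3 by auto
    qed
    then show ?thesis by (auto simp: G_def indicator_def)
  qed
  have "(LINT x|lebesgue_on (box 0 p). F (x + h *\<^sub>R axis i 1))
      = (LINT x|lborel. indicator ?C x *\<^sub>R F (x + h *\<^sub>R axis i 1))"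
    by (rule integral_box_eq_half_open_cell) measurable
  also have "\<dots> = (LINT x|lborel. (\<lambda>x. indicator ?C (x - h *\<^sub>R axis i 1) *\<^sub>R F x) (x + h *\<^sub>R axis i 1))"
    by simp
  also have "\<dots> = (LINT x|lborel. indicator ?C (x - h *\<^sub>R axis i 1) *\<^sub>R F x)"
    by (rule integral_lborel_shift) measurable
  also have "\<dots> = (LINT x|lborel. indicator A x *\<^sub>R F x) + (LINT x|lborel. G x)"
    unfolding split by (intro Bochner_Integration.integral_add iG intg A) (auto simp: A_def)
  also have "(LINT x|lborel. G x) = (LINT x|lborel. indicator A' x *\<^sub>R F x)"
    using integral_lborel_shift[of "\<lambda>x. indicator A' x *\<^sub>R F x" "- axis i (p$i)"]
    by (simp add: G_eq)
  also have "(LINT x|lborel. indicator A x *\<^sub>R F x) + (LINT x|lborel. indicator A' x *\<^sub>R F x)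
     = (LINT x|lborel. indicator A x *\<^sub>R F x + indicator A' x *\<^sub>R F x)"
    by (intro Bochner_Integration.integral_add[symmetric] intg A) (auto simp: A_def A'_def)
  also have "\<dots> = (LINT x|lborel. indicator ?C x *\<^sub>R F x)"
    by (intro Bochner_Integration.integral_cong) (auto simp: A_def A'_def indicator_def)
  also have "\<dots> = (LINT x|lebesgue_on (box 0 p). F x)"
    by (rule integral_box_eq_half_open_cell[symmetric]) measurable
  finally show ?thesis .
qed

text \<open>One axis at a time: the part of the shift already treated is absorbed in the integrand,
  which stays continuous and periodic.\<close>

lemma integral_cell_shift:
  fixes F :: "real^'n \<Rightarrow> 'b::euclidean_space"
  assumes cont: "continuous_on UNIV F"
    and per: "\<And>x i. F (x + axis i (p$i)) = F x"
    and z: "\<And>i. 0 \<le> z$i" "\<And>i. z$i \<le> p$i"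
  shows "(LINT x|lebesgue_on (box 0 p). F (x + z)) = (LINT x|lebesgue_on (box 0 p). F x)"
proof -
  have "(LINT x|lebesgue_on (box 0 p). F (x + (\<Sum>i\<in>I. z$i *\<^sub>R axis i 1))) = (LINT x|lebesgue_on (box 0 p). F x)"
    if "finite I" for I
    using that
  proof (induction I)
    case empty
    then show ?case by simp
  next
    case (insert i I)
    let ?s = "\<Sum>i\<in>I. z$i *\<^sub>R axis i 1"
    have "(LINT x|lebesgue_on (box 0 p). F ((x + z$i *\<^sub>R axis i 1) + ?s)) = (LINT x|lebesgue_on (box 0 p). F (x + ?s))"
    proof (rule integral_cell_shift_axis[where F="\<lambda>x. F (x + ?s)"])
      show "continuous_on UNIV (\<lambda>x. F (x + ?s))"
        by (rule continuous_on_compose2[OF cont]) (auto intro!: continuous_intros)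
      show "F (x + axis i (p$i) + ?s) = F (x + ?s)" for x i
        using per[of "x + ?s" i] by (simp add: algebra_simps)
    qed (use z in auto)
    then show ?case using insert by (simp add: algebra_simps)
  qed
  from this[of UNIV] have "(LINT x|lebesgue_on (box 0 p). F (x + (\<Sum>i\<in>UNIV. z$i *s axis i 1))) = (LINT x|lebesgue_on (box 0 p). F x)"
    by (simp add: scalar_mult_eq_scaleR)
  then show ?thesis by (simp only: basis_expansion)
qed

section \<open>Partial derivatives and limits of difference quotients\<close>

text \<open>A derivative along one axis is all that the limit of a difference quotient requires, and
  it reduces sums and products of fluxes to one-variable rules.\<close>

definition has_partial :: "(real^'n \<Rightarrow> real) \<Rightarrow> 'n \<Rightarrow> real \<Rightarrow> real^'n \<Rightarrow> bool"
  where "has_partial F i d x \<longleftrightarrow> ((\<lambda>h. F (x + h *\<^sub>R axis i 1)) has_real_derivative d) (at 0)"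

lemma has_partial_frechet:
  assumes "F differentiable at x"
  shows "has_partial F i (frechet_derivative F (at x) (axis i 1)) x"
proof -
  have "(F has_derivative frechet_derivative F (at x)) (at x)"
    using assms frechet_derivative_works by blast
  moreover have "((\<lambda>h. x + h *\<^sub>R axis i 1) has_derivative (\<lambda>h. h *\<^sub>R axis i 1)) (at 0)"
    by (auto intro!: derivative_eq_intros)
  ultimately have "(F \<circ> (\<lambda>h. x + h *\<^sub>R axis i 1) has_derivative frechet_derivative F (at x) \<circ> (\<lambda>h. h *\<^sub>R axis i 1)) (at 0)"
    by (intro diff_chain_at) auto
  moreover have "frechet_derivative F (at x) \<circ> (\<lambda>h. h *\<^sub>R axis i 1) = (*) (frechet_derivative F (at x) (axis i 1))"
    using assms linear_frechet_derivative[OF assms] by (auto simp: linear_cmul)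
  ultimately show ?thesis
    unfolding has_partial_def has_field_derivative_def by (simp only: o_def)
qed

lemma has_partial_grad_matrix:
  assumes "u differentiable at x"
  shows "has_partial (\<lambda>z. u z $ j) i (grad_matrix u x $ j $ i) x"
proof -
  have D: "(u has_derivative frechet_derivative u (at x)) (at x)"
    using assms frechet_derivative_works by blast
  then have D': "((\<lambda>z. u z $ j) has_derivative (\<lambda>h. frechet_derivative u (at x) h $ j)) (at x)"
    by (rule bounded_linear.has_derivative[OF bounded_linear_vec_nth])
  then have "frechet_derivative (\<lambda>z. u z $ j) (at x) = (\<lambda>h. frechet_derivative u (at x) h $ j)"
    using frechet_derivative_at by metis
  moreover have "(\<lambda>z. u z $ j) differentiable at x" using D' differentiable_def by blast
  ultimately show ?thesis
    using has_partial_frechet[of "\<lambda>z. u z $ j" x i] by (simp add: grad_matrix_def matrix_def)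
qed

text \<open>Partial derivatives are local. This lets a flux on an open domain be replaced by its
  extension by zero.\<close>

lemma has_partial_cong:
  assumes "has_partial F i d x" "open S" "x \<in> S" "\<And>y. y \<in> S \<Longrightarrow> F y = G y"
  shows "has_partial G i d x"
proof -
  have "((\<lambda>h::real. x + h *\<^sub>R axis i 1) \<longlongrightarrow> x + 0 *\<^sub>R axis i 1) (nhds 0)"
    by (intro tendsto_intros filterlim_ident)
  then have "((\<lambda>h::real. x + h *\<^sub>R axis i 1) \<longlongrightarrow> x) (nhds 0)" by simp
  then have "\<forall>\<^sub>F h::real in nhds 0. x + h *\<^sub>R axis i 1 \<in> S"
    by (rule topological_tendstoD) (use assms in auto)
  then have "\<forall>\<^sub>F h::real in nhds 0. F (x + h *\<^sub>R axis i 1) = G (x + h *\<^sub>R axis i 1)"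
    by eventually_elim (use assms in auto)
  then show ?thesis
    using assms(1) unfolding has_partial_def
    by (subst (asm) DERIV_cong_ev[OF refl _ refl]) auto
qed

lemma diff_quotient_tendsto_partial:
  assumes "has_partial F i d x" "h \<longlonglongrightarrow> 0" "\<And>n. h n \<noteq> 0"
  shows "(\<lambda>n. (F (x + h n *\<^sub>R axis i 1) - F x) / h n) \<longlonglongrightarrow> d"
proof -
  have "((\<lambda>h. (F (x + h *\<^sub>R axis i 1) - F x) / h) \<longlongrightarrow> d) (at 0)"
    using assms(1) unfolding has_partial_def DERIV_def by simp
  then show ?thesis
    by (rule filterlim_compose[of _ _ _ h]) (use assms in \<open>auto simp: filterlim_at\<close>)
qed

text \<open>The values of \<open>F\<close> that the shift moves into \<open>\<Omega>\<close> are of the size of the shift, and the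
  measure of the set on which they are taken tends to \<open>0\<close>.\<close>

lemma integral_diff_quotient_tendsto_0:
  fixes F :: "real^'n \<Rightarrow> real" and h :: "nat \<Rightarrow> real"
  assumes "open \<Omega>" "bounded \<Omega>"
    and lip: "C-lipschitz_on UNIV F" and zero: "\<And>x. x \<notin> \<Omega> \<Longrightarrow> F x = 0"
    and h: "h \<longlonglongrightarrow> 0" "\<And>n. h n > 0"
  shows "(\<lambda>n. LINT x|lebesgue_on \<Omega>. (F (x + h n *\<^sub>R axis i 1) - F x) / h n) \<longlonglongrightarrow> 0"
proof -
  have cont: "continuous_on UNIV F" using lip by (rule lipschitz_on_continuous_on)
  then have [measurable]: "F \<in> borel_measurable borel" by (rule borel_measurable_continuous_onI)
  have [measurable]: "\<Omega> \<in> sets borel" using assms by auto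
  have C: "C \<ge> 0" using lip by (rule lipschitz_on_nonneg)
  have "integrable lborel (\<lambda>x. indicator (closure \<Omega>) x *\<^sub>R F x)"
    by (rule borel_integrable_compact) (use assms cont in \<open>auto intro: continuous_on_subset\<close>)
  moreover have "(\<lambda>x. indicator (closure \<Omega>) x *\<^sub>R F x) = F"
    using zero closure_subset[of \<Omega>] by (auto simp: indicator_def fun_eq_iff)
  ultimately have iF: "integrable lborel F" by simp
  \<comment> \<open>A change of variables moves the shift from \<open>F\<close> to the indicator of
    \<Omega>. What is left is supported where exactly one of \<open>x\<close> and the back-shifted
    point lies in \<Omega>.\<close>
  define u where "u n x = (indicator \<Omega> (x - h n *\<^sub>R axis i 1) - indicator \<Omega> x) * (F x / h n)" for n x
  have iu: "integrable lborel (\<lambda>x. indicator \<Omega> (x - c) * (F x / h n))" for c n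
    by (rule Bochner_Integration.integrable_bound[of _ "\<lambda>x. F x / h n"])
      (use iF in \<open>auto simp: indicator_def intro!: AE_I2\<close>)
  have eq: "(LINT x|lebesgue_on \<Omega>. (F (x + h n *\<^sub>R axis i 1) - F x) / h n) = (LINT x|lborel. u n x)" for n
  proof -
    have i0: "integrable lborel (\<lambda>x. indicator \<Omega> x * (F x / h n))" using iu[of 0 n] by simp
    have i1: "integrable lborel (\<lambda>x. indicator \<Omega> x * (F (x + h n *\<^sub>R axis i 1) / h n))"
    proof -
      have "integrable (distr lborel borel ((+) (h n *\<^sub>R axis i 1))) (\<lambda>x. indicator \<Omega> (x - h n *\<^sub>R axis i 1) * (F x / h n))"
        using iu by (simp only: lborel_distr_plus)
      then show ?thesis
        by (subst (asm) integrable_distr_eq) (auto simp: add.commute)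
    qed
    have "(LINT x|lebesgue_on \<Omega>. (F (x + h n *\<^sub>R axis i 1) - F x) / h n)
      = (LINT x|lborel. indicator \<Omega> x *\<^sub>R ((F (x + h n *\<^sub>R axis i 1) - F x) / h n))"
      by (rule integral_lebesgue_on_lborel) measurable
    also have "\<dots> = (LINT x|lborel. indicator \<Omega> x * (F (x + h n *\<^sub>R axis i 1) / h n))
       - (LINT x|lborel. indicator \<Omega> x * (F x / h n))"
      by (subst Bochner_Integration.integral_diff[symmetric, OF i1 i0])
        (simp only: diff_divide_distrib right_diff_distrib real_scaleR_def)
    also have "(LINT x|lborel. indicator \<Omega> x * (F (x + h n *\<^sub>R axis i 1) / h n))
       = (LINT x|lborel. indicator \<Omega> (x - h n *\<^sub>R axis i 1) * (F x / h n))"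
      using integral_lborel_shift[of "\<lambda>x. indicator \<Omega> (x - h n *\<^sub>R axis i 1) * (F x / h n)" "h n *\<^sub>R axis i 1"]
      by simp
    also have "\<dots> - (LINT x|lborel. indicator \<Omega> x * (F x / h n)) = (LINT x|lborel. u n x)"
      unfolding u_def by (subst Bochner_Integration.integral_diff[symmetric, OF iu i0]) (simp only: left_diff_distrib)
    finally show ?thesis .
  qed
  have "(\<lambda>n. LINT x|lborel. u n x) \<longlonglongrightarrow> (LINT x|(lborel::(real^'n) measure). 0)"
  proof (rule integral_dominated_convergence)
    show "integrable lborel (\<lambda>x. C * indicator \<Omega> x)"
      using emeasure_bounded_finite[OF assms(2)] by (intro integrable_mult_right) auto
    show "u n \<in> borel_measurable lborel" for n unfolding u_def by measurable
    show "AE x in lborel. norm (u n x) \<le> C * indicator \<Omega> x" for n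
    proof (rule AE_I2)
      fix x
      \<comment> \<open>At a back-shifted point outside \<Omega> the flux is zero, so
        \<open>F x\<close> is itself an increment over the distance \<open>h n\<close>; this
        compensates the division by \<open>h n\<close>.\<close>
      have "\<bar>F x\<bar> / h n \<le> C" if "x - h n *\<^sub>R axis i 1 \<notin> \<Omega>"
      proof -
        have "\<bar>F x - F (x - h n *\<^sub>R axis i 1)\<bar> \<le> C * dist x (x - h n *\<^sub>R axis i 1)"
          using lipschitz_onD[OF lip, of x "x - h n *\<^sub>R axis i 1"] by (simp add: dist_real_def)
        also have "dist x (x - h n *\<^sub>R axis i 1) = h n"
          using h(2)[of n] by (simp add: dist_norm norm_axis_1)
        finally show ?thesis
          using zero[OF that] h(2)[of n] by (simp add: divide_le_eq)
      qed
      then show "norm (u n x) \<le> C * indicator \<Omega> x"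
        using C zero[of x] h(2)[of n] unfolding u_def by (auto simp: indicator_def abs_mult)
    qed
    show "AE x in lborel. (\<lambda>n. u n x) \<longlonglongrightarrow> 0"
    proof (rule AE_I2)
      fix x
      show "(\<lambda>n. u n x) \<longlonglongrightarrow> 0"
      proof (cases "x \<in> \<Omega>")
        case True
        \<comment> \<open>An open set contains the back-shifted point for all small shifts, so
          \<open>u n x\<close> is eventually exactly zero. No estimate of a boundary layer
          enters.\<close>
        have "(\<lambda>n. x - h n *\<^sub>R axis i 1) \<longlonglongrightarrow> x - 0 *\<^sub>R axis i 1" by (intro tendsto_intros h)
        then have "\<forall>\<^sub>F n in sequentially. x - h n *\<^sub>R axis i 1 \<in> \<Omega>"
          using assms(1) True by (intro topological_tendstoD) auto
        then have "\<forall>\<^sub>F n in sequentially. u n x = 0"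
          by eventually_elim (use True in \<open>auto simp: u_def\<close>)
        then show ?thesis by (rule tendsto_eventually)
      next
        case False
        then show ?thesis by (simp add: u_def zero)
      qed
    qed
  qed simp
  then show ?thesis unfolding eq by simp
qed

text \<open>Almost everywhere \<open>D\<close> is the limit of sums of difference quotients, and the
  Lipschitz constants dominate these on a set of finite measure. Hence the integral of
  \<open>D\<close> is the limit of their integrals, whatever makes these tend to zero: vanishing at
  a wall or periodicity.\<close>

lemma integral_divergence_0:
  fixes F :: "'n \<Rightarrow> real^'n \<Rightarrow> real"
  assumes A: "A \<in> lmeasurable"
    and lip: "\<And>i. \<exists>C. C-lipschitz_on UNIV (F i)"
    and quot: "\<And>i. (\<lambda>n. LINT x|lebesgue_on A. (F i (x + h n *\<^sub>R axis i 1) - F i x) / h n) \<longlonglongrightarrow> 0"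
    and h: "h \<longlonglongrightarrow> 0" "\<And>n. h n > 0"
    and D: "D \<in> borel_measurable (lebesgue_on A)"
    and AE: "AE x in lebesgue_on A. \<exists>d. (\<forall>i. has_partial (F i) i (d i) x) \<and> D x = (\<Sum>i\<in>UNIV. d i)"
  shows "integrable (lebesgue_on A) D" "(LINT x|lebesgue_on A. D x) = 0"
proof -
  interpret finite_measure "lebesgue_on A"
    using A by (rule finite_measure_lebesgue_on)
  obtain C where C: "\<And>i. (C i)-lipschitz_on UNIV (F i)" using lip by metis
  define s where "s n i x = (F i (x + h n *\<^sub>R axis i 1) - F i x) / h n" for n i x
  have cont: "continuous_on UNIV (F i)" for i using C by (rule lipschitz_on_continuous_on)
  have cs: "continuous_on UNIV (s n i)" for n i
    unfolding s_def using h(2)[of n]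
    by (intro continuous_intros continuous_on_compose2[OF cont]) auto
  have sC: "norm (s n i x) \<le> C i" for n i x
  proof -
    have "\<bar>F i (x + h n *\<^sub>R axis i 1) - F i x\<bar> \<le> C i * h n"
      using lipschitz_onD[OF C, of "x + h n *\<^sub>R axis i 1" x i] h(2)[of n] by (simp add: dist_norm norm_axis_1)
    then show ?thesis using h(2)[of n] by (simp add: s_def abs_divide divide_le_eq)
  qed
  have int: "integrable (lebesgue_on A) (s n i)" for n i
    by (rule integrable_bounded_continuous[OF A continuous_on_subset[OF cs] sC]) auto
  have lim: "AE x in lebesgue_on A. (\<lambda>n. \<Sum>i\<in>UNIV. s n i x) \<longlonglongrightarrow> D x"
    using AE
  proof eventually_elim
    case (elim x)
    then obtain d where d: "\<And>i. has_partial (F i) i (d i) x" "D x = (\<Sum>i\<in>UNIV. d i)" by blast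
    have "(\<lambda>n. s n i x) \<longlonglongrightarrow> d i" for i
      unfolding s_def by (rule diff_quotient_tendsto_partial[OF d(1) h(1)]) (metis h(2) less_irrefl)
    then show ?case unfolding d(2) by (intro tendsto_sum) auto
  qed
  have bd: "AE x in lebesgue_on A. norm (\<Sum>i\<in>UNIV. s n i x) \<le> (\<Sum>i\<in>UNIV. C i)" for n
    by (intro AE_I2 order_trans[OF norm_sum] sum_mono sC)
  have meas: "(\<lambda>x. \<Sum>i\<in>UNIV. s n i x) \<in> borel_measurable (lebesgue_on A)" for n
    using int by (intro borel_measurable_sum) auto
  show "integrable (lebesgue_on A) D"
    by (rule integrable_dominated_convergence[OF D meas _ lim bd]) simp
  have "(\<lambda>n. LINT x|lebesgue_on A. (\<Sum>i\<in>UNIV. s n i x)) \<longlonglongrightarrow> (LINT x|lebesgue_on A. D x)"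
    by (rule integral_dominated_convergence[OF D meas _ lim bd]) simp
  moreover have "(\<lambda>n. LINT x|lebesgue_on A. (\<Sum>i\<in>UNIV. s n i x)) \<longlonglongrightarrow> 0"
  proof -
    have "(\<lambda>n. \<Sum>i\<in>UNIV. LINT x|lebesgue_on A. s n i x) \<longlonglongrightarrow> (\<Sum>i\<in>(UNIV::'n set). 0)"
      unfolding s_def by (intro tendsto_sum quot)
    then show ?thesis by (subst Bochner_Integration.integral_sum) (use int in auto)
  qed
  ultimately show "(LINT x|lebesgue_on A. D x) = 0" by (rule LIMSEQ_unique)
qed

lemma has_partial_const: "has_partial (\<lambda>_. c) i 0 x"
  by (simp add: has_partial_def)

lemma has_partial_add:
  "has_partial F i a x \<Longrightarrow> has_partial G i b x \<Longrightarrow> has_partial (\<lambda>x. F x + G x) i (a + b) x"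
  unfolding has_partial_def by (rule DERIV_add)

lemma has_partial_diff:
  "has_partial F i a x \<Longrightarrow> has_partial G i b x \<Longrightarrow> has_partial (\<lambda>x. F x - G x) i (a - b) x"
  unfolding has_partial_def by (rule DERIV_diff)

lemma has_partial_mult:
  "has_partial F i a x \<Longrightarrow> has_partial G i b x \<Longrightarrow> has_partial (\<lambda>x. F x * G x) i (a * G x + F x * b) x"
  unfolding has_partial_def by (auto intro!: derivative_eq_intros)

lemma has_partial_sum:
  "(\<And>j. j \<in> J \<Longrightarrow> has_partial (F j) i (a j) x) \<Longrightarrow> has_partial (\<lambda>x. \<Sum>j\<in>J. F j x) i (\<Sum>j\<in>J. a j) x"
  unfolding has_partial_def by (rule DERIV_sum)

lemma has_partial_coord: "has_partial (\<lambda>x. x $ i) i 1 x"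
  unfolding has_partial_def by (auto intro!: derivative_eq_intros simp: axis_def)

subsection \<open>Fields on a flow region\<close>

fun periodic_field :: "'n::finite flow_region \<Rightarrow> (real^'n \<Rightarrow> 'b) \<Rightarrow> bool" where
  "periodic_field (No_Slip \<Omega>) F \<longleftrightarrow> True"
| "periodic_field (Periodic p) F \<longleftrightarrow> (\<forall>x i. F (x + axis i (p $ i)) = F x)"

text \<open>Boundedness is part of the notion because products of Lipschitz functions are Lipschitz
  only if the factors are bounded. The class is thus an algebra, and every flux of the proof is
  assembled inside it.\<close>

definition lip_field :: "'n::finite flow_region \<Rightarrow> (real^'n \<Rightarrow> real) \<Rightarrow> bool" where
  "lip_field R F \<longleftrightarrow> (\<exists>B. \<forall>x\<in>field_domain R. \<bar>F x\<bar> \<le> B) \<and>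
     (\<exists>C. C-lipschitz_on (field_domain R) F) \<and> periodic_field R F"

text \<open>First-order vanishing at the wall, phrased on \<Omega> alone without boundary values. It
  is preserved by multiplication with any \<open>lip_field\<close>, so one vanishing factor makes a
  whole flux term vanish, and it is what makes the extension by zero Lipschitz.\<close>

fun wall_zero :: "'n::finite flow_region \<Rightarrow> (real^'n \<Rightarrow> real) \<Rightarrow> bool" where
  "wall_zero (No_Slip \<Omega>) F \<longleftrightarrow> (\<exists>B. \<forall>x\<in>\<Omega>. \<bar>F x\<bar> \<le> B * infdist x (- \<Omega>))"
| "wall_zero (Periodic p) F \<longleftrightarrow> True"

lemma lip_field_const: "lip_field R (\<lambda>_. c)"
  unfolding lip_field_def by (cases R) (auto intro: lipschitz_on_constant)

lemma lip_field_add: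
  assumes "lip_field R F" "lip_field R G"
  shows "lip_field R (\<lambda>x. F x + G x)"
proof -
  obtain B C B' C' where B: "\<And>x. x \<in> field_domain R \<Longrightarrow> \<bar>F x\<bar> \<le> B" "\<And>x. x \<in> field_domain R \<Longrightarrow> \<bar>G x\<bar> \<le> B'"
    and C: "C-lipschitz_on (field_domain R) F" "C'-lipschitz_on (field_domain R) G"
    using assms unfolding lip_field_def by blast
  have "\<bar>F x + G x\<bar> \<le> B + B'" if "x \<in> field_domain R" for x
    using B(1)[OF that] B(2)[OF that] by linarith
  moreover have "(C + C')-lipschitz_on (field_domain R) (\<lambda>x. F x + G x)"
    by (rule lipschitz_on_add[OF C])
  moreover have "periodic_field R (\<lambda>x. F x + G x)"
    using assms unfolding lip_field_def by (cases R) auto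
  ultimately show ?thesis unfolding lip_field_def by blast
qed

lemma lip_field_mult:
  assumes "lip_field R F" "lip_field R G"
  shows "lip_field R (\<lambda>x. F x * G x)"
proof -
  obtain B C B' C' where B: "\<And>x. x \<in> field_domain R \<Longrightarrow> \<bar>F x\<bar> \<le> B" "\<And>x. x \<in> field_domain R \<Longrightarrow> \<bar>G x\<bar> \<le> B'"
    and C: "C-lipschitz_on (field_domain R) F" "C'-lipschitz_on (field_domain R) G"
    using assms unfolding lip_field_def by blast
  note C0 = lipschitz_on_nonneg[OF C(1)] lipschitz_on_nonneg[OF C(2)]
  have "\<bar>F x * G x\<bar> \<le> B * B'" if "x \<in> field_domain R" for x
    unfolding abs_mult using B(1)[OF that] B(2)[OF that] by (intro mult_mono) auto
  moreover have "(\<bar>B\<bar> * C' + C * \<bar>B'\<bar>)-lipschitz_on (field_domain R) (\<lambda>x. F x * G x)"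
  proof (rule lipschitz_onI)
    fix x y assume xy: "x \<in> field_domain R" "y \<in> field_domain R"
    have "dist (F x * G x) (F y * G y) = \<bar>F x * (G x - G y) + (F x - F y) * G y\<bar>"
      by (simp add: dist_real_def algebra_simps)
    also have "\<dots> \<le> \<bar>F x\<bar> * \<bar>G x - G y\<bar> + \<bar>F x - F y\<bar> * \<bar>G y\<bar>"
      by (rule order_trans[OF abs_triangle_ineq]) (simp add: abs_mult)
    also have "\<dots> \<le> \<bar>B\<bar> * (C' * dist x y) + (C * dist x y) * \<bar>B'\<bar>"
      using B(1)[OF xy(1)] B(2)[OF xy(2)] lipschitz_onD[OF C(1) xy] lipschitz_onD[OF C(2) xy] C0
      by (intro add_mono mult_mono) (auto simp: dist_real_def)
    finally show "dist (F x * G x) (F y * G y) \<le> (\<bar>B\<bar> * C' + C * \<bar>B'\<bar>) * dist x y"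
      by (simp add: algebra_simps)
  qed (use C0 in auto)
  moreover have "periodic_field R (\<lambda>x. F x * G x)"
    using assms unfolding lip_field_def by (cases R) auto
  ultimately show ?thesis unfolding lip_field_def by blast
qed

lemma lip_field_cmult: "lip_field R F \<Longrightarrow> lip_field R (\<lambda>x. c * F x)"
  by (intro lip_field_mult lip_field_const)

lemma lip_field_diff: "lip_field R F \<Longrightarrow> lip_field R G \<Longrightarrow> lip_field R (\<lambda>x. F x - G x)"
  using lip_field_add[of R F "\<lambda>x. (-1) * G x"] lip_field_cmult[of R G "-1"] by simp

lemma lip_field_sum: "(\<And>j. j \<in> J \<Longrightarrow> lip_field R (F j)) \<Longrightarrow> lip_field R (\<lambda>x. \<Sum>j\<in>J. F j x)"
  by (induction J rule: infinite_finite_induct) (auto intro: lip_field_const lip_field_add)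

lemma wall_zero_add:
  assumes "wall_zero R F" "wall_zero R G"
  shows "wall_zero R (\<lambda>x. F x + G x)"
proof (cases R)
  case (No_Slip \<Omega>)
  with assms obtain B B' where B: "\<And>x. x \<in> \<Omega> \<Longrightarrow> \<bar>F x\<bar> \<le> B * infdist x (- \<Omega>)"
    "\<And>x. x \<in> \<Omega> \<Longrightarrow> \<bar>G x\<bar> \<le> B' * infdist x (- \<Omega>)" by auto
  have "\<bar>F x + G x\<bar> \<le> (B + B') * infdist x (- \<Omega>)" if "x \<in> \<Omega>" for x
    using B(1)[OF that] B(2)[OF that] by (simp add: algebra_simps)
  then show ?thesis using No_Slip by auto
qed simp

lemma wall_zero_mult:
  assumes "wall_zero R F" "lip_field R G"
  shows "wall_zero R (\<lambda>x. F x * G x)"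
proof (cases R)
  case (No_Slip \<Omega>)
  with assms obtain B B' where B: "\<And>x. x \<in> \<Omega> \<Longrightarrow> \<bar>F x\<bar> \<le> B * infdist x (- \<Omega>)"
    "\<And>x. x \<in> \<Omega> \<Longrightarrow> \<bar>G x\<bar> \<le> B'" by (auto simp: lip_field_def)
  have "\<bar>F x * G x\<bar> \<le> (B * B') * infdist x (- \<Omega>)" if "x \<in> \<Omega>" for x
  proof -
    have "\<bar>F x\<bar> * \<bar>G x\<bar> \<le> (B * infdist x (- \<Omega>)) * B'"
      using B(1)[OF that] B(2)[OF that] by (intro mult_mono) auto
    then show ?thesis by (simp add: abs_mult algebra_simps)
  qed
  then show ?thesis using No_Slip by auto
qed simp

lemma wall_zero_const0: "wall_zero R (\<lambda>_. 0)"
  by (cases R) (auto intro: exI[of _ 0])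

lemma wall_zero_diff: "wall_zero R F \<Longrightarrow> wall_zero R G \<Longrightarrow> wall_zero R (\<lambda>x. F x - G x)"
  using wall_zero_add[of R F "\<lambda>x. G x * (-1)"] wall_zero_mult[of R G "\<lambda>_. -1"] lip_field_const by auto

lemma wall_zero_sum: "(\<And>j. j \<in> J \<Longrightarrow> wall_zero R (F j)) \<Longrightarrow> wall_zero R (\<lambda>x. \<Sum>j\<in>J. F j x)"
  by (induction J rule: infinite_finite_induct) (auto intro: wall_zero_const0 wall_zero_add)

lemma flow_domain_lmeasurable: "valid_region R \<Longrightarrow> flow_domain R \<in> lmeasurable"
  by (cases R) (auto intro: bounded_set_imp_lmeasurable)

lemma flow_domain_open: "valid_region R \<Longrightarrow> open (flow_domain R)"
  by (cases R) auto

lemma flow_domain_bounded: "valid_region R \<Longrightarrow> bounded (flow_domain R)"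
  by (cases R) auto

lemma flow_domain_nonempty: "valid_region R \<Longrightarrow> flow_domain R \<noteq> {}"
  by (cases R) (auto simp: box_ne_empty Basis_vec_def inner_axis)

lemma flow_domain_subset: "flow_domain R \<subseteq> field_domain R"
  by (cases R) auto

lemma flow_domain_measure_pos:
  assumes "valid_region R" shows "measure lebesgue (flow_domain R) > 0"
proof -
  have "\<not> negligible (flow_domain R)"
    using flow_domain_open[OF assms] flow_domain_nonempty[OF assms] open_not_negligible by blast
  then show ?thesis
    using flow_domain_lmeasurable[OF assms] by (simp add: negligible_iff_measure less_le)
qed

lemma lip_field_continuous_on: "lip_field R F \<Longrightarrow> continuous_on (flow_domain R) F"
  unfolding lip_field_def
  by (meson continuous_on_subset flow_domain_subset lipschitz_on_continuous_on)

lemma lip_field_integrable: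
  assumes "valid_region R" "lip_field R F"
  shows "integrable (lebesgue_on (flow_domain R)) F"
proof -
  obtain B where B: "\<And>x. x \<in> field_domain R \<Longrightarrow> \<bar>F x\<bar> \<le> B" using assms by (auto simp: lip_field_def)
  show ?thesis
    using flow_domain_lmeasurable[OF assms(1)] lip_field_continuous_on[OF assms(2)]
  proof (rule integrable_bounded_continuous)
    show "x \<in> flow_domain R \<Longrightarrow> norm (F x) \<le> B" for x using B flow_domain_subset[of R] by auto
  qed
qed

lemma lip_field_measurable:
  "valid_region R \<Longrightarrow> lip_field R F \<Longrightarrow> F \<in> borel_measurable (lebesgue_on (flow_domain R))"
  using lip_field_integrable by blast

section \<open>The divergence theorem on a flow region\<close>

text \<open>With a wall, the flux extended by zero is Lipschitz on the whole space, and its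
  difference quotients integrate to a null sequence. For periodic fluxes the integrals of the
  difference quotients are exactly zero once the step is below the period.\<close>

theorem region_divergence_theorem:
  fixes F :: "'n::finite \<Rightarrow> real^'n \<Rightarrow> real"
  assumes R: "valid_region R"
    and lip: "\<And>i. lip_field R (F i)" and wall: "\<And>i. wall_zero R (F i)"
    and D: "D \<in> borel_measurable (lebesgue_on (flow_domain R))"
    and AE: "AE x in lebesgue_on (flow_domain R).
      \<exists>d. (\<forall>i. has_partial (F i) i (d i) x) \<and> D x = (\<Sum>i\<in>UNIV. d i)"
  shows "integrable (lebesgue_on (flow_domain R)) D" "(LINT x|lebesgue_on (flow_domain R). D x) = 0"
proof -
  define h where "h n = inverse (real (Suc n))" for n
  have h: "h \<longlonglongrightarrow> 0" "\<And>n. h n > 0"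
    unfolding h_def using LIMSEQ_inverse_real_of_nat by auto
  have "integrable (lebesgue_on (flow_domain R)) D \<and> (LINT x|lebesgue_on (flow_domain R). D x) = 0"
  proof (cases R)
    case (No_Slip \<Omega>)
    have \<Omega>: "open \<Omega>" "bounded \<Omega>" using R No_Slip by auto
    define F' where "F' i x = (if x \<in> \<Omega> then F i x else 0)" for i x
    have lip': "\<exists>C. C-lipschitz_on UNIV (F' i)" for i
    proof -
      obtain B where B: "\<And>x. x \<in> \<Omega> \<Longrightarrow> \<bar>F i x\<bar> \<le> B * infdist x (- \<Omega>)"
        using wall[of i] No_Slip by auto
      obtain C where C: "C-lipschitz_on \<Omega> (F i)" using lip[of i] No_Slip by (auto simp: lip_field_def)
      have C0: "C \<ge> 0" using C by (rule lipschitz_on_nonneg)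
      \<comment> \<open>A pair of points on opposite sides of the wall is compared through the
        distance to the complement, so the shape of the boundary does not enter. The absolute value
        of \<open>B\<close> is taken because \<open>B\<close> may be negative.\<close>
      have out: "\<bar>F i x\<bar> \<le> (C + \<bar>B\<bar>) * dist x y" if "x \<in> \<Omega>" "y \<notin> \<Omega>" for x y
      proof -
        have "\<bar>F i x\<bar> \<le> \<bar>B\<bar> * infdist x (- \<Omega>)"
          using B[OF that(1)] infdist_nonneg[of x "- \<Omega>"] by (meson abs_ge_self mult_right_mono order_trans)
        also have "\<dots> \<le> \<bar>B\<bar> * dist x y" using that by (intro mult_left_mono infdist_le) auto
        also have "\<dots> \<le> (C + \<bar>B\<bar>) * dist x y" using C0 by (intro mult_right_mono) auto
        finally show ?thesis .
      qed
      have "(C + \<bar>B\<bar>)-lipschitz_on UNIV (F' i)"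
      proof (rule lipschitz_onI)
        fix x y
        have "dist (F i x) (F i y) \<le> (C + \<bar>B\<bar>) * dist x y" if "x \<in> \<Omega>" "y \<in> \<Omega>"
          using lipschitz_onD[OF C that] by (smt (verit) mult_right_mono zero_le_dist)
        then show "dist (F' i x) (F' i y) \<le> (C + \<bar>B\<bar>) * dist x y"
          using out[of x y] out[of y x] C0 by (auto simp: F'_def dist_real_def dist_commute)
      qed (use C0 in auto)
      then show ?thesis by blast
    qed
    have AE': "AE x in lebesgue_on \<Omega>. \<exists>d. (\<forall>i. has_partial (F' i) i (d i) x) \<and> D x = (\<Sum>i\<in>UNIV. d i)"
    proof -
      have "AE x in lebesgue_on \<Omega>. \<exists>d. (\<forall>i. has_partial (F i) i (d i) x) \<and> D x = (\<Sum>i\<in>UNIV. d i)"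
        using AE unfolding No_Slip flow_domain.simps .
      moreover have "AE x in lebesgue_on \<Omega>. x \<in> \<Omega>" by (rule AE_I2) (simp add: space_restrict_space)
      ultimately show ?thesis
      proof eventually_elim
        case (elim x)
        then obtain d where d: "\<And>i. has_partial (F i) i (d i) x" "D x = (\<Sum>i\<in>UNIV. d i)" by blast
        have "has_partial (F' i) i (d i) x" for i
          using d(1) \<Omega>(1) elim(2) by (rule has_partial_cong) (simp add: F'_def)
        then show ?case using d(2) by blast
      qed
    qed
    have quot: "(\<lambda>n. LINT x|lebesgue_on \<Omega>. (F' i (x + h n *\<^sub>R axis i 1) - F' i x) / h n) \<longlonglongrightarrow> 0" for i
    proof -
      obtain C where C: "C-lipschitz_on UNIV (F' i)" using lip'[of i] by blast
      show ?thesis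
        by (rule integral_diff_quotient_tendsto_0[OF \<Omega> C _ h]) (simp add: F'_def)
    qed
    have "\<Omega> \<in> lmeasurable" using \<Omega> by (intro bounded_set_imp_lmeasurable) auto
    moreover have "D \<in> borel_measurable (lebesgue_on \<Omega>)" using D unfolding No_Slip flow_domain.simps .
    ultimately show ?thesis
      unfolding No_Slip flow_domain.simps
      using integral_divergence_0[OF _ lip' quot h _ AE'] by blast
  next
    case (Periodic p)
    have p: "p $ i > 0" for i using R Periodic by auto
    have lip': "\<exists>C. C-lipschitz_on UNIV (F i)" for i using lip[of i] Periodic by (auto simp: lip_field_def)
    have per: "F i (x + axis j (p $ j)) = F i x" for i j x using lip[of i] Periodic by (auto simp: lip_field_def)
    have quot: "(\<lambda>n. LINT x|lebesgue_on (box 0 p). (F i (x + h n *\<^sub>R axis i 1) - F i x) / h n) \<longlonglongrightarrow> 0" for i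
    proof (rule tendsto_eventually)
      have cont: "continuous_on UNIV (F i)" using lip'[of i] lipschitz_on_continuous_on by blast
      obtain B where B: "\<And>x. \<bar>F i x\<bar> \<le> B" using lip[of i] Periodic by (auto simp: lip_field_def)
      have int: "integrable (lebesgue_on (box 0 p)) (\<lambda>x. F i (x + c))" for c
        using B by (intro integrable_bounded_continuous[where B=B] continuous_intros continuous_on_compose2[OF cont]) auto
      \<comment> \<open>The shift lemma covers shifts of at most one period.\<close>
      have "\<forall>\<^sub>F n in sequentially. h n < p $ i" using h(1) p[of i] by (rule order_tendstoD)
      then show "\<forall>\<^sub>F n in sequentially. (LINT x|lebesgue_on (box 0 p). (F i (x + h n *\<^sub>R axis i 1) - F i x) / h n) = 0"
      proof eventually_elim
        case (elim n)
        have "(LINT x|lebesgue_on (box 0 p). F i (x + h n *\<^sub>R axis i 1)) = (LINT x|lebesgue_on (box 0 p). F i x)"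
          using cont per h(2)[of n] elim by (intro integral_cell_shift_axis) auto
        then show ?case using int[of "h n *\<^sub>R axis i 1"] int[of 0] by simp
      qed
    qed
    have D': "D \<in> borel_measurable (lebesgue_on (box 0 p))" using D unfolding Periodic flow_domain.simps .
    note AE' = AE[unfolded Periodic flow_domain.simps]
    show ?thesis
      unfolding Periodic flow_domain.simps
      using integral_divergence_0[OF lmeasurable_box lip' quot h D' AE'] by blast
  qed
  then show "integrable (lebesgue_on (flow_domain R)) D" "(LINT x|lebesgue_on (flow_domain R). D x) = 0" by auto
qed

subsection \<open>The energy balance\<close>

lemma norm_matrix_power2: "(norm (M :: real^'m^'n))\<^sup>2 = (\<Sum>i\<in>UNIV. \<Sum>j\<in>UNIV. (M$i$j)\<^sup>2)"
  by (simp add: power2_norm_eq_inner inner_vec_def) (simp add: power2_eq_square)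

lemma sym_grad_component: "sym_grad u x $ i $ j = (grad_matrix u x $ i $ j + grad_matrix u x $ j $ i) / 2"
  by (simp add: sym_grad_def transpose_def)

lemma lip_field_sym_grad:
  assumes "\<And>i j. lip_field R (\<lambda>x. grad_matrix u x $ i $ j)"
  shows "lip_field R (\<lambda>x. sym_grad u x $ i $ j)"
proof -
  have "lip_field R (\<lambda>x. (1/2) * (grad_matrix u x $ i $ j + grad_matrix u x $ j $ i))"
    by (intro lip_field_cmult lip_field_add assms)
  then show ?thesis by (simp add: sym_grad_component)
qed

lemma lip_field_norm_sym_grad:
  assumes "\<And>i j. lip_field R (\<lambda>x. grad_matrix u x $ i $ j)"
  shows "lip_field R (\<lambda>x. (norm (sym_grad u x))\<^sup>2)"
  unfolding norm_matrix_power2 unfolding power2_eq_square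
  by (intro lip_field_sum lip_field_mult lip_field_sym_grad assms)

text \<open>The symmetric part is orthogonal to the antisymmetric part of the gradient. The indices
  stand in the order in which they arise when the stress flux is differentiated along
  \<open>i\<close>.\<close>

lemma grad_contract_sym_grad:
  "(\<Sum>i\<in>UNIV. \<Sum>j\<in>UNIV. grad_matrix u x $ j $ i * sym_grad u x $ j $ i) = (norm (sym_grad u x))\<^sup>2"
proof -
  let ?G = "\<lambda>i j. grad_matrix u x $ i $ j"
  have 1: "(\<Sum>i\<in>UNIV. \<Sum>j\<in>UNIV. ?G j i * sym_grad u x $ j $ i) = (\<Sum>i\<in>UNIV. \<Sum>j\<in>UNIV. ?G i j * sym_grad u x $ i $ j)"
    by (rule sum.swap)
  have 2: "(\<Sum>i\<in>UNIV. \<Sum>j\<in>UNIV. ?G i j * sym_grad u x $ i $ j) = (\<Sum>i\<in>UNIV. \<Sum>j\<in>UNIV. ?G j i * sym_grad u x $ i $ j)"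
    by (subst sum.swap) (simp add: sym_grad_component add.commute)
  have "(norm (sym_grad u x))\<^sup>2 = (\<Sum>i\<in>UNIV. \<Sum>j\<in>UNIV. (1/2) * (?G i j * sym_grad u x $ i $ j) + (1/2) * (?G j i * sym_grad u x $ i $ j))"
    unfolding norm_matrix_power2
    by (intro sum.cong refl) (simp add: sym_grad_component power2_eq_square field_simps)
  also have "\<dots> = (1/2) * (\<Sum>i\<in>UNIV. \<Sum>j\<in>UNIV. ?G i j * sym_grad u x $ i $ j) + (1/2) * (\<Sum>i\<in>UNIV. \<Sum>j\<in>UNIV. ?G j i * sym_grad u x $ i $ j)"
    by (simp add: sum.distrib sum_distrib_left)
  finally show ?thesis using 1 2 by simp
qed

lemma borel_measurable_vec_nthI:
  fixes f :: "'a \<Rightarrow> real^'n"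
  assumes "\<And>j. (\<lambda>x. f x $ j) \<in> borel_measurable M"
  shows "f \<in> borel_measurable M"
  using assms by (subst borel_measurable_euclidean_space) (auto simp: Basis_vec_def inner_axis)

text \<open>The momentum equation is tested with \<open>u - c\<close>; since \<open>c\<close> is
  constant, this field has the same gradient as \<open>u\<close> and is also divergence-free. The
  field \<open>a\<close> stands for the time derivative minus the force, and \<open>N\<close> for
  the total viscosity.\<close>

lemma momentum_balance:
  fixes u a :: "real^'n \<Rightarrow> real^'n" and N q :: "real^'n \<Rightarrow> real" and c :: "real^'n"
  assumes R: "valid_region R"
    and u: "\<And>j. lip_field R (\<lambda>x. u x $ j)"
    and G: "\<And>i j. lip_field R (\<lambda>x. grad_matrix u x $ i $ j)"
    and N: "lip_field R N" and q: "lip_field R q"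
    and wall: "\<And>j. wall_zero R (\<lambda>x. u x $ j - c $ j)"
    and diff: "\<And>x. x \<in> field_domain R \<Longrightarrow> u differentiable at x"
    and div: "\<And>x. x \<in> field_domain R \<Longrightarrow> divergence u x = 0"
    and a: "a \<in> borel_measurable (lebesgue_on (flow_domain R))"
    and AE: "AE x in lebesgue_on (flow_domain R).
      (\<lambda>z. N z *\<^sub>R sym_grad u z) differentiable at x \<and> q differentiable at x \<and>
      a x + grad_matrix u x *v u x - tensor_divergence (\<lambda>z. N z *\<^sub>R sym_grad u z) x + scalar_grad q x = 0"
  shows "integrable (lebesgue_on (flow_domain R)) (\<lambda>x. (u x - c) \<bullet> a x + N x * (norm (sym_grad u x))\<^sup>2)"
    "(LINT x|lebesgue_on (flow_domain R). (u x - c) \<bullet> a x + N x * (norm (sym_grad u x))\<^sup>2) = 0"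
proof -
  let ?M = "lebesgue_on (flow_domain R)"
  define w where "w j x = u x $ j - c $ j" for j x
  define \<sigma> where "\<sigma> z = N z *\<^sub>R sym_grad u z" for z
  \<comment> \<open>Pressure flux, transport of the kinetic energy of the fluctuation, and stress
    flux. The transporting velocity is the full \<open>u\<close>, not \<open>u - c\<close>, as in
    the momentum equation.\<close>
  define F where "F i x = w i x * q x + u x $ i * (\<Sum>j\<in>UNIV. w j x * w j x * (1/2)) - (\<Sum>j\<in>UNIV. w j x * \<sigma> x $ j $ i)" for i x
  define D where "D x = - ((u x - c) \<bullet> a x + N x * (norm (sym_grad u x))\<^sup>2)" for x
  have w: "lip_field R (w j)" for j unfolding w_def by (intro lip_field_diff u lip_field_const)
  have w0: "wall_zero R (w j)" for j using wall unfolding w_def .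
  have \<sigma>: "lip_field R (\<lambda>x. \<sigma> x $ j $ i)" for i j
    unfolding \<sigma>_def by (simp add: lip_field_mult N lip_field_sym_grad G)
  have lip: "lip_field R (F i)" for i
    unfolding F_def by (intro lip_field_diff lip_field_add lip_field_mult lip_field_sum w q u \<sigma> lip_field_const)
  \<comment> \<open>The transport term vanishes at the wall because of the factors
    \<open>w j\<close>, not because of \<open>u\<close>; \<open>wall_zero_mult\<close> expects the
    vanishing factor on the left.\<close>
  have comm: "u x $ i * (\<Sum>j\<in>UNIV. w j x * w j x * (1/2)) = (\<Sum>j\<in>UNIV. w j x * w j x * (1/2)) * u x $ i" for i x
    by (rule mult.commute)
  have wz: "wall_zero R (F i)" for i
    unfolding F_def comm
    by (intro wall_zero_diff wall_zero_add wall_zero_mult wall_zero_sum w0 w q u \<sigma> lip_field_const)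
  have meas: "D \<in> borel_measurable ?M"
  proof -
    have [measurable]: "u \<in> borel_measurable ?M"
      by (rule borel_measurable_vec_nthI) (rule lip_field_measurable[OF R u])
    have [measurable]: "(\<lambda>x. (norm (sym_grad u x))\<^sup>2) \<in> borel_measurable ?M" "N \<in> borel_measurable ?M" "a \<in> borel_measurable ?M"
      using lip_field_measurable[OF R] lip_field_norm_sym_grad[OF G] N a by auto
    show ?thesis unfolding D_def by measurable
  qed
  have AE': "AE x in ?M. \<exists>d. (\<forall>i. has_partial (F i) i (d i) x) \<and> D x = (\<Sum>i\<in>UNIV. d i)"
  proof -
    have "AE x in ?M. x \<in> flow_domain R" by (rule AE_I2) (simp add: space_restrict_space)
    with AE show ?thesis
    proof eventually_elim
      case (elim x)
      have xd: "x \<in> field_domain R" using elim flow_domain_subset[of R] by auto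
      define g where "g j i = grad_matrix u x $ j $ i" for j i
      define ds where "ds j i = grad_matrix (\<lambda>z. \<sigma> z $ j) x $ i $ i" for j i
      define dq where "dq i = frechet_derivative q (at x) (axis i 1)" for i
      have pu: "has_partial (\<lambda>z. u z $ j) i (g j i) x" for i j
        unfolding g_def by (rule has_partial_grad_matrix[OF diff[OF xd]])
      have pw: "has_partial (w j) i (g j i) x" for i j
      proof -
        have "has_partial (\<lambda>z. u z $ j - c $ j) i (g j i - 0) x"
          by (intro has_partial_diff pu has_partial_const)
        moreover have "w j = (\<lambda>z. u z $ j - c $ j)" by (simp add: w_def fun_eq_iff)
        ultimately show ?thesis by simp
      qed
      have pq: "has_partial q i (dq i) x" for i unfolding dq_def using elim by (intro has_partial_frechet) auto
      have ps: "has_partial (\<lambda>z. \<sigma> z $ j $ i) i (ds j i) x" for i j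
      proof -
        have "\<sigma> differentiable at x" using elim unfolding \<sigma>_def by auto
        then have "(\<lambda>z. \<sigma> z $ j) differentiable at x"
          unfolding differentiable_def using bounded_linear.has_derivative[OF bounded_linear_vec_nth] by blast
        then show ?thesis unfolding ds_def by (rule has_partial_grad_matrix)
      qed
      define d where "d i = (g i i * q x + w i x * dq i) +
          (g i i * (\<Sum>j\<in>UNIV. w j x * w j x * (1/2)) + u x $ i * (\<Sum>j\<in>UNIV. (g j i * w j x + w j x * g j i) * (1/2) + w j x * w j x * 0))
          - (\<Sum>j\<in>UNIV. g j i * \<sigma> x $ j $ i + w j x * ds j i)" for i
      have "has_partial (F i) i (d i) x" for i
        unfolding F_def d_def
        by (intro has_partial_diff has_partial_add has_partial_mult has_partial_sum pu pw pq ps has_partial_const)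
      \<comment> \<open>By \<open>tr\<close> the pressure and the kinetic energy lose the terms in
        which they multiply the divergence. The remaining terms are the momentum equation contracted
        with \<open>w\<close>, together with the dissipation from differentiating \<open>w\<close>
        in the stress flux.\<close>
      moreover have "D x = (\<Sum>i\<in>UNIV. d i)"
      proof -
        have tr: "(\<Sum>i\<in>UNIV. g i i) = 0"
          using div[OF xd] by (simp add: divergence_def trace_def g_def)
        have td: "tensor_divergence \<sigma> x $ j = (\<Sum>i\<in>UNIV. ds j i)" for j
          by (simp add: tensor_divergence_def divergence_def trace_def ds_def)
        have sg: "scalar_grad q x $ i = dq i" for i by (simp add: scalar_grad_def dq_def)
        have gv: "(grad_matrix u x *v u x) $ j = (\<Sum>i\<in>UNIV. g j i * u x $ i)" for j
          by (simp add: matrix_vector_mult_def g_def)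
        have eq: "a x $ j = - (\<Sum>i\<in>UNIV. g j i * u x $ i) + (\<Sum>i\<in>UNIV. ds j i) - dq j" for j
        proof -
          have "(a x + grad_matrix u x *v u x - tensor_divergence \<sigma> x + scalar_grad q x) $ j = 0"
            using elim unfolding \<sigma>_def by simp
          then show ?thesis by (simp add: td sg gv)
        qed
        have e1: "(u x - c) \<bullet> a x = (\<Sum>j\<in>UNIV. w j x * a x $ j)"
          by (simp add: inner_vec_def w_def)
        have e2: "(\<Sum>j\<in>UNIV. w j x * a x $ j) = - (\<Sum>j\<in>UNIV. \<Sum>i\<in>UNIV. w j x * (g j i * u x $ i)) 
            + (\<Sum>j\<in>UNIV. \<Sum>i\<in>UNIV. w j x * ds j i) - (\<Sum>j\<in>UNIV. w j x * dq j)"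
          unfolding eq by (simp add: algebra_simps sum.distrib sum_subtractf sum_distrib_left sum_negf)
        have e3: "N x * (norm (sym_grad u x))\<^sup>2 = (\<Sum>i\<in>UNIV. \<Sum>j\<in>UNIV. g j i * \<sigma> x $ j $ i)"
          unfolding grad_contract_sym_grad[symmetric] by (simp add: sum_distrib_left g_def \<sigma>_def algebra_simps)
        have "(\<Sum>i\<in>UNIV. d i) = (\<Sum>i\<in>UNIV. g i i) * q x + (\<Sum>i\<in>UNIV. w i x * dq i)
            + (\<Sum>i\<in>UNIV. g i i) * (\<Sum>j\<in>UNIV. w j x * w j x * (1/2)) + (\<Sum>i\<in>UNIV. \<Sum>j\<in>UNIV. w j x * (g j i * u x $ i))
            - (\<Sum>i\<in>UNIV. \<Sum>j\<in>UNIV. g j i * \<sigma> x $ j $ i) - (\<Sum>i\<in>UNIV. \<Sum>j\<in>UNIV. w j x * ds j i)"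
          unfolding d_def
          by (simp add: sum.distrib sum_subtractf sum_distrib_right)
             (simp add: sum_distrib_left algebra_simps)
        moreover have "(\<Sum>i\<in>UNIV. \<Sum>j\<in>UNIV. w j x * (g j i * u x $ i)) = (\<Sum>j\<in>UNIV. \<Sum>i\<in>UNIV. w j x * (g j i * u x $ i))"
          by (rule sum.swap)
        moreover have "(\<Sum>i\<in>UNIV. \<Sum>j\<in>UNIV. w j x * ds j i) = (\<Sum>j\<in>UNIV. \<Sum>i\<in>UNIV. w j x * ds j i)"
          by (rule sum.swap)
        ultimately show ?thesis
          unfolding D_def e1 e2 e3 tr by simp
      qed
      ultimately show ?case by blast
    qed
  qed
  note * = region_divergence_theorem[OF R lip wz meas AE']
  have eq: "(\<lambda>x. - D x) = (\<lambda>x. (u x - c) \<bullet> a x + N x * (norm (sym_grad u x))\<^sup>2)"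
    by (simp add: D_def fun_eq_iff)
  from *(1) have "integrable ?M (\<lambda>x. - D x)" by simp
  then show "integrable ?M (\<lambda>x. (u x - c) \<bullet> a x + N x * (norm (sym_grad u x))\<^sup>2)" unfolding eq .
  from *(2) have "(LINT x|?M. - D x) = 0" by simp
  then show "(LINT x|?M. (u x - c) \<bullet> a x + N x * (norm (sym_grad u x))\<^sup>2) = 0" unfolding eq .
qed

subsection \<open>Poincare inequalities for the symmetric gradient\<close>

text \<open>Only the diagonal of the Frobenius sum is kept; there the gradient and its symmetric
  part agree.\<close>

lemma sum_diag_sym_grad_le:
  "(\<Sum>i\<in>UNIV. (grad_matrix u x $ i $ i)\<^sup>2) \<le> (norm (sym_grad u x))\<^sup>2"
  unfolding norm_matrix_power2
proof (rule sum_mono)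
  fix i
  have "(grad_matrix u x $ i $ i)\<^sup>2 = (sym_grad u x $ i $ i)\<^sup>2" by (simp add: sym_grad_component)
  also have "\<dots> \<le> (\<Sum>j\<in>UNIV. (sym_grad u x $ i $ j)\<^sup>2)"
    by (rule member_le_sum[where f="\<lambda>j. (sym_grad u x $ i $ j)\<^sup>2"]) auto
  finally show "(grad_matrix u x $ i $ i)\<^sup>2 \<le> (\<Sum>j\<in>UNIV. (sym_grad u x $ i $ j)\<^sup>2)" .
qed

lemma norm_vec_power2: "(norm (v :: real^'n))\<^sup>2 = (\<Sum>i\<in>UNIV. (v $ i)\<^sup>2)"
  by (simp add: power2_norm_eq_inner inner_vec_def) (simp add: power2_eq_square)

lemma lip_field_norm_power2:
  assumes "\<And>j. lip_field R (\<lambda>x. u x $ j)"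
  shows "lip_field R (\<lambda>x. (norm (u x))\<^sup>2)"
  unfolding norm_vec_power2 unfolding power2_eq_square by (intro lip_field_sum lip_field_mult assms)

text \<open>Since \<open>\<partial>\<^sub>i u\<^sub>i\<close> is an entry of the symmetric gradient, the divergence theorem for the fluxes
  \<open>x\<^sub>i u\<^sub>i\<^sup>2\<close> bounds the velocity by the symmetric gradient without Korn's inequality.\<close>

lemma poincare_no_slip:
  fixes \<Omega> :: "(real^'n) set"
  defines "R \<equiv> No_Slip \<Omega>"
  assumes R: "valid_region R"
    and B: "\<And>x. x \<in> \<Omega> \<Longrightarrow> norm x \<le> B"
    and u: "\<And>j. lip_field R (\<lambda>x. u x $ j)"
    and G: "\<And>i j. lip_field R (\<lambda>x. grad_matrix u x $ i $ j)"
    and wall: "\<And>j. wall_zero R (\<lambda>x. u x $ j)"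
    and diff: "\<And>x. x \<in> field_domain R \<Longrightarrow> u differentiable at x"
  shows "(LINT x|lebesgue_on (flow_domain R). (norm (u x))\<^sup>2)
     \<le> 4 * B\<^sup>2 * (LINT x|lebesgue_on (flow_domain R). (norm (sym_grad u x))\<^sup>2)"
proof -
  let ?M = "lebesgue_on (flow_domain R)"
  have dom: "field_domain R = \<Omega>" "flow_domain R = \<Omega>" by (simp_all add: R_def)
  have coord: "lip_field R (\<lambda>x. x $ i)" for i
  proof -
    have "\<bar>x $ i\<bar> \<le> B" if "x \<in> \<Omega>" for x
      using B[OF that] component_le_norm_cart[of x i] by linarith
    moreover have "1-lipschitz_on \<Omega> (\<lambda>x. x $ i)"
    proof (rule lipschitz_onI)
      show "dist (x $ i) (y $ i) \<le> 1 * dist x y" for x y :: "real^'n"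
        using component_le_norm_cart[of "x - y" i] by (simp add: dist_norm dist_real_def)
    qed simp
    ultimately show ?thesis unfolding lip_field_def dom by (auto simp: R_def)
  qed
  define F where "F i x = u x $ i * (u x $ i * x $ i)" for i x
  define d where "d i x = grad_matrix u x $ i $ i * (u x $ i * x $ i) + u x $ i * (grad_matrix u x $ i $ i * x $ i + u x $ i * 1)" for i x
  define D where "D x = (\<Sum>i\<in>UNIV. d i x)" for x
  have F: "lip_field R (F i)" "wall_zero R (F i)" for i
    unfolding F_def by (intro lip_field_mult wall_zero_mult u coord wall)+
  have "lip_field R D"
    unfolding D_def d_def by (intro lip_field_sum lip_field_add lip_field_mult u coord G lip_field_const)
  then have D: "D \<in> borel_measurable ?M" by (rule lip_field_measurable[OF R])
  have AE: "AE x in ?M. \<exists>e. (\<forall>i. has_partial (F i) i (e i) x) \<and> D x = (\<Sum>i\<in>UNIV. e i)"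
  proof (rule AE_I2)
    fix x assume "x \<in> space ?M"
    then have x: "x \<in> field_domain R" using dom by (simp add: space_restrict_space)
    have pu: "has_partial (\<lambda>z. u z $ i) i (grad_matrix u x $ i $ i) x" for i
      by (rule has_partial_grad_matrix[OF diff[OF x]])
    have "has_partial (F i) i (d i x) x" for i
      unfolding F_def d_def by (intro has_partial_mult pu has_partial_coord)
    then show "\<exists>e. (\<forall>i. has_partial (F i) i (e i) x) \<and> D x = (\<Sum>i\<in>UNIV. e i)"
      unfolding D_def by (intro exI[of _ "\<lambda>i. d i x"]) simp
  qed
  note div = region_divergence_theorem[OF R F D AE]
  have iu: "integrable ?M (\<lambda>x. (norm (u x))\<^sup>2)"
    using lip_field_integrable[OF R lip_field_norm_power2[OF u]] .
  have iS: "integrable ?M (\<lambda>x. (norm (sym_grad u x))\<^sup>2)"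
    using lip_field_integrable[OF R lip_field_norm_sym_grad[OF G]] .
  have "(LINT x|?M. (norm (u x))\<^sup>2) \<le> (LINT x|?M. 2 * D x + 4 * B\<^sup>2 * (norm (sym_grad u x))\<^sup>2)"
  proof (rule integral_mono)
    fix x assume "x \<in> space ?M"
    then have x: "x \<in> \<Omega>" using dom by (simp add: space_restrict_space)
    have "(u x $ i)\<^sup>2 \<le> 2 * d i x + 4 * B\<^sup>2 * (grad_matrix u x $ i $ i)\<^sup>2" for i
    proof -
      define a g y where "a = u x $ i" and "g = grad_matrix u x $ i $ i" and "y = x $ i"
      have "\<bar>y\<bar> \<le> B" using B[OF x] component_le_norm_cart[of x i] unfolding y_def by linarith
      then have "y\<^sup>2 \<le> B\<^sup>2" using power_mono[of "\<bar>y\<bar>" B 2] by simp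
      then have "y\<^sup>2 * g\<^sup>2 \<le> B\<^sup>2 * g\<^sup>2" by (rule mult_right_mono) simp
      \<comment> \<open>Here \<open>d i x\<close> is \<open>a\<^sup>2 + 2 * a * g * y\<close>.
        Completing the square in \<open>2 * d i x - a\<^sup>2\<close> leaves at worst
        \<open>- 4 * y\<^sup>2 * g\<^sup>2\<close>, which is the origin of the factor 4.\<close>
      moreover have "0 \<le> (a + 2 * y * g)\<^sup>2" by simp
      ultimately have "a\<^sup>2 \<le> 2 * (g * (a * y) + a * (g * y + a * 1)) + 4 * B\<^sup>2 * g\<^sup>2"
        by (simp add: power2_eq_square algebra_simps)
      then show ?thesis unfolding d_def a_def g_def y_def .
    qed
    then have "(norm (u x))\<^sup>2 \<le> (\<Sum>i\<in>UNIV. 2 * d i x + 4 * B\<^sup>2 * (grad_matrix u x $ i $ i)\<^sup>2)"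
      unfolding norm_vec_power2 by (intro sum_mono)
    also have "\<dots> = 2 * D x + 4 * B\<^sup>2 * (\<Sum>i\<in>UNIV. (grad_matrix u x $ i $ i)\<^sup>2)"
      by (simp add: D_def sum.distrib sum_distrib_left)
    also have "\<dots> \<le> 2 * D x + 4 * B\<^sup>2 * (norm (sym_grad u x))\<^sup>2"
      using sum_diag_sym_grad_le[of u x] by (intro add_left_mono mult_left_mono) auto
    finally show "(norm (u x))\<^sup>2 \<le> 2 * D x + 4 * B\<^sup>2 * (norm (sym_grad u x))\<^sup>2" .
  qed (use iu iS div(1) in auto)
  also have "\<dots> = 2 * (LINT x|?M. D x) + 4 * B\<^sup>2 * (LINT x|?M. (norm (sym_grad u x))\<^sup>2)"
    using iS div(1) by simp
  finally show ?thesis using div(2) by simp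
qed

lemma lip_field_shift:
  "lip_field (Periodic p) F \<Longrightarrow> lip_field (Periodic p) (\<lambda>x. F (x + c))"
  unfolding lip_field_def
proof (safe, goal_cases)
  case (2 B C)
  then show ?case
    by (intro exI[of _ C] lipschitz_onI) (auto dest: lipschitz_onD[of _ _ _ "_ + c" "_ + c"] lipschitz_on_nonneg)
next
  case (3 B C)
  then have "F (x + c + axis i (p $ i)) = F (x + c)" for x i by simp
  then show ?case by (simp add: algebra_simps)
qed auto

lemma has_partial_shift: "has_partial F i d (x + c) \<Longrightarrow> has_partial (\<lambda>x. F (x + c)) i d x"
  by (simp add: has_partial_def algebra_simps)

text \<open>Difference quotients take the place of one of the two derivatives, because second derivatives
  need not exist.\<close>

lemma korn_periodic:
  fixes u :: "real^'n \<Rightarrow> real^'n" and p :: "real^'n"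
  defines "R \<equiv> Periodic p"
  assumes R: "valid_region R"
    and u: "\<And>j. lip_field R (\<lambda>x. u x $ j)"
    and G: "\<And>i j. lip_field R (\<lambda>x. grad_matrix u x $ i $ j)"
    and diff: "\<And>x. x \<in> field_domain R \<Longrightarrow> u differentiable at x"
    and div: "\<And>x. x \<in> field_domain R \<Longrightarrow> divergence u x = 0"
  shows "(LINT x|lebesgue_on (flow_domain R). (norm (grad_matrix u x))\<^sup>2)
     = 2 * (LINT x|lebesgue_on (flow_domain R). (norm (sym_grad u x))\<^sup>2)"
proof -
  let ?M = "lebesgue_on (flow_domain R)"
  have dom: "field_domain R = UNIV" "flow_domain R = box 0 p" by (simp_all add: R_def)
  define g where "g j i x = grad_matrix u x $ j $ i" for i j x
  have g: "lip_field R (g j i)" for i j unfolding g_def using G by simp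
  have pu: "has_partial (\<lambda>z. u z $ j) i (g j i x) x" for i j x
    unfolding g_def by (rule has_partial_grad_matrix[OF diff]) (simp add: dom)
  have tr: "(\<Sum>i\<in>UNIV. g i i x) = 0" for x
    using div[of x] by (simp add: divergence_def trace_def g_def dom)
  define h where "h n = inverse (real (Suc n))" for n
  have h: "h \<longlonglongrightarrow> 0" "\<And>n. h n > 0"
    unfolding h_def using LIMSEQ_inverse_real_of_nat by auto
  \<comment> \<open>Formally the integrand is the divergence of \<open>u $ j\<close> times the
    derivative of \<open>u\<close> along \<open>j\<close>, since that derivative is again
    divergence-free. The fluxes \<open>F n\<close> use the difference quotient along
    \<open>j\<close> instead.\<close>
  have cross: "(LINT x|?M. (\<Sum>i\<in>UNIV. g j i x * g i j x)) = 0" for j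
  proof -
    define s where "s n i x = (u (x + h n *\<^sub>R axis j 1) $ i - u x $ i) / h n" for n i x
    define F where "F n i x = u x $ j * s n i x" for n i x
    have s_eq: "s n i = (\<lambda>x. (1 / h n) * (u (x + h n *\<^sub>R axis j 1) $ i - u x $ i))" for n i
      by (simp add: s_def fun_eq_iff)
    have ls: "lip_field R (s n i)" for n i
      unfolding s_eq using lip_field_shift[of p "\<lambda>x. u x $ i"] u[of i]
      by (intro lip_field_cmult lip_field_diff) (auto simp: R_def)
    have lF: "lip_field R (F n i)" for n i unfolding F_def by (intro lip_field_mult u ls)
    have wF: "wall_zero R (F n i)" for n i by (simp add: R_def)
    have lD: "lip_field R (\<lambda>x. \<Sum>i\<in>UNIV. g j i x * s n i x)" for n
      by (intro lip_field_sum lip_field_mult g ls)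
    have zero: "(LINT x|?M. (\<Sum>i\<in>UNIV. g j i x * s n i x)) = 0" for n
    proof (rule region_divergence_theorem(2)[OF R lF wF lip_field_measurable[OF R lD]])
      show "AE x in ?M. \<exists>d. (\<forall>i. has_partial (F n i) i (d i) x) \<and> (\<Sum>i\<in>UNIV. g j i x * s n i x) = (\<Sum>i\<in>UNIV. d i)"
      proof (rule AE_I2)
        fix x :: "real^'n"
        let ?y = "x + h n *\<^sub>R axis j 1"
        \<comment> \<open>Summed over \<open>i\<close>, the second term is a difference quotient of
          the divergence of \<open>u\<close> and vanishes by \<open>tr\<close>.\<close>
        define d where "d i = g j i x * s n i x + u x $ j * (0 * (u ?y $ i - u x $ i) + (1 / h n) * (g i i ?y - g i i x))" for i
        have ps: "has_partial (s n i) i (0 * (u ?y $ i - u x $ i) + (1 / h n) * (g i i ?y - g i i x)) x" for i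
          unfolding s_eq by (intro has_partial_mult has_partial_const has_partial_diff pu has_partial_shift)
        have "has_partial (F n i) i (d i) x" for i
          unfolding F_def d_def by (intro has_partial_mult pu ps)
        moreover have "(\<Sum>i\<in>UNIV. d i) = (\<Sum>i\<in>UNIV. g j i x * s n i x)
          + u x $ j * ((1 / h n) * ((\<Sum>i\<in>UNIV. g i i ?y) - (\<Sum>i\<in>UNIV. g i i x)))"
          unfolding d_def by (simp only: sum.distrib sum_distrib_left sum_subtractf[symmetric]) simp
        ultimately show "\<exists>d. (\<forall>i. has_partial (F n i) i (d i) x) \<and> (\<Sum>i\<in>UNIV. g j i x * s n i x) = (\<Sum>i\<in>UNIV. d i)"
          by (intro exI[of _ d]) (simp add: tr)
      qed
    qed
    obtain B where B: "\<And>i x. \<bar>g j i x\<bar> \<le> B i"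
      using g unfolding lip_field_def dom by (metis UNIV_I)
    obtain C where C: "\<And>i. (C i)-lipschitz_on UNIV (\<lambda>x. u x $ i)"
      using u unfolding lip_field_def dom by metis
    have sC: "\<bar>s n i x\<bar> \<le> C i" for n i x
    proof -
      have "\<bar>u (x + h n *\<^sub>R axis j 1) $ i - u x $ i\<bar> \<le> C i * h n"
        using lipschitz_onD[OF C, of "x + h n *\<^sub>R axis j 1" x i] h(2)[of n] by (simp add: dist_norm norm_axis_1)
      then show ?thesis using h(2)[of n] by (simp add: s_def abs_divide divide_le_eq)
    qed
    interpret finite_measure ?M
      using flow_domain_lmeasurable[OF R] by (rule finite_measure_lebesgue_on)
    have "(\<lambda>n. LINT x|?M. (\<Sum>i\<in>UNIV. g j i x * s n i x)) \<longlonglongrightarrow> (LINT x|?M. (\<Sum>i\<in>UNIV. g j i x * g i j x))"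
    proof (rule integral_dominated_convergence)
      show "integrable ?M (\<lambda>_. \<Sum>i\<in>UNIV. B i * C i)" by simp
      show "(\<lambda>x. \<Sum>i\<in>UNIV. g j i x * g i j x) \<in> borel_measurable ?M"
        by (intro lip_field_measurable[OF R] lip_field_sum lip_field_mult g)
      show "(\<lambda>x. \<Sum>i\<in>UNIV. g j i x * s n i x) \<in> borel_measurable ?M" for n
        by (intro lip_field_measurable[OF R] lD)
      show "AE x in ?M. norm (\<Sum>i\<in>UNIV. g j i x * s n i x) \<le> (\<Sum>i\<in>UNIV. B i * C i)" for n
      proof (intro AE_I2 order_trans[OF norm_sum] sum_mono)
        fix x i
        have "\<bar>g j i x\<bar> * \<bar>s n i x\<bar> \<le> B i * C i"
          using B[of i x] by (intro mult_mono B sC) auto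
        then show "norm (g j i x * s n i x) \<le> B i * C i" by (simp add: abs_mult)
      qed
      show "AE x in ?M. (\<lambda>n. \<Sum>i\<in>UNIV. g j i x * s n i x) \<longlonglongrightarrow> (\<Sum>i\<in>UNIV. g j i x * g i j x)"
      proof (intro AE_I2 tendsto_sum tendsto_mult tendsto_const)
        show "(\<lambda>n. s n i x) \<longlonglongrightarrow> g i j x" for i x
          unfolding s_def by (rule diff_quotient_tendsto_partial[OF pu h(1)]) (metis h(2) less_irrefl)
      qed
    qed
    then show ?thesis by (simp add: zero LIMSEQ_const_iff)
  qed
  have lc: "lip_field R (\<lambda>x. \<Sum>i\<in>UNIV. g j i x * g i j x)" for j
    by (intro lip_field_sum lip_field_mult g)
  have lG: "lip_field R (\<lambda>x. (norm (grad_matrix u x))\<^sup>2)"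
    unfolding norm_matrix_power2 unfolding power2_eq_square by (intro lip_field_sum lip_field_mult G)
  \<comment> \<open>Expanding the square of the symmetric part produces the mixed products that
    integrate to zero by \<open>cross\<close>.\<close>
  have pt: "2 * (norm (sym_grad u x))\<^sup>2 = (norm (grad_matrix u x))\<^sup>2 + (\<Sum>j\<in>UNIV. \<Sum>i\<in>UNIV. g j i x * g i j x)" for x
  proof -
    have 1: "2 * (norm (sym_grad u x))\<^sup>2 = (\<Sum>i\<in>UNIV. \<Sum>j\<in>UNIV. (1/2) * (g i j x)\<^sup>2 + (1/2) * (g j i x)\<^sup>2 + g i j x * g j i x)"
      unfolding norm_matrix_power2 sum_distrib_left
      by (intro sum.cong refl) (simp add: sym_grad_component g_def power2_eq_square field_simps)
    have 2: "(\<Sum>i\<in>UNIV. \<Sum>j\<in>UNIV. (g j i x)\<^sup>2) = (\<Sum>i\<in>UNIV. \<Sum>j\<in>UNIV. (g i j x)\<^sup>2)"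
      by (rule sum.swap)
    have 3: "(norm (grad_matrix u x))\<^sup>2 = (\<Sum>i\<in>UNIV. \<Sum>j\<in>UNIV. (g i j x)\<^sup>2)"
      by (simp add: norm_matrix_power2 g_def)
    show ?thesis unfolding 1 3 using 2
      by (simp add: sum.distrib sum_divide_distrib[symmetric])
  qed
  have "2 * (LINT x|?M. (norm (sym_grad u x))\<^sup>2) = (LINT x|?M. (norm (grad_matrix u x))\<^sup>2 + (\<Sum>j\<in>UNIV. \<Sum>i\<in>UNIV. g j i x * g i j x))"
    unfolding pt[symmetric] by simp
  also have "\<dots> = (LINT x|?M. (norm (grad_matrix u x))\<^sup>2) + (\<Sum>j\<in>UNIV. LINT x|?M. (\<Sum>i\<in>UNIV. g j i x * g i j x))"
  proof -
    have "integrable ?M (\<lambda>x. \<Sum>i\<in>UNIV. g j i x * g i j x)" for j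
      by (rule lip_field_integrable[OF R lc])
    then show ?thesis
      using lip_field_integrable[OF R lG] by (subst Bochner_Integration.integral_add) auto
  qed
  finally show ?thesis using cross by simp
qed

section \<open>Mean square increments and the periodic Poincare inequality\<close>

lemma norm_sum_power2_le:
  fixes a :: "nat \<Rightarrow> 'a::real_normed_vector"
  shows "(norm (\<Sum>k<N. a k))\<^sup>2 \<le> N * (\<Sum>k<N. (norm (a k))\<^sup>2)"
proof -
  have "(norm (\<Sum>k<N. a k))\<^sup>2 \<le> (\<Sum>k<N. norm (a k))\<^sup>2"
    by (intro power_mono norm_sum) auto
  also have "\<dots> \<le> (\<Sum>k<N. (norm (a k))\<^sup>2) * card {..<N}"
    by (rule sum_squared_le_sum_of_squares)
  finally show ?thesis by (simp add: mult.commute)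
qed

lemma norm_matrix_vector_mult_le:
  fixes A :: "real^'m^'n"
  shows "norm (A *v z) \<le> norm A * norm z"
proof -
  have "(norm (A *v z))\<^sup>2 \<le> (norm A)\<^sup>2 * (norm z)\<^sup>2"
  proof -
    have "((A *v z) $ i)\<^sup>2 \<le> (norm (A $ i))\<^sup>2 * (norm z)\<^sup>2" for i
    proof -
      have "\<bar>(A $ i) \<bullet> z\<bar> \<le> norm (A $ i) * norm z" by (rule Cauchy_Schwarz_ineq2)
      then have "((A $ i) \<bullet> z)\<^sup>2 \<le> (norm (A $ i) * norm z)\<^sup>2"
        using power_mono[of "\<bar>(A $ i) \<bullet> z\<bar>" _ 2] by simp
      then show ?thesis by (simp add: matrix_vector_mul_component power_mult_distrib)
    qed
    then have "(norm (A *v z))\<^sup>2 \<le> (\<Sum>i\<in>UNIV. (norm (A $ i))\<^sup>2 * (norm z)\<^sup>2)"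
      unfolding norm_vec_power2[of "A *v z"] by (rule sum_mono)
    also have "\<dots> = (norm A)\<^sup>2 * (norm z)\<^sup>2"
      by (simp add: norm_matrix_power2 norm_vec_power2 sum_distrib_right)
    finally show ?thesis .
  qed
  then show ?thesis
    by (metis mult_nonneg_nonneg norm_ge_zero power2_le_imp_le power_mult_distrib)
qed

lemma has_derivative_grad_matrix:
  assumes "u differentiable at x"
  shows "(u has_derivative (*v) (grad_matrix u x)) (at x)"
proof -
  have D: "(u has_derivative frechet_derivative u (at x)) (at x)"
    using assms frechet_derivative_works by blast
  moreover have "(*v) (grad_matrix u x) = frechet_derivative u (at x)"
    unfolding grad_matrix_def using matrix_vector_mul(2)[OF has_derivative_linear[OF D]] .
  ultimately show ?thesis by simp
qed

text \<open>The increment along \<open>z\<close> is the sum of \<open>N\<close> increments along \<open>z / N\<close>, which by periodicity have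
  the same mean square; then \<open>N \<rightarrow> \<infinity>\<close>.\<close>

lemma integral_increment_le:
  fixes u :: "real^'n \<Rightarrow> real^'n" and p :: "real^'n"
  defines "R \<equiv> Periodic p"
  assumes R: "valid_region R"
    and u: "\<And>j. lip_field R (\<lambda>x. u x $ j)"
    and G: "\<And>i j. lip_field R (\<lambda>x. grad_matrix u x $ i $ j)"
    and diff: "\<And>x. x \<in> field_domain R \<Longrightarrow> u differentiable at x"
    and z: "\<And>i. 0 \<le> z $ i" "\<And>i. z $ i \<le> p $ i"
  shows "(LINT x|lebesgue_on (box 0 p). (norm (u (x + z) - u x))\<^sup>2)
     \<le> (norm z)\<^sup>2 * (LINT x|lebesgue_on (box 0 p). (norm (grad_matrix u x))\<^sup>2)"
proof -
  let ?M = "lebesgue_on (box 0 p)"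
  have dom: "field_domain R = UNIV" "flow_domain R = box 0 p" by (simp_all add: R_def)
  interpret finite_measure ?M by (rule finite_measure_lebesgue_on) simp
  obtain C where C: "\<And>i. (C i)-lipschitz_on UNIV (\<lambda>x. u x $ i)"
    using u unfolding lip_field_def dom by metis
  define K where "K = (\<Sum>i\<in>UNIV. C i)"
  have C0: "C i \<ge> 0" for i using C lipschitz_on_nonneg by blast
  have uK: "norm (u x - u y) \<le> K * norm (x - y)" for x y
  proof -
    have "norm (u x - u y) \<le> (\<Sum>i\<in>UNIV. \<bar>(u x - u y) $ i\<bar>)" by (rule norm_le_l1_cart)
    also have "\<dots> \<le> (\<Sum>i\<in>UNIV. C i * norm (x - y))"
      using lipschitz_onD[OF C] by (intro sum_mono) (simp add: dist_norm)
    finally show ?thesis by (simp add: K_def sum_distrib_right)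
  qed
  have cu: "continuous_on UNIV u"
    by (rule lipschitz_on_continuous_on[of K], rule lipschitz_onI)
      (use uK C0 in \<open>auto simp: dist_norm K_def intro: sum_nonneg\<close>)
  have per: "u (x + axis i (p $ i)) = u x" for x i
    using u unfolding lip_field_def by (simp add: R_def vec_eq_iff)
  have i1: "integrable ?M (\<lambda>x. (norm (u (x + a) - u (x + b)))\<^sup>2)" for a b
  proof (rule integrable_bounded_continuous)
    show "continuous_on (box 0 p) (\<lambda>x. (norm (u (x + a) - u (x + b)))\<^sup>2)"
      by (intro continuous_intros continuous_on_compose2[OF cu]) auto
    show "norm ((norm (u (x + a) - u (x + b)))\<^sup>2) \<le> (K * norm (a - b))\<^sup>2" for x
      using power_mono[OF uK[of "x + a" "x + b"], of 2] by simp
  qed simp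
  define N where "N n = real (Suc n)" for n
  have N: "N n > 0" for n by (simp add: N_def)
  define s where "s n x = N n *\<^sub>R (u (x + (1 / N n) *\<^sub>R z) - u x)" for n x
  have step: "(LINT x|?M. (norm (u (x + z) - u x))\<^sup>2) \<le> (LINT x|?M. (norm (s n x))\<^sup>2)" for n
  proof -
    define y where "y k = (real k / N n) *\<^sub>R z" for k
    define f where "f x = (norm (u (x + (1 / N n) *\<^sub>R z) - u x))\<^sup>2" for x
    \<comment> \<open>All intermediate points stay within one period in each coordinate, so the
      shift lemma applies to each of them.\<close>
    have yz: "0 \<le> y k $ i" "y k $ i \<le> p $ i" if "k \<le> Suc n" for k i
    proof -
      have "0 \<le> real k / N n" "real k / N n \<le> 1" using that by (auto simp: N_def)
      moreover have "0 \<le> (real k / N n) * z $ i"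
        using calculation(1) z(1)[of i] by (rule mult_nonneg_nonneg)
      moreover have "(real k / N n) * z $ i \<le> 1 * z $ i"
        using calculation z(1)[of i] by (intro mult_right_mono) auto
      ultimately show "0 \<le> y k $ i" "y k $ i \<le> p $ i"
        using z(2)[of i] unfolding y_def vector_scaleR_component real_scaleR_def by linarith+
    qed
    have ySuc: "y (Suc k) = y k + (1 / N n) *\<^sub>R z" for k
      by (simp add: y_def add_divide_distrib scaleR_add_left[symmetric])
    have "(norm (u (x + z) - u x))\<^sup>2 \<le> N n * (\<Sum>k<Suc n. f (x + y k))" for x
    proof -
      have "u (x + z) - u x = u (x + y (Suc n)) - u (x + y 0)"
        using N[of n] by (simp add: y_def N_def)
      also have "\<dots> = (\<Sum>k<Suc n. u (x + y (Suc k)) - u (x + y k))"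
        by (rule sum_lessThan_telescope[symmetric])
      finally have "(norm (u (x + z) - u x))\<^sup>2 \<le> real (Suc n) * (\<Sum>k<Suc n. (norm (u (x + y (Suc k)) - u (x + y k)))\<^sup>2)"
        using norm_sum_power2_le[of "\<lambda>k. u (x + y (Suc k)) - u (x + y k)" "Suc n"] by simp
      then show ?thesis unfolding N_def[symmetric] f_def ySuc by (simp add: add.assoc)
    qed
    then have "(LINT x|?M. (norm (u (x + z) - u x))\<^sup>2) \<le> (LINT x|?M. N n * (\<Sum>k<Suc n. f (x + y k)))"
    proof (intro integral_mono)
      show "integrable ?M (\<lambda>x. (norm (u (x + z) - u x))\<^sup>2)" using i1[of z 0] by simp
      have "integrable ?M (\<lambda>x. f (x + y k))" for k
        using i1[of "y k + (1 / N n) *\<^sub>R z" "y k"] by (simp add: f_def add.assoc)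
      then show "integrable ?M (\<lambda>x. N n * (\<Sum>k<Suc n. f (x + y k)))"
        by (intro integrable_mult_right Bochner_Integration.integrable_sum)
    qed
    also have "\<dots> = N n * (\<Sum>k<Suc n. LINT x|?M. f (x + y k))"
    proof -
      have "integrable ?M (\<lambda>x. f (x + y k))" for k
        using i1[of "y k + (1 / N n) *\<^sub>R z" "y k"] by (simp add: f_def add.assoc)
      then show ?thesis
        by (simp only: integral_mult_right_zero) (subst Bochner_Integration.integral_sum, auto)
    qed
    also have "(\<Sum>k<Suc n. LINT x|?M. f (x + y k)) = (\<Sum>k<Suc n. LINT x|?M. f x)"
    proof (rule sum.cong[OF refl])
      fix k assume "k \<in> {..<Suc n}"
      then have k: "k \<le> Suc n" by simp
      show "(LINT x|?M. f (x + y k)) = (LINT x|?M. f x)"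
      proof (rule integral_cell_shift[OF _ _ yz[OF k]])
        show "continuous_on UNIV f"
          unfolding f_def by (intro continuous_intros continuous_on_compose2[OF cu]) auto
        show "f (x + axis i (p $ i)) = f x" for x i
          using per[of "x + (1 / N n) *\<^sub>R z" i] per[of x i] unfolding f_def by (simp add: ac_simps)
      qed
    qed
    \<comment> \<open>One factor \<open>N n\<close> comes from the Cauchy-Schwarz inequality for the
      telescoping sum, the other from \<open>Suc n\<close> equal integrals. Together they turn the
      small increment into the difference quotient \<open>s n\<close>.\<close>
    also have "N n * (\<Sum>k<Suc n. LINT x|?M. f x) = (LINT x|?M. N n * N n * f x)"
      by (simp add: N_def)
    also have "\<dots> = (LINT x|?M. (norm (s n x))\<^sup>2)"
    proof (rule arg_cong[where f="integral\<^sup>L ?M"], rule ext)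
      show "N n * N n * f x = (norm (s n x))\<^sup>2" for x
        using N[of n] by (simp add: s_def f_def power_mult_distrib power2_eq_square)
    qed
    finally show ?thesis .
  qed
  have lG: "lip_field R (\<lambda>x. (norm (grad_matrix u x))\<^sup>2)"
    unfolding norm_matrix_power2 unfolding power2_eq_square by (intro lip_field_sum lip_field_mult G)
  have lGz: "lip_field R (\<lambda>x. (norm (grad_matrix u x *v z))\<^sup>2)"
    unfolding norm_vec_power2 unfolding power2_eq_square matrix_vector_mult_def
    by (simp, intro lip_field_sum lip_field_mult G lip_field_const)
  have "(\<lambda>n. LINT x|?M. (norm (s n x))\<^sup>2) \<longlonglongrightarrow> (LINT x|?M. (norm (grad_matrix u x *v z))\<^sup>2)"
  proof (rule integral_dominated_convergence)
    show "integrable ?M (\<lambda>_. (K * norm z)\<^sup>2)" by simp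
    show "(\<lambda>x. (norm (grad_matrix u x *v z))\<^sup>2) \<in> borel_measurable ?M"
      using lip_field_measurable[OF R lGz] by (simp add: dom)
    show "(\<lambda>x. (norm (s n x))\<^sup>2) \<in> borel_measurable ?M" for n
    proof -
      have "(\<lambda>x. (norm (s n x))\<^sup>2) = (\<lambda>x. (N n)\<^sup>2 * (norm (u (x + (1 / N n) *\<^sub>R z) - u (x + 0)))\<^sup>2)"
        unfolding s_def using N[of n] by (simp add: power_mult_distrib fun_eq_iff)
      then show ?thesis using i1[of "(1 / N n) *\<^sub>R z" 0] by simp
    qed
    show "AE x in ?M. norm ((norm (s n x))\<^sup>2) \<le> (K * norm z)\<^sup>2" for n
    proof (rule AE_I2)
      fix x
      have "norm (s n x) \<le> K * norm z"
        using uK[of "x + (1 / N n) *\<^sub>R z" x] N[of n] unfolding s_def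
        by (simp add: pos_le_divide_eq mult.commute)
      then show "norm ((norm (s n x))\<^sup>2) \<le> (K * norm z)\<^sup>2" by (simp add: power_mono)
    qed
    show "AE x in ?M. (\<lambda>n. (norm (s n x))\<^sup>2) \<longlonglongrightarrow> (norm (grad_matrix u x *v z))\<^sup>2"
    proof (rule AE_I2)
      fix x
      have D: "(u has_derivative (*v) (grad_matrix u x)) (at x)"
        by (intro has_derivative_grad_matrix diff) (simp add: dom)
      have "((\<lambda>h::real. x + h *\<^sub>R z) has_derivative (\<lambda>h. h *\<^sub>R z)) (at 0)"
        by (auto intro!: derivative_eq_intros)
      then have "(u \<circ> (\<lambda>h::real. x + h *\<^sub>R z) has_derivative (*v) (grad_matrix u x) \<circ> (\<lambda>h. h *\<^sub>R z)) (at 0)"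
        using D by (intro diff_chain_at) auto
      then have D0: "((\<lambda>h. u (x + h *\<^sub>R z)) has_derivative (\<lambda>h. h *\<^sub>R (grad_matrix u x *v z))) (at 0)"
        by (simp add: o_def matrix_vector_mult_scaleR)
      have N0: "filterlim (\<lambda>n. 1 / N n) (at 0) sequentially"
        using N LIMSEQ_inverse_real_of_nat by (auto simp: filterlim_at N_def inverse_eq_divide)
      have "(\<lambda>n. s n x) \<longlonglongrightarrow> grad_matrix u x *v z"
      proof (rule vec_tendstoI)
        fix i
        have "((\<lambda>h. u (x + h *\<^sub>R z) $ i) has_derivative (\<lambda>h. (h *\<^sub>R (grad_matrix u x *v z)) $ i)) (at 0)"
          by (rule bounded_linear.has_derivative[OF bounded_linear_vec_nth D0])
        then have "((\<lambda>h. u (x + h *\<^sub>R z) $ i) has_real_derivative (grad_matrix u x *v z) $ i) (at 0)"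
          by (rule has_derivative_imp_has_field_derivative) simp
        then have "((\<lambda>h. (u (x + h *\<^sub>R z) $ i - u x $ i) / h) \<longlongrightarrow> (grad_matrix u x *v z) $ i) (at 0)"
          by (simp add: DERIV_def)
        from filterlim_compose[OF this N0]
        have "(\<lambda>n. (u (x + (1 / N n) *\<^sub>R z) $ i - u x $ i) / (1 / N n)) \<longlonglongrightarrow> (grad_matrix u x *v z) $ i" .
        then show "(\<lambda>n. s n x $ i) \<longlonglongrightarrow> (grad_matrix u x *v z) $ i"
          by (simp add: s_def mult.commute)
      qed
      then show "(\<lambda>n. (norm (s n x))\<^sup>2) \<longlonglongrightarrow> (norm (grad_matrix u x *v z))\<^sup>2"
        by (intro tendsto_intros)
    qed
  qed
  then have "(LINT x|?M. (norm (u (x + z) - u x))\<^sup>2) \<le> (LINT x|?M. (norm (grad_matrix u x *v z))\<^sup>2)"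
    using step by (intro LIMSEQ_le_const) auto
  also have "\<dots> \<le> (LINT x|?M. (norm z)\<^sup>2 * (norm (grad_matrix u x))\<^sup>2)"
  proof (rule integral_mono)
    show "integrable ?M (\<lambda>x. (norm (grad_matrix u x *v z))\<^sup>2)"
      using lip_field_integrable[OF R lGz] by (simp add: dom)
    show "integrable ?M (\<lambda>x. (norm z)\<^sup>2 * (norm (grad_matrix u x))\<^sup>2)"
      using lip_field_integrable[OF R lG] by (simp add: dom)
    show "(norm (grad_matrix u x *v z))\<^sup>2 \<le> (norm z)\<^sup>2 * (norm (grad_matrix u x))\<^sup>2" for x
      using power_mono[OF norm_matrix_vector_mult_le[of "grad_matrix u x" z], of 2]
      by (simp add: power_mult_distrib mult.commute)
  qed
  finally show ?thesis by simp
qed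

text \<open>With a wall the value is zero instead of the average: a test field must vanish at the
  wall, and there the Poincare inequality holds without subtracting anything. With this convention
  both boundary conditions share one energy argument.\<close>

fun mean_field :: "'n::finite flow_region \<Rightarrow> (real^'n \<Rightarrow> real^'n) \<Rightarrow> real^'n" where
  "mean_field (No_Slip \<Omega>) u = 0"
| "mean_field (Periodic p) u =
     (1 / measure lebesgue (box 0 p)) *\<^sub>R (LINT x|lebesgue_on (box 0 p). u x)"

lemma integral_norm_diff_const:
  fixes u :: "'a::euclidean_space \<Rightarrow> 'b::euclidean_space"
  assumes A: "A \<in> lmeasurable" and u: "integrable (lebesgue_on A) u" "integrable (lebesgue_on A) (\<lambda>x. (norm (u x))\<^sup>2)"
  shows "integrable (lebesgue_on A) (\<lambda>x. (norm (u x - c))\<^sup>2)"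
    "(LINT x|lebesgue_on A. (norm (u x - c))\<^sup>2)
     = (LINT x|lebesgue_on A. (norm (u x))\<^sup>2) - 2 * (c \<bullet> (LINT x|lebesgue_on A. u x)) + measure lebesgue A * (norm c)\<^sup>2"
proof -
  interpret finite_measure "lebesgue_on A" using A by (rule finite_measure_lebesgue_on)
  have eq: "(norm (u x - c))\<^sup>2 = (norm (u x))\<^sup>2 - 2 * (c \<bullet> u x) + (norm c)\<^sup>2" for x
    by (simp add: power2_norm_eq_inner inner_diff_left inner_diff_right inner_commute)
  have i: "integrable (lebesgue_on A) (\<lambda>x. c \<bullet> u x)" using u(1) by simp
  show "integrable (lebesgue_on A) (\<lambda>x. (norm (u x - c))\<^sup>2)" unfolding eq using u(2) i by simp
  have m: "measure (lebesgue_on A) (space (lebesgue_on A)) = measure lebesgue A"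
    using A by (simp add: space_restrict_space measure_restrict_space fmeasurableD)
  show "(LINT x|lebesgue_on A. (norm (u x - c))\<^sup>2)
     = (LINT x|lebesgue_on A. (norm (u x))\<^sup>2) - 2 * (c \<bullet> (LINT x|lebesgue_on A. u x)) + measure lebesgue A * (norm c)\<^sup>2"
    unfolding eq using u i m by simp
qed

text \<open>At a wall both sides are zero; for a periodic flow this is the definition of the
  average. It yields one variance formula for both cases.\<close>

lemma mean_field_inner_integral:
  assumes "valid_region R"
  shows "mean_field R u \<bullet> (LINT x|lebesgue_on (flow_domain R). u x)
     = measure lebesgue (flow_domain R) * (norm (mean_field R u))\<^sup>2"
proof (cases R)
  case (Periodic p)
  let ?I = "LINT x|lebesgue_on (box 0 p). u x"
  have m: "measure lebesgue (box 0 p) \<noteq> 0" using flow_domain_measure_pos[OF assms] Periodic by simp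
  define v where "v = mean_field R u"
  have I: "?I = measure lebesgue (box 0 p) *\<^sub>R v" using m Periodic by (simp add: v_def)
  have "v \<bullet> ?I = measure lebesgue (box 0 p) * (norm v)\<^sup>2"
    unfolding I by (simp add: power2_norm_eq_inner)
  then show ?thesis unfolding v_def Periodic flow_domain.simps .
qed simp

lemma integral_norm_diff_mean_field:
  fixes u :: "real^'n \<Rightarrow> real^'n"
  assumes R: "valid_region R" and u: "integrable (lebesgue_on (flow_domain R)) u" "integrable (lebesgue_on (flow_domain R)) (\<lambda>x. (norm (u x))\<^sup>2)"
  shows "(LINT x|lebesgue_on (flow_domain R). (norm (u x - mean_field R u))\<^sup>2)
     = (LINT x|lebesgue_on (flow_domain R). (norm (u x))\<^sup>2) - measure lebesgue (flow_domain R) * (norm (mean_field R u))\<^sup>2"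
  unfolding integral_norm_diff_const(2)[OF flow_domain_lmeasurable[OF R] u] mean_field_inner_integral[OF R] by simp

text \<open>Passes to the gauge integral over the closed cell, where the order of integration of a
  continuous function can be exchanged by \<open>integral_swap_continuous\<close>.\<close>

lemma integral_cell_eq:
  fixes f :: "real^'n \<Rightarrow> 'b::euclidean_space"
  assumes "continuous_on UNIV f"
  shows "(LINT x|lebesgue_on (box 0 p). f x) = integral (cbox 0 p) f"
proof -
  obtain B where "\<And>x. x \<in> cbox 0 p \<Longrightarrow> norm (f x) \<le> B"
    using compact_imp_bounded[OF compact_continuous_image[OF continuous_on_subset[OF assms]], of "cbox 0 p"]
    by (auto simp: bounded_iff)
  then have "integrable (lebesgue_on (box 0 p)) f"
    using assms box_subset_cbox by (intro integrable_bounded_continuous[where B=B]) (auto intro: continuous_on_subset)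
  then show ?thesis
    using lebesgue_integral_eq_integral[of "box 0 p" f] by (simp add: integral_open_interval)
qed

text \<open>The squared increment \<open>f x z\<close> is integrated over the cell in both
  variables. Integration in \<open>z\<close> first gives, by periodicity, twice the measure of the
  cell times the integral of the squared fluctuation once \<open>x\<close> is integrated too.
  Integration in \<open>x\<close> first is bounded for each shift \<open>z\<close> by
  \<open>integral_increment_le\<close>. Dividing by twice the measure gives the factor 1/2.\<close>

lemma poincare_periodic:
  fixes u :: "real^'n \<Rightarrow> real^'n" and p :: "real^'n"
  defines "R \<equiv> Periodic p"
  assumes R: "valid_region R"
    and u: "\<And>j. lip_field R (\<lambda>x. u x $ j)"
    and G: "\<And>i j. lip_field R (\<lambda>x. grad_matrix u x $ i $ j)"
    and diff: "\<And>x. x \<in> field_domain R \<Longrightarrow> u differentiable at x"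
  shows "(LINT x|lebesgue_on (box 0 p). (norm (u x - mean_field R u))\<^sup>2)
     \<le> (norm p)\<^sup>2 / 2 * (LINT x|lebesgue_on (box 0 p). (norm (grad_matrix u x))\<^sup>2)"
proof -
  let ?M = "lebesgue_on (box 0 p)"
  let ?m = "measure lebesgue (box 0 p)"
  have dom: "field_domain R = UNIV" "flow_domain R = box 0 p" by (simp_all add: R_def)
  have p: "p $ i > 0" for i using R by (simp add: R_def)
  have m: "?m > 0" using flow_domain_measure_pos[OF R] dom by simp
  have mc: "measure lebesgue (cbox 0 p) = ?m"
    by (simp add: measure_completion measure_lborel_cbox_eq measure_lborel_box_eq)
  have cu: "continuous_on UNIV u"
  proof -
    have "continuous_on UNIV (\<lambda>x. \<chi> i. u x $ i)"
      using u unfolding lip_field_def dom by (intro continuous_on_vec_lambda) (meson lipschitz_on_continuous_on)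
    then show ?thesis by simp
  qed
  have per: "u (x + axis i (p $ i)) = u x" for x i
    using u unfolding lip_field_def by (simp add: R_def vec_eq_iff)
  have iu: "integrable ?M u"
    using integrable_bounded_continuous[of "box 0 p" u] compact_imp_bounded[OF compact_continuous_image[OF continuous_on_subset[OF cu]], of "cbox 0 p"]
      box_subset_cbox[of 0 p] continuous_on_subset[OF cu] by (auto simp: bounded_iff subset_iff)
  have iu2: "integrable ?M (\<lambda>x. (norm (u x))\<^sup>2)"
    using lip_field_integrable[OF R lip_field_norm_power2[OF u]] dom by simp
  define K where "K = (LINT x|?M. (norm (grad_matrix u x))\<^sup>2)"
  have K: "K \<ge> 0" unfolding K_def by simp
  define I where "I = (LINT x|?M. u x)"
  define J where "J = (LINT x|?M. (norm (u x))\<^sup>2)"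
  define f where "f x z = (norm (u (x + z) - u x))\<^sup>2" for x z
  have cu': "continuous_on S (\<lambda>y. u (g y))" if "continuous_on S g" for S and g :: "'b::topological_space \<Rightarrow> real^'n"
    using that by (intro continuous_on_compose2[OF cu]) auto
  have cf: "continuous_on S (\<lambda>(x, z). f x z)" for S
    unfolding f_def case_prod_beta by (intro continuous_intros cu')
  have cf': "continuous_on S (\<lambda>(z, x). f x z)" for S
    unfolding f_def case_prod_beta by (intro continuous_intros cu')
  have cf1: "continuous_on S (\<lambda>x. f x z)" "continuous_on S (f x)" for S x z
    unfolding f_def by (intro continuous_intros cu')+
  \<comment> \<open>For fixed \<open>x\<close> the shift by \<open>x\<close> is removed, so the
    increment becomes the distance of \<open>u\<close> from the constant \<open>u x\<close>.\<close>
  have inner: "integral (cbox 0 p) (f x) = J - 2 * (u x \<bullet> I) + ?m * (norm (u x))\<^sup>2" if x: "x \<in> cbox 0 p" for x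
  proof -
    have "integral (cbox 0 p) (f x) = (LINT z|?M. (\<lambda>y. (norm (u y - u x))\<^sup>2) (z + x))"
      unfolding integral_cell_eq[OF cf1(2), symmetric]
      by (intro Bochner_Integration.integral_cong) (simp_all add: f_def add.commute)
    also have "\<dots> = (LINT y|?M. (norm (u y - u x))\<^sup>2)"
    proof (rule integral_cell_shift)
      show "continuous_on UNIV (\<lambda>y. (norm (u y - u x))\<^sup>2)" by (intro continuous_intros cu)
    qed (use x per in \<open>auto simp: mem_box_cart\<close>)
    also have "\<dots> = J - 2 * (u x \<bullet> I) + ?m * (norm (u x))\<^sup>2"
      unfolding J_def I_def by (rule integral_norm_diff_const(2)[OF _ iu iu2]) simp
    finally show ?thesis .
  qed
  have "2 * ?m * J - 2 * (norm I)\<^sup>2 = (LINT x|?M. J - 2 * (u x \<bullet> I) + ?m * (norm (u x))\<^sup>2)"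
  proof -
    interpret finite_measure ?M by (rule finite_measure_lebesgue_on) simp
    have "measure ?M (space ?M) = ?m"
      by (simp add: space_restrict_space measure_restrict_space fmeasurableD)
    then show ?thesis using iu iu2 by (simp add: I_def J_def power2_norm_eq_inner)
  qed
  also have "\<dots> = integral (cbox 0 p) (\<lambda>x. J - 2 * (u x \<bullet> I) + ?m * (norm (u x))\<^sup>2)"
    by (intro integral_cell_eq continuous_intros cu)
  also have "\<dots> = integral (cbox 0 p) (\<lambda>x. integral (cbox 0 p) (f x))"
    using inner by (intro Henstock_Kurzweil_Integration.integral_cong) auto
  also have "\<dots> = integral (cbox 0 p) (\<lambda>z. integral (cbox 0 p) (\<lambda>x. f x z))"
    by (rule integral_swap_continuous[OF cf])
  also have "\<dots> \<le> integral (cbox 0 p) (\<lambda>z. (norm p)\<^sup>2 * K)"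
  proof (rule integral_le)
    show "(\<lambda>z. integral (cbox 0 p) (\<lambda>x. f x z)) integrable_on cbox 0 p"
      by (intro integrable_continuous integral_continuous_on_param cf')
    fix z assume z: "z \<in> cbox 0 p"
    then have zi: "0 \<le> z $ i" "z $ i \<le> p $ i" for i by (auto simp: mem_box_cart)
    have "integral (cbox 0 p) (\<lambda>x. f x z) = (LINT x|?M. (norm (u (x + z) - u x))\<^sup>2)"
      unfolding integral_cell_eq[OF cf1(1), symmetric] by (simp add: f_def)
    also have "\<dots> \<le> (norm z)\<^sup>2 * K"
      unfolding K_def using R u G diff zi unfolding R_def by (intro integral_increment_le) auto
    \<comment> \<open>Shifts in the closed cell are no longer than its diagonal
      \<open>p\<close>.\<close>
    also have "\<dots> \<le> (norm p)\<^sup>2 * K"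
    proof -
      have "(norm z)\<^sup>2 \<le> (norm p)\<^sup>2"
        unfolding norm_vec_power2 using zi by (intro sum_mono power_mono) auto
      then show ?thesis using K by (rule mult_right_mono)
    qed
    finally show "integral (cbox 0 p) (\<lambda>x. f x z) \<le> (norm p)\<^sup>2 * K" .
  qed (rule integrable_const)
  also have "\<dots> = ?m * ((norm p)\<^sup>2 * K)"
    using mc by (simp add: measure_completion)
  finally have main: "?m * J - (norm I)\<^sup>2 \<le> ?m * ((norm p)\<^sup>2 / 2 * K)" by simp
  have "(LINT x|?M. (norm (u x - mean_field R u))\<^sup>2) = J - ?m * (norm (mean_field R u))\<^sup>2"
    using integral_norm_diff_mean_field[OF R] iu iu2 unfolding dom J_def by blast
  also have "\<dots> = (?m * J - (norm I)\<^sup>2) / ?m"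
    using m by (simp add: R_def I_def power_divide field_simps power2_eq_square)
  also have "\<dots> \<le> (norm p)\<^sup>2 / 2 * K"
    using main m by (simp add: pos_divide_le_eq mult.commute)
  finally show ?thesis unfolding K_def .
qed

text \<open>The class on which the Poincare constant is uniform. The wall condition is imposed on
  the fluctuation, which is the test field of the energy balance.\<close>

definition velocity_field :: "'n::finite flow_region \<Rightarrow> (real^'n \<Rightarrow> real^'n) \<Rightarrow> bool" where
  "velocity_field R u \<longleftrightarrow>
     (\<forall>j. lip_field R (\<lambda>x. u x $ j)) \<and> (\<forall>i j. lip_field R (\<lambda>x. grad_matrix u x $ i $ j)) \<and>
     (\<forall>j. wall_zero R (\<lambda>x. u x $ j - mean_field R u $ j)) \<and>
     (\<forall>x\<in>field_domain R. u differentiable at x \<and> divergence u x = 0)"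

text \<open>The constant is obtained before \<open>u\<close>, so it depends on the region alone;
  this is what later allows a threshold independent of the solution. At a wall the
  \<open>+ 1\<close> keeps the constant positive. In the periodic case the factor 1/2 cancels
  against the factor 2 from \<open>korn_periodic\<close>.\<close>

lemma poincare_velocity_field:
  fixes R :: "'n::finite flow_region"
  assumes R: "valid_region R"
  obtains C where "C > 0"
    "\<And>u. velocity_field R u \<Longrightarrow>
      (LINT x|lebesgue_on (flow_domain R). (norm (u x - mean_field R u))\<^sup>2)
        \<le> C * (LINT x|lebesgue_on (flow_domain R). (norm (sym_grad u x))\<^sup>2)"
proof (cases R)
  case (No_Slip \<Omega>)
  then obtain B where B: "\<And>x. x \<in> \<Omega> \<Longrightarrow> norm x \<le> B"
    using R by (auto simp: bounded_iff)
  show thesis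
  proof (rule that[of "4 * (\<bar>B\<bar> + 1)\<^sup>2"])
    show "4 * (\<bar>B\<bar> + 1)\<^sup>2 > 0" by (simp add: zero_less_power2)
    fix u assume "velocity_field R u"
    moreover have "\<And>x. x \<in> \<Omega> \<Longrightarrow> norm x \<le> \<bar>B\<bar> + 1" using B by fastforce
    ultimately show "(LINT x|lebesgue_on (flow_domain R). (norm (u x - mean_field R u))\<^sup>2)
        \<le> 4 * (\<bar>B\<bar> + 1)\<^sup>2 * (LINT x|lebesgue_on (flow_domain R). (norm (sym_grad u x))\<^sup>2)"
      using poincare_no_slip[of \<Omega> "\<bar>B\<bar> + 1" u] R unfolding No_Slip velocity_field_def by simp
  qed
next
  case (Periodic p)
  then have "p \<noteq> 0" using R by auto
  show thesis
  proof (rule that[of "(norm p)\<^sup>2"])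
    show "(norm p)\<^sup>2 > 0" using \<open>p \<noteq> 0\<close> by simp
    fix u assume "velocity_field R u"
    then show "(LINT x|lebesgue_on (flow_domain R). (norm (u x - mean_field R u))\<^sup>2)
        \<le> (norm p)\<^sup>2 * (LINT x|lebesgue_on (flow_domain R). (norm (sym_grad u x))\<^sup>2)"
      using poincare_periodic[of p u] korn_periodic[of p u] R unfolding Periodic velocity_field_def by auto
  qed
qed

subsection \<open>Regularity of the fields of a solution\<close>

lemma periodic_int_shift:
  assumes per: "\<And>x i. F (x + axis i (p $ i)) = F x"
  shows "F (x + of_int k *\<^sub>R axis i (p $ i)) = F x"
proof (induction k arbitrary: x rule: int_induct[where k=0])
  case (step1 k)
  have "F (x + of_int (k + 1) *\<^sub>R axis i (p $ i)) = F ((x + of_int k *\<^sub>R axis i (p $ i)) + axis i (p $ i))"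
    by (simp add: algebra_simps)
  then show ?case using step1 per by simp
next
  case (step2 k)
  have "F (x + of_int (k - 1) *\<^sub>R axis i (p $ i)) = F ((x + of_int (k - 1) *\<^sub>R axis i (p $ i)) + axis i (p $ i))"
    using per by simp
  then show ?case using step2 by (simp add: algebra_simps)
qed simp

text \<open>Each coordinate is moved back by the integer part of \<open>x $ i / p $ i\<close>
  periods. This reduces bounds on the whole space to a compact cell.\<close>

lemma periodic_representative:
  fixes F :: "real^'n \<Rightarrow> 'b"
  assumes per: "\<And>x i. F (x + axis i (p $ i)) = F x" and p: "\<And>i. p $ i > 0"
  obtains y where "y \<in> cbox 0 p" "F x = F y"
proof
  define k where "k i = - \<lfloor>x $ i / p $ i\<rfloor>" for i
  have *: "F (x + (\<Sum>i\<in>I. of_int (k i) *\<^sub>R axis i (p $ i))) = F x" if "finite I" for I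
    using that
  proof (induction I)
    case (insert i I)
    have "F (x + (\<Sum>i\<in>insert i I. of_int (k i) *\<^sub>R axis i (p $ i)))
      = F ((x + (\<Sum>i\<in>I. of_int (k i) *\<^sub>R axis i (p $ i))) + of_int (k i) *\<^sub>R axis i (p $ i))"
      using insert by (simp add: algebra_simps)
    also have "\<dots> = F x" using periodic_int_shift[of F p, OF per] insert by simp
    finally show ?case .
  qed simp
  let ?y = "x + (\<Sum>i\<in>UNIV. of_int (k i) *\<^sub>R axis i (p $ i))"
  show "F x = F ?y" using * by simp
  have y: "?y $ j = x $ j + of_int (k j) * p $ j" for j
    by (simp add: axis_def if_distrib cong: if_cong)
  show "?y \<in> cbox 0 p"
  proof (simp only: mem_box_cart, intro allI)
    fix j
    have "of_int \<lfloor>x $ j / p $ j\<rfloor> \<le> x $ j / p $ j" "x $ j / p $ j \<le> of_int \<lfloor>x $ j / p $ j\<rfloor> + 1"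
      by linarith+
    then have "of_int \<lfloor>x $ j / p $ j\<rfloor> * p $ j \<le> x $ j" "x $ j \<le> (of_int \<lfloor>x $ j / p $ j\<rfloor> + 1) * p $ j"
      by (simp_all only: pos_le_divide_eq[OF p] pos_divide_le_eq[OF p])
    then show "0 $ j \<le> ?y $ j \<and> ?y $ j \<le> p $ j"
      unfolding y unfolding k_def by (simp add: algebra_simps)
  qed
qed

text \<open>A Lipschitz function is bounded on a bounded set; a periodic one takes all its values on
  one cell.\<close>

lemma lipschitz_field_bounded:
  fixes F :: "real^'n \<Rightarrow> 'b::heine_borel"
  assumes R: "valid_region R" and lip: "C-lipschitz_on (field_domain R) F" and per: "periodic_field R F"
  shows "bounded (F ` field_domain R)"
proof (cases R)
  case (No_Slip \<Omega>)
  then show ?thesis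
    using R lip by (metis bounded_uniformly_continuous_image lipschitz_on_uniformly_continuous field_domain.simps(1) valid_region.simps(1))
next
  case (Periodic p)
  have "bounded (F ` cbox 0 p)"
    using lip Periodic
    by (metis bounded_uniformly_continuous_image lipschitz_on_uniformly_continuous lipschitz_on_subset
        bounded_cbox field_domain.simps(2) subset_UNIV)
  moreover have "F x \<in> F ` cbox 0 p" for x
  proof -
    have "F (x + axis i (p $ i)) = F x" "p $ i > 0" for x i using per R Periodic by auto
    then obtain y where "y \<in> cbox 0 p" "F x = F y" by (rule periodic_representative)
    then show ?thesis by auto
  qed
  ultimately show ?thesis using Periodic by (auto intro: bounded_subset)
qed

lemma lip_fieldI:
  assumes "valid_region R" "C-lipschitz_on (field_domain R) F" "periodic_field R F"
  shows "lip_field R F"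
  using lipschitz_field_bounded[OF assms] assms unfolding lip_field_def by (auto simp: bounded_iff)

lemma norm_diff_le_segment:
  fixes u :: "real^'n \<Rightarrow> real^'n"
  assumes "closed_segment x y \<subseteq> S" "\<And>z. z \<in> S \<Longrightarrow> u differentiable at z"
    and "\<And>z. z \<in> S \<Longrightarrow> norm (grad_matrix u z) \<le> B"
  shows "norm (u x - u y) \<le> B * norm (x - y)"
proof (rule differentiable_bound[where S = "closed_segment x y"])
  fix z assume "z \<in> closed_segment x y"
  then have z: "z \<in> S" using assms by auto
  show "(u has_derivative (*v) (grad_matrix u z)) (at z within closed_segment x y)"
    using has_derivative_grad_matrix[OF assms(2)[OF z]] by (rule has_derivative_at_withinI)
  show "onorm ((*v) (grad_matrix u z)) \<le> B"
    by (rule order_trans[OF onorm_le[OF norm_matrix_vector_mult_le] assms(3)[OF z]])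
qed auto

text \<open>The ball around \<open>x\<close> that reaches to the nearest point \<open>z\<close> of
  the complement lies in \<Omega>, so a bounded gradient may be integrated along the segment towards
  \<open>z\<close>, where the velocity is zero. The resulting linear decay at the wall also yields
  the global Lipschitz bound when \<Omega> is not convex.\<close>

lemma no_slip_velocity_bounds:
  fixes u :: "real^'n \<Rightarrow> real^'n"
  assumes \<Omega>: "open \<Omega>" "bounded \<Omega>"
    and cont: "continuous_on (closure \<Omega>) u" and wall: "\<And>x. x \<in> frontier \<Omega> \<Longrightarrow> u x = 0"
    and diff: "\<And>x. x \<in> \<Omega> \<Longrightarrow> u differentiable at x"
    and B: "\<And>x. x \<in> \<Omega> \<Longrightarrow> norm (grad_matrix u x) \<le> B" and B0: "B \<ge> 0"
  shows "\<And>x. x \<in> \<Omega> \<Longrightarrow> norm (u x) \<le> B * infdist x (- \<Omega>)" "B-lipschitz_on \<Omega> u"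
proof -
  have "\<Omega> \<noteq> UNIV" using \<Omega>(2) not_bounded_UNIV by metis
  then have ne: "- \<Omega> \<noteq> {}" by auto
  show *: "norm (u x) \<le> B * infdist x (- \<Omega>)" if x: "x \<in> \<Omega>" for x
  proof -
    obtain z where z: "z \<in> - \<Omega>" "infdist x (- \<Omega>) = dist x z"
      using infdist_attains_inf[of "- \<Omega>" x] \<Omega>(1) ne by (auto simp: closed_Compl)
    have ball: "ball x (dist x z) \<subseteq> \<Omega>"
    proof
      fix y assume "y \<in> ball x (dist x z)"
      then have "dist x y < infdist x (- \<Omega>)" using z by simp
      then show "y \<in> \<Omega>" using infdist_le[of y "- \<Omega>" x] by force
    qed
    have xz: "dist x z > 0" using x z by auto
    \<comment> \<open>The point \<open>z\<close> lies outside \<Omega>. The mean value inequality is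
      used up to \<open>w n\<close> inside the ball, and continuity on the closure carries the bound
      to \<open>z\<close>.\<close>
    define w where "w n = x + (1 - inverse (real (Suc n))) *\<^sub>R (z - x)" for n
    have "w \<longlonglongrightarrow> x + (1 - 0) *\<^sub>R (z - x)"
      unfolding w_def by (intro tendsto_intros LIMSEQ_inverse_real_of_nat)
    then have wz: "w \<longlonglongrightarrow> z" by simp
    have wd: "dist x (w n) = (1 - inverse (real (Suc n))) * dist x z" for n
    proof -
      have "0 \<le> 1 - inverse (real (Suc n))" by (simp add: inverse_le_1_iff)
      then show ?thesis by (simp add: w_def dist_norm norm_minus_commute)
    qed
    have wb: "w n \<in> ball x (dist x z)" for n
      unfolding mem_ball wd using xz by simp
    have zc: "z \<in> closure \<Omega>"
      using wz wb ball unfolding closure_sequential by (intro exI[of _ w]) auto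
    then have "u z = 0" using z \<Omega>(1) by (intro wall) (simp add: frontier_def interior_open)
    moreover have "(\<lambda>n. u (w n)) \<longlonglongrightarrow> u z"
      using cont zc wz wb ball closure_subset[of \<Omega>] unfolding continuous_on_sequentially by (auto simp: o_def subset_iff)
    ultimately have "(\<lambda>n. norm (u x - u (w n))) \<longlonglongrightarrow> norm (u x - 0)" by (intro tendsto_intros) auto
    moreover have "norm (u x - u (w n)) \<le> B * dist x z" for n
    proof -
      have "closed_segment x (w n) \<subseteq> \<Omega>"
        using closed_segment_subset[of x "ball x (dist x z)" "w n"] wb[of n] xz ball by auto
      then have "norm (u x - u (w n)) \<le> B * norm (x - w n)"
        using diff B by (rule norm_diff_le_segment)
      also have "\<dots> \<le> B * dist x z"
        using wb[of n] B0 by (intro mult_left_mono) (auto simp: dist_norm)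
      finally show ?thesis .
    qed
    ultimately have "norm (u x - 0) \<le> B * dist x z" by (intro LIMSEQ_le_const2) auto
    then show ?thesis using z by simp
  qed
  show "B-lipschitz_on \<Omega> u"
  proof (rule lipschitz_onI[OF _ B0])
    fix x y assume xy: "x \<in> \<Omega>" "y \<in> \<Omega>"
    show "dist (u x) (u y) \<le> B * dist x y"
    proof (cases "closed_segment x y \<subseteq> \<Omega>")
      case True
      then show ?thesis using norm_diff_le_segment[of x y \<Omega> u B] diff B by (simp add: dist_norm)
    next
      case False
      \<comment> \<open>At a point \<open>z\<close> where the segment is outside \<Omega>, each
        velocity is bounded by its distance to \<open>z\<close>, and these two distances add up to
        \<open>dist x y\<close>.\<close>
      then obtain z where z: "z \<in> closed_segment x y" "z \<notin> \<Omega>" by auto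
      have "norm (u x) \<le> B * dist x z" "norm (u y) \<le> B * dist y z"
        using *[OF xy(1)] *[OF xy(2)] infdist_le[of z "- \<Omega>"] z(2) B0
        by (meson ComplI mult_left_mono order_trans)+
      moreover have "dist x z + dist y z = dist x y"
        using z(1) unfolding between_mem_segment[symmetric] between by (simp add: dist_commute)
      moreover have "B * (dist x z + dist y z) = B * dist x z + B * dist y z" by (simp add: distrib_left)
      ultimately show ?thesis using norm_triangle_ineq4[of "u x" "u y"] by (simp add: dist_norm)
    qed
  qed
qed

lemma grad_matrix_shift:
  fixes u :: "real^'n \<Rightarrow> real^'n"
  assumes diff: "u differentiable at x" and per: "\<And>x. u (x + c) = u x"
  shows "grad_matrix u (x + c) = grad_matrix u x"
proof -
  have "((\<lambda>y. y - c) has_derivative (\<lambda>h. h)) (at (x + c))" by (auto intro!: derivative_eq_intros)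
  moreover have "(u has_derivative frechet_derivative u (at x)) (at ((x + c) - c))"
    using diff frechet_derivative_works by auto
  ultimately have "(u \<circ> (\<lambda>y. y - c) has_derivative frechet_derivative u (at x) \<circ> (\<lambda>h. h)) (at (x + c))"
    by (rule diff_chain_at)
  moreover have "u \<circ> (\<lambda>y. y - c) = u" using per[of "_ - c"] by (auto simp: fun_eq_iff)
  ultimately have "(u has_derivative frechet_derivative u (at x)) (at (x + c))" by (simp add: o_def)
  then have "frechet_derivative u (at (x + c)) = frechet_derivative u (at x)"
    using frechet_derivative_at by metis
  then show ?thesis by (simp add: grad_matrix_def)
qed

lemma lipschitz_on_component:
  assumes "C-lipschitz_on S f" shows "C-lipschitz_on S (\<lambda>x. (f x :: 'a::real_normed_vector^'n) $ i)"
proof (rule lipschitz_onI[OF _ lipschitz_on_nonneg[OF assms]])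
  show "dist (f x $ i) (f y $ i) \<le> C * dist x y" if "x \<in> S" "y \<in> S" for x y
    using dist_vec_nth_le[of "f x" i "f y"] lipschitz_onD[OF assms that] by linarith
qed

text \<open>A Lipschitz gradient is bounded by \<open>lipschitz_field_bounded\<close>, and this
  bound is a Lipschitz constant of the velocity itself.\<close>

lemma velocity_fieldI:
  fixes u :: "real^'n \<Rightarrow> real^'n"
  assumes R: "valid_region R"
    and diff: "\<And>x. x \<in> field_domain R \<Longrightarrow> u differentiable at x"
    and div: "\<And>x. x \<in> field_domain R \<Longrightarrow> divergence u x = 0"
    and lip: "C-lipschitz_on (field_domain R) (grad_matrix u)"
    and cont: "continuous_on (closure (field_domain R)) u"
    and per: "periodic_field R u"
    and wall: "\<And>\<Omega> x. R = No_Slip \<Omega> \<Longrightarrow> x \<in> frontier \<Omega> \<Longrightarrow> u x = 0"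
  shows "velocity_field R u"
proof -
  have perG: "periodic_field R (grad_matrix u)"
    using grad_matrix_shift[OF diff] per by (cases R) auto
  have perj: "periodic_field R (\<lambda>x. u x $ j)" "periodic_field R (\<lambda>x. grad_matrix u x $ i $ j)" for i j
    using per perG by (cases R; simp)+
  have G: "lip_field R (\<lambda>x. grad_matrix u x $ i $ j)" for i j
    by (rule lip_fieldI[OF R lipschitz_on_component[OF lipschitz_on_component[OF lip]] perj(2)])
  obtain B where B: "\<And>x. x \<in> field_domain R \<Longrightarrow> norm (grad_matrix u x) \<le> B" "B \<ge> 0"
    using lipschitz_field_bounded[OF R lip perG] unfolding bounded_pos by (auto intro: less_imp_le)
  have "B-lipschitz_on (field_domain R) u \<and> (\<forall>j. wall_zero R (\<lambda>x. u x $ j - mean_field R u $ j))"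
  proof (cases R)
    case (No_Slip \<Omega>)
    note * = no_slip_velocity_bounds[of \<Omega> u B]
    have b: "norm (u x) \<le> B * infdist x (- \<Omega>)" if "x \<in> \<Omega>" for x
      using *(1) that R cont wall diff B No_Slip by auto
    have "\<bar>u x $ j\<bar> \<le> B * infdist x (- \<Omega>)" if "x \<in> \<Omega>" for x j
      using b[OF that] component_le_norm_cart[of "u x" j] by linarith
    moreover have "B-lipschitz_on \<Omega> u" using *(2) R cont wall diff B No_Slip by auto
    ultimately show ?thesis using No_Slip by auto
  next
    case (Periodic p)
    have "B-lipschitz_on UNIV u"
      using norm_diff_le_segment[of _ _ UNIV u B] diff B Periodic
      by (intro lipschitz_onI) (auto simp: dist_norm)
    then show ?thesis using Periodic by auto
  qed
  then show ?thesis
    unfolding velocity_field_def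
    using G diff div lip_fieldI[OF R lipschitz_on_component perj(1)] by blast
qed

text \<open>The spatial factor of the eddy viscosity. Splitting it from \<open>k t\<close> exposes
  the linearity of the equation for \<open>k\<close> and unites both boundary conditions.\<close>

definition weight :: "'n::finite flow_region \<Rightarrow> real \<Rightarrow> real \<Rightarrow> real^'n \<Rightarrow> real" where
  "weight R \<kappa> L x = (case R of No_Slip \<Omega> \<Rightarrow> (\<kappa> * (infdist x (frontier \<Omega>) / L))\<^sup>2 | Periodic p \<Rightarrow> 1)"

lemma eddy_viscosity_eq: "eddy_viscosity R \<mu> \<kappa> L \<tau> k t x = sqrt 2 * \<mu> * \<tau> * k t * weight R \<kappa> L x"
  by (cases R) (simp_all add: weight_def)

lemma weight_nonneg: "weight R \<kappa> L x \<ge> 0"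
  by (cases R) (simp_all add: weight_def)

lemma lip_field_weight:
  assumes R: "valid_region R"
  shows "lip_field R (weight R \<kappa> L)"
proof (cases R)
  case (No_Slip \<Omega>)
  have "1-lipschitz_on \<Omega> (\<lambda>x. infdist x (frontier \<Omega>))"
    by (rule lipschitz_onI) (auto simp: dist_real_def infdist_triangle_abs)
  then have "lip_field R (\<lambda>x. infdist x (frontier \<Omega>))"
    using No_Slip R by (intro lip_fieldI[OF R, of 1]) auto
  then have "lip_field R (\<lambda>x. (\<kappa> / L * infdist x (frontier \<Omega>)) * (\<kappa> / L * infdist x (frontier \<Omega>)))"
    by (intro lip_field_mult lip_field_cmult)
  moreover have "weight R \<kappa> L = (\<lambda>x. (\<kappa> / L * infdist x (frontier \<Omega>)) * (\<kappa> / L * infdist x (frontier \<Omega>)))"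
    by (simp add: weight_def No_Slip fun_eq_iff power2_eq_square)
  ultimately show ?thesis by simp
next
  case (Periodic p)
  then have "weight R \<kappa> L = (\<lambda>x. 1)" by (simp add: weight_def fun_eq_iff)
  then show ?thesis using lip_field_const[of R 1] by simp
qed

subsection \<open>Integrals depending on time\<close>

text \<open>The mean value inequality bounds the difference quotients by \<open>B\<close>, so
  dominated convergence applies on a finite measure. Measurability of the derivative comes from its
  being a pointwise limit of these quotients.\<close>

lemma DERIV_integral_param:
  fixes \<phi> \<phi>' :: "real \<Rightarrow> 'a \<Rightarrow> real"
  assumes M: "finite_measure M" and t: "a < t" "t < b"
    and int: "\<And>s. s \<in> {a..b} \<Longrightarrow> integrable M (\<phi> s)"
    and der: "\<And>s x. s \<in> {a..b} \<Longrightarrow> x \<in> space M \<Longrightarrow> ((\<lambda>s. \<phi> s x) has_real_derivative \<phi>' s x) (at s)"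
    and bd: "\<And>s x. s \<in> {a..b} \<Longrightarrow> x \<in> space M \<Longrightarrow> \<bar>\<phi>' s x\<bar> \<le> B"
  shows "integrable M (\<phi>' t)" "((\<lambda>s. LINT x|M. \<phi> s x) has_real_derivative (LINT x|M. \<phi>' t x)) (at t)"
proof -
  interpret finite_measure M by (rule M)
  have quot: "(\<lambda>n. (\<phi> (t + h n) x - \<phi> t x) / h n) \<longlonglongrightarrow> \<phi>' t x"
    if x: "x \<in> space M" and h: "h \<longlonglongrightarrow> 0" "\<And>n. h n \<noteq> 0" for x and h :: "nat \<Rightarrow> real"
  proof -
    have "((\<lambda>h. (\<phi> (t + h) x - \<phi> t x) / h) \<longlongrightarrow> \<phi>' t x) (at 0)"
      using der[of t x] x t by (simp add: DERIV_def)
    then show ?thesis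
      by (rule filterlim_compose[of _ _ _ h]) (use h in \<open>auto simp: filterlim_at\<close>)
  qed
  have qi: "integrable M (\<lambda>x. (\<phi> (t + h) x - \<phi> t x) / h)" if "t + h \<in> {a..b}" for h
    using int[OF that] int[of t] t by auto
  have qb: "\<bar>(\<phi> (t + h) x - \<phi> t x) / h\<bar> \<le> B" if "t + h \<in> {a..b}" "h \<noteq> 0" "x \<in> space M" for h x
  proof -
    have "norm (\<phi> (t + h) x - \<phi> t x) \<le> B * norm (t + h - t)"
    proof (rule field_differentiable_bound[where S="{a..b}"])
      show "((\<lambda>s. \<phi> s x) has_real_derivative \<phi>' z x) (at z within {a..b})" if "z \<in> {a..b}" for z
        using der[OF that \<open>x \<in> space M\<close>] by (rule has_field_derivative_at_within)
      show "norm (\<phi>' z x) \<le> B" if "z \<in> {a..b}" for z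
        using bd[OF that \<open>x \<in> space M\<close>] by simp
    qed (use that t in auto)
    then show ?thesis using that(2) by (simp add: abs_divide pos_divide_le_eq)
  qed
  have conv: "integrable M (\<phi>' t) \<and> (\<lambda>n. ((LINT x|M. \<phi> (t + h n) x) - (LINT x|M. \<phi> t x)) / h n) \<longlonglongrightarrow> (LINT x|M. \<phi>' t x)"
    if h: "h \<longlonglongrightarrow> 0" "\<And>n. h n \<noteq> 0" and hab: "\<And>n. t + h n \<in> {a..b}" for h
  proof -
    have meas: "\<phi>' t \<in> borel_measurable M"
      by (rule borel_measurable_LIMSEQ_real[OF quot[OF _ h]]) (use qi[OF hab] in auto)
    have qm: "(\<lambda>x. (\<phi> (t + h n) x - \<phi> t x) / h n) \<in> borel_measurable M" for n using qi[OF hab] by auto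
    have lim: "AE x in M. (\<lambda>n. (\<phi> (t + h n) x - \<phi> t x) / h n) \<longlonglongrightarrow> \<phi>' t x"
      using quot[OF _ h] by (intro AE_I2)
    have bound: "AE x in M. norm ((\<phi> (t + h n) x - \<phi> t x) / h n) \<le> B" for n
      using qb[OF hab h(2)] by (intro AE_I2) simp
    have 1: "integrable M (\<phi>' t)"
      by (rule integrable_dominated_convergence[OF meas qm _ lim bound]) simp
    have "(\<lambda>n. LINT x|M. (\<phi> (t + h n) x - \<phi> t x) / h n) \<longlonglongrightarrow> (LINT x|M. \<phi>' t x)"
      by (rule integral_dominated_convergence[OF meas qm _ lim bound]) simp
    moreover have "(LINT x|M. (\<phi> (t + h n) x - \<phi> t x) / h n) = ((LINT x|M. \<phi> (t + h n) x) - (LINT x|M. \<phi> t x)) / h n" for n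
      using int[OF hab] int[of t] t by simp
    ultimately show ?thesis using 1 by (simp only: simp_thms)
  qed
  \<comment> \<open>A concrete sequence with \<open>t + h n\<close> in \<open>{a..b}\<close> already
    from \<open>n = 0\<close>; it extracts the integrability statement from
    \<open>conv\<close>.\<close>
  define h where "h n = (b - t) * inverse (real (Suc n))" for n
  have "h \<longlonglongrightarrow> (b - t) * 0" unfolding h_def by (intro tendsto_intros LIMSEQ_inverse_real_of_nat)
  moreover have "t + h n \<in> {a..b}" for n
  proof -
    have "h n \<le> (b - t) * 1"
      unfolding h_def using t by (intro mult_left_mono) (auto simp: inverse_le_1_iff)
    moreover have "0 \<le> h n" unfolding h_def using t by simp
    ultimately show ?thesis using t by simp
  qed
  ultimately show "integrable M (\<phi>' t)" using conv[of h] t by (simp add: h_def)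
  show "((\<lambda>s. LINT x|M. \<phi> s x) has_real_derivative (LINT x|M. \<phi>' t x)) (at t)"
    unfolding DERIV_def tendsto_at_iff_sequentially
  proof (intro allI impI)
    fix X :: "nat \<Rightarrow> real" assume X: "\<forall>i. X i \<in> UNIV - {0}" "X \<longlonglongrightarrow> 0"
    have "(\<lambda>n. t + X n) \<longlonglongrightarrow> t + 0" using X by (intro tendsto_intros)
    then have "\<forall>\<^sub>F n in sequentially. t + X n \<in> {a<..<b}" using t by (intro topological_tendstoD) auto
    \<comment> \<open>\<open>conv\<close> requires all terms to stay in \<open>{a..b}\<close>, so an
      initial segment of the sequence is cut off.\<close>
    then obtain N where N: "\<And>n. n \<ge> N \<Longrightarrow> t + X n \<in> {a<..<b}" unfolding eventually_sequentially by blast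
    have "(\<lambda>n. ((LINT x|M. \<phi> (t + X (n + N)) x) - (LINT x|M. \<phi> t x)) / X (n + N)) \<longlonglongrightarrow> (LINT x|M. \<phi>' t x)"
    proof (rule conv[THEN conjunct2])
      show "(\<lambda>n. X (n + N)) \<longlonglongrightarrow> 0" using X(2) by (rule LIMSEQ_ignore_initial_segment)
      show "X (n + N) \<noteq> 0" for n using X(1) by auto
      show "t + X (n + N) \<in> {a..b}" for n using N[of "n + N"] by auto
    qed
    then have "(\<lambda>n. ((LINT x|M. \<phi> (t + X n) x) - (LINT x|M. \<phi> t x)) / X n) \<longlonglongrightarrow> (LINT x|M. \<phi>' t x)"
      by (rule LIMSEQ_offset)
    then show "((\<lambda>h. ((LINT x|M. \<phi> (t + h) x) - (LINT x|M. \<phi> t x)) / h) \<circ> X) \<longlonglongrightarrow> (LINT x|M. \<phi>' t x)"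
      by (simp add: o_def)
  qed
qed

text \<open>A convergent sequence of times stays in some \<open>{0..T}\<close>, and the integrand is
  bounded on the compact product of this interval with the closure of the domain.\<close>

lemma continuous_on_integral_param:
  fixes \<phi> :: "real \<Rightarrow> 'a::euclidean_space \<Rightarrow> 'b::euclidean_space"
  assumes A: "open A" "bounded A" and cont: "continuous_on ({0..} \<times> closure A) (\<lambda>(s, x). \<phi> s x)"
  shows "continuous_on {0..} (\<lambda>s. LINT x|lebesgue_on A. \<phi> s x)"
  unfolding continuous_on_sequentially
proof (intro allI ballI impI, elim conjE)
  fix X :: "nat \<Rightarrow> real" and t assume t: "t \<in> {0..}" and X: "\<forall>n. X n \<in> {0..}" "X \<longlonglongrightarrow> t"
  let ?M = "lebesgue_on A"
  have Am: "A \<in> lmeasurable" using A by (intro bounded_set_imp_lmeasurable) auto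
  interpret finite_measure ?M using Am by (rule finite_measure_lebesgue_on)
  obtain T where T: "\<And>n. \<bar>X n\<bar> \<le> T" using convergent_imp_Bseq[of X] X(2) by (auto simp: Bseq_def convergent_def)
  have "compact ({0..T} \<times> closure A)" using A by (intro compact_Times) (auto simp: compact_closure)
  then have "bounded ((\<lambda>(s, x). \<phi> s x) ` ({0..T} \<times> closure A))"
    by (intro compact_imp_bounded compact_continuous_image continuous_on_subset[OF cont]) auto
  then obtain B where B: "\<And>s x. s \<in> {0..T} \<Longrightarrow> x \<in> closure A \<Longrightarrow> norm (\<phi> s x) \<le> B"
    unfolding bounded_iff by (fastforce simp: case_prod_beta)
  have cx: "continuous_on A (\<phi> s)" if "s \<ge> 0" for s
  proof -
    have "continuous_on A (\<lambda>x. (s, x))" by (intro continuous_intros)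
    then show ?thesis
      using continuous_on_compose2[OF cont, of A "\<lambda>x. (s, x)"] that closure_subset[of A] by auto
  qed
  have meas: "\<phi> s \<in> borel_measurable ?M" if "s \<ge> 0" for s
    using cx[OF that] Am by (intro continuous_imp_measurable_on_sets_lebesgue) auto
  have "(\<lambda>n. LINT x|?M. \<phi> (X n) x) \<longlonglongrightarrow> (LINT x|?M. \<phi> t x)"
  proof (rule integral_dominated_convergence)
    show "integrable ?M (\<lambda>_. B)" by simp
    show "\<phi> t \<in> borel_measurable ?M" using t by (intro meas) auto
    show "\<phi> (X n) \<in> borel_measurable ?M" for n using X by (intro meas) auto
    show "AE x in ?M. norm (\<phi> (X n) x) \<le> B" for n
    proof (rule AE_I2)
      fix x assume "x \<in> space ?M"
      then have "x \<in> closure A" using closure_subset[of A] by (auto simp: space_restrict_space)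
      moreover have "X n \<in> {0..T}" using X(1) T[of n] by auto
      ultimately show "norm (\<phi> (X n) x) \<le> B" by (rule B[rotated])
    qed
    show "AE x in ?M. (\<lambda>n. \<phi> (X n) x) \<longlonglongrightarrow> \<phi> t x"
    proof (rule AE_I2)
      fix x assume "x \<in> space ?M"
      then have x: "x \<in> closure A" using closure_subset[of A] by (auto simp: space_restrict_space)
      have "continuous_on {0..} (\<lambda>s. \<phi> s x)"
      proof -
        have "continuous_on {0..} (\<lambda>s::real. (s, x))" by (intro continuous_intros)
        then show ?thesis
          using continuous_on_compose2[OF cont, of "{0..}" "\<lambda>s. (s, x)"] x by auto
      qed
      then show "(\<lambda>n. \<phi> (X n) x) \<longlonglongrightarrow> \<phi> t x"
        using t X unfolding continuous_on_sequentially by (auto simp: o_def)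
    qed
  qed
  then show "((\<lambda>s. LINT x|?M. \<phi> s x) \<circ> X) \<longlonglongrightarrow> (LINT x|?M. \<phi> t x)" by (simp add: o_def)
qed

subsection \<open>The energy inequality\<close>

definition fluctuation_energy :: "'n::finite flow_region \<Rightarrow> (real^'n \<Rightarrow> real^'n) \<Rightarrow> real" where
  "fluctuation_energy R u = (LINT x|lebesgue_on (flow_domain R). (norm (u x - mean_field R u))\<^sup>2) / 2"

lemma fluctuation_energy_nonneg: "fluctuation_energy R u \<ge> 0"
  unfolding fluctuation_energy_def by simp

lemma regular_fields_continuous:
  assumes "regular_fields R ts v q" "valid_region R"
  shows "continuous_on ({0..} \<times> closure (flow_domain R)) (\<lambda>(t, x). v t x)"
  using assms continuous_on_subset[of _ _ "{0..} \<times> closure (flow_domain R)"] closure_mono[OF flow_domain_subset]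
  unfolding regular_fields_def by (metis Sigma_mono order_refl)

lemma regular_fields_continuous_at:
  assumes "regular_fields R ts v q" "valid_region R" "t \<ge> 0"
  shows "continuous_on (closure (flow_domain R)) (v t)"
proof -
  have "continuous_on (closure (flow_domain R)) (\<lambda>x. (t, x))" by (intro continuous_intros)
  then show ?thesis
    using continuous_on_compose2[OF regular_fields_continuous[OF assms(1,2)], of _ "\<lambda>x. (t, x)"] assms(3)
    by auto
qed

lemma regular_fields_integrable:
  assumes "regular_fields R ts v q" "valid_region R" "t \<ge> 0"
  shows "integrable (lebesgue_on (flow_domain R)) (v t)"
    "integrable (lebesgue_on (flow_domain R)) (\<lambda>x. (norm (v t x))\<^sup>2)"
proof -
  note c = regular_fields_continuous_at[OF assms]
  have "bounded (v t ` closure (flow_domain R))"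
    using c flow_domain_bounded[OF assms(2)] by (intro compact_imp_bounded compact_continuous_image) (auto simp: compact_closure)
  then obtain B where B: "\<And>x. x \<in> flow_domain R \<Longrightarrow> norm (v t x) \<le> B"
    using closure_subset[of "flow_domain R"] unfolding bounded_iff by blast
  have c': "continuous_on (flow_domain R) (v t)" using c closure_subset continuous_on_subset by blast
  show "integrable (lebesgue_on (flow_domain R)) (v t)"
    by (rule integrable_bounded_continuous[OF flow_domain_lmeasurable[OF assms(2)] c' B])
  show "integrable (lebesgue_on (flow_domain R)) (\<lambda>x. (norm (v t x))\<^sup>2)"
  proof (rule integrable_bounded_continuous[OF flow_domain_lmeasurable[OF assms(2)]])
    show "continuous_on (flow_domain R) (\<lambda>x. (norm (v t x))\<^sup>2)" by (intro continuous_intros c')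
    show "norm ((norm (v t x))\<^sup>2) \<le> B\<^sup>2" if "x \<in> flow_domain R" for x
      using power_mono[OF B[OF that], of 2] by simp
  qed
qed

text \<open>The variance formula takes the moving mean out of the integral, leaving two terms that
  depend on time separately.\<close>

lemma fluctuation_energy_continuous:
  assumes reg: "regular_fields R ts v q" and R: "valid_region R"
  shows "continuous_on {0..} (\<lambda>t. fluctuation_energy R (v t))"
proof -
  have cont: "continuous_on ({0..} \<times> closure (flow_domain R)) (\<lambda>(t, x). v t x)"
    by (rule regular_fields_continuous[OF reg R])
  then have c2: "continuous_on ({0..} \<times> closure (flow_domain R)) (\<lambda>(t, x). (norm (v t x))\<^sup>2)"
    unfolding case_prod_beta by (intro continuous_intros)
  have cm: "continuous_on {0..} (\<lambda>t. mean_field R (v t))"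
  proof (cases R)
    case (Periodic p)
    then show ?thesis
      using continuous_on_integral_param[OF flow_domain_open[OF R] flow_domain_bounded[OF R] cont]
      by (auto intro!: continuous_intros)
  qed auto
  have "continuous_on {0..} (\<lambda>t. ((LINT x|lebesgue_on (flow_domain R). (norm (v t x))\<^sup>2)
      - measure lebesgue (flow_domain R) * (norm (mean_field R (v t)))\<^sup>2) / 2)"
    by (intro continuous_intros cm
        continuous_on_integral_param[OF flow_domain_open[OF R] flow_domain_bounded[OF R] c2]) auto
  then show ?thesis
    by (rule continuous_on_eq)
      (simp add: fluctuation_energy_def integral_norm_diff_mean_field[OF R regular_fields_integrable[OF reg R]])
qed

lemma fluctuation_energy_le:
  assumes reg: "regular_fields R ts v q" and R: "valid_region R" and t: "t \<ge> 0"
  shows "fluctuation_energy R (v t) \<le> (LINT x|lebesgue_on (flow_domain R). (norm (v t x))\<^sup>2) / 2"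
  using flow_domain_measure_pos[OF R]
  by (simp add: fluctuation_energy_def integral_norm_diff_mean_field[OF R regular_fields_integrable[OF reg R t]])

text \<open>The derivative of the mean leaves no term of its own, since a periodic fluctuation has
  integral zero and at a wall the subtracted field is zero. The variance formula is differentiated
  instead of the square of the fluctuation.\<close>

lemma fluctuation_energy_derivative:
  fixes R :: "'n::finite flow_region"
  assumes reg: "regular_fields R ts v q" and R: "valid_region R" and t: "t \<in> model_times ts"
  defines "vt \<equiv> \<lambda>x. vector_derivative (\<lambda>s. v s x) (at t)"
  shows "vt \<in> borel_measurable (lebesgue_on (flow_domain R))"
    "integrable (lebesgue_on (flow_domain R)) (\<lambda>x. (v t x - mean_field R (v t)) \<bullet> vt x)"
    "((\<lambda>s. fluctuation_energy R (v s)) has_real_derivative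
       (LINT x|lebesgue_on (flow_domain R). (v t x - mean_field R (v t)) \<bullet> vt x)) (at t)"
proof -
  let ?M = "lebesgue_on (flow_domain R)"
  let ?m = "measure lebesgue (flow_domain R)"
  have fin: "finite_measure ?M" using flow_domain_lmeasurable[OF R] by (rule finite_measure_lebesgue_on)
  have sp: "space ?M = flow_domain R" by (simp add: space_restrict_space)
  \<comment> \<open>Openness leaves room for a compact interval of times around \<open>t\<close>, on
    which the time derivative is bounded uniformly in space.\<close>
  have "open (model_times ts)" unfolding model_times_def by (intro open_Diff) auto
  then obtain e where e: "e > 0" "cball t e \<subseteq> model_times ts" using t open_contains_cball by blast
  define a b where "a = t - e" and "b = t + e"
  have ab: "a < t" "t < b" using e by (auto simp: a_def b_def)
  have abm: "{a..b} \<subseteq> model_times ts" using e(2) by (simp add: a_def b_def cball_eq_atLeastAtMost)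
  have pos: "s > 0" if "s \<in> {a..b}" for s using abm that by (auto simp: model_times_def)
  define V where "V s x = vector_derivative (\<lambda>s. v s x) (at s)" for s x
  have der: "((\<lambda>s. v s x) has_vector_derivative V s x) (at s)" if "s \<in> {a..b}" "x \<in> flow_domain R" for s x
  proof -
    have "(\<lambda>s. v s x) differentiable at s"
      using reg abm that flow_domain_subset[of R] unfolding regular_fields_def by blast
    then show ?thesis unfolding V_def by (simp add: vector_derivative_works)
  qed
  have derj: "((\<lambda>s. v s x $ j) has_real_derivative V s x $ j) (at s)" if "s \<in> {a..b}" "x \<in> flow_domain R" for s x j
    using bounded_linear.has_vector_derivative[OF bounded_linear_vec_nth der[OF that]]
    by (simp add: has_real_derivative_iff_has_vector_derivative)
  have "bounded ((\<lambda>(t, x). vector_derivative (\<lambda>s. v s x) (at t)) ` ({a..b} \<times> flow_domain R))"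
    using reg abm unfolding regular_fields_def by blast
  then obtain B where B: "\<And>s x. s \<in> {a..b} \<Longrightarrow> x \<in> flow_domain R \<Longrightarrow> norm (V s x) \<le> B"
    unfolding bounded_iff V_def by fastforce
  have "compact ({a..b} \<times> closure (flow_domain R))"
    using flow_domain_bounded[OF R] by (intro compact_Times) (auto simp: compact_closure)
  moreover have "{a..b} \<times> closure (flow_domain R) \<subseteq> {0..} \<times> closure (flow_domain R)" using pos by fastforce
  ultimately have "bounded ((\<lambda>(s, x). v s x) ` ({a..b} \<times> closure (flow_domain R)))"
    using continuous_on_subset[OF regular_fields_continuous[OF reg R]]
    by (intro compact_imp_bounded compact_continuous_image) auto
  then obtain B' where B': "\<And>s x. s \<in> {a..b} \<Longrightarrow> x \<in> flow_domain R \<Longrightarrow> norm (v s x) \<le> B'"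
    using closure_subset[of "flow_domain R"] unfolding bounded_iff by fastforce
  have vV: "vt = V t" by (simp add: vt_def V_def fun_eq_iff)
  have ivj: "integrable ?M (\<lambda>x. v s x $ j)" if "s \<in> {a..b}" for s j
    using integrable_bounded_linear[OF bounded_linear_vec_nth regular_fields_integrable(1)[OF reg R]] pos[OF that] by simp
  have I: "integrable ?M (\<lambda>x. V t x $ j)"
    "((\<lambda>s. LINT x|?M. v s x $ j) has_real_derivative (LINT x|?M. V t x $ j)) (at t)" for j
  proof -
    have bd: "\<bar>V s x $ j\<bar> \<le> B" if "s \<in> {a..b}" "x \<in> space ?M" for s x
      using B[of s x] component_le_norm_cart[of "V s x" j] that sp by simp
    have d: "((\<lambda>s. v s x $ j) has_real_derivative V s x $ j) (at s)" if "s \<in> {a..b}" "x \<in> space ?M" for s x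
      using derj that sp by simp
    show "integrable ?M (\<lambda>x. V t x $ j)"
      by (rule DERIV_integral_param(1)[OF fin ab ivj d bd])
    show "((\<lambda>s. LINT x|?M. v s x $ j) has_real_derivative (LINT x|?M. V t x $ j)) (at t)"
      by (rule DERIV_integral_param(2)[OF fin ab ivj d bd])
  qed
  have J: "integrable ?M (\<lambda>x. 2 * (v t x \<bullet> V t x))"
    "((\<lambda>s. LINT x|?M. (norm (v s x))\<^sup>2) has_real_derivative (LINT x|?M. 2 * (v t x \<bullet> V t x))) (at t)"
  proof -
    have d: "((\<lambda>s. (norm (v s x))\<^sup>2) has_real_derivative 2 * (v s x \<bullet> V s x)) (at s)"
      if "s \<in> {a..b}" "x \<in> space ?M" for s x
    proof -
      have "((\<lambda>s. \<Sum>j\<in>UNIV. (v s x $ j)\<^sup>2) has_real_derivative (\<Sum>j\<in>UNIV. 2 * (v s x $ j) * V s x $ j)) (at s)"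
        using derj that sp by (auto intro!: derivative_eq_intros simp: mult_ac)
      then show ?thesis
        unfolding norm_vec_power2 by (simp add: inner_vec_def sum_distrib_left mult.assoc)
    qed
    have bd: "\<bar>2 * (v s x \<bullet> V s x)\<bar> \<le> 2 * (B' * B)" if "s \<in> {a..b}" "x \<in> space ?M" for s x
    proof -
      have "\<bar>v s x \<bullet> V s x\<bar> \<le> norm (v s x) * norm (V s x)" by (rule Cauchy_Schwarz_ineq2)
      also have "\<dots> \<le> B' * B" using B[of s x] B'[of s x] that sp by (intro mult_mono) (auto intro: order_trans[OF norm_ge_zero])
      finally show ?thesis by simp
    qed
    have i: "integrable ?M (\<lambda>x. (norm (v s x))\<^sup>2)" if "s \<in> {a..b}" for s
      using regular_fields_integrable(2)[OF reg R] pos[OF that] by simp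
    show "integrable ?M (\<lambda>x. 2 * (v t x \<bullet> V t x))"
      by (rule DERIV_integral_param(1)[OF fin ab i d bd])
    show "((\<lambda>s. LINT x|?M. (norm (v s x))\<^sup>2) has_real_derivative (LINT x|?M. 2 * (v t x \<bullet> V t x))) (at t)"
      by (rule DERIV_integral_param(2)[OF fin ab i d bd])
  qed
  show "vt \<in> borel_measurable ?M" unfolding vV by (rule borel_measurable_vec_nthI) (use I(1) in auto)
  have iv: "integrable ?M (\<lambda>x. v t x \<bullet> V t x)" using J(1) by simp
  have ic: "integrable ?M (\<lambda>x. c \<bullet> V t x)" for c
    unfolding inner_vec_def using I(1) by auto
  have icI: "(LINT x|?M. c \<bullet> V t x) = (\<Sum>j\<in>UNIV. c $ j * (LINT x|?M. V t x $ j))" for c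
    unfolding inner_vec_def using I(1) by simp
  have mean: "((\<lambda>s. ?m * (norm (mean_field R (v s)))\<^sup>2) has_real_derivative 2 * (LINT x|?M. mean_field R (v t) \<bullet> V t x)) (at t)"
  proof (cases R)
    case (Periodic p)
    have m: "?m > 0" by (rule flow_domain_measure_pos[OF R])
    have mj: "mean_field R (v s) $ j = (LINT x|?M. v s x $ j) / ?m" if "s \<in> {a..b}" for s j
    proof -
      have "(LINT x|?M. v s x) $ j = (LINT x|?M. v s x $ j)"
        using integral_bounded_linear[OF bounded_linear_vec_nth regular_fields_integrable(1)[OF reg R]] pos[OF that] by simp
      then show ?thesis using Periodic by simp
    qed
    have "((\<lambda>s. ?m * (\<Sum>j\<in>UNIV. ((LINT x|?M. v s x $ j) / ?m)\<^sup>2)) has_real_derivative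
       ?m * (\<Sum>j\<in>UNIV. 2 * ((LINT x|?M. v t x $ j) / ?m) * ((LINT x|?M. V t x $ j) / ?m))) (at t)"
    proof (intro DERIV_cmult DERIV_sum)
      fix j
      show "((\<lambda>s. ((LINT x|?M. v s x $ j) / ?m)\<^sup>2) has_real_derivative
          2 * ((LINT x|?M. v t x $ j) / ?m) * ((LINT x|?M. V t x $ j) / ?m)) (at t)"
        using DERIV_power[OF DERIV_cdivide[OF I(2)[of j], of ?m], of 2] by (simp add: mult_ac)
    qed
    moreover have "?m * (\<Sum>j\<in>UNIV. 2 * ((LINT x|?M. v t x $ j) / ?m) * ((LINT x|?M. V t x $ j) / ?m))
       = 2 * (LINT x|?M. mean_field R (v t) \<bullet> V t x)"
      unfolding icI sum_distrib_left using m mj[of t] ab by (intro sum.cong refl) simp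
    ultimately have *: "((\<lambda>s. ?m * (\<Sum>j\<in>UNIV. ((LINT x|?M. v s x $ j) / ?m)\<^sup>2)) has_real_derivative
       2 * (LINT x|?M. mean_field R (v t) \<bullet> V t x)) (at t)" by simp
    show ?thesis
    proof (rule has_field_derivative_transform_within_open[OF *])
      show "open {a<..<b}" "t \<in> {a<..<b}" using ab by auto
      show "?m * (\<Sum>j\<in>UNIV. ((LINT x|?M. v s x $ j) / ?m)\<^sup>2) = ?m * (norm (mean_field R (v s)))\<^sup>2"
        if "s \<in> {a<..<b}" for s
        using mj[of s] that by (simp add: norm_vec_power2)
    qed
  qed auto
  have inn: "(\<lambda>x. (v t x - mean_field R (v t)) \<bullet> V t x) = (\<lambda>x. v t x \<bullet> V t x - mean_field R (v t) \<bullet> V t x)"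
    by (simp add: inner_diff_left)
  show "integrable ?M (\<lambda>x. (v t x - mean_field R (v t)) \<bullet> vt x)"
    unfolding vV inn using iv ic by simp
  have *: "((\<lambda>s. ((LINT x|?M. (norm (v s x))\<^sup>2) - ?m * (norm (mean_field R (v s)))\<^sup>2) / 2) has_real_derivative
     ((LINT x|?M. 2 * (v t x \<bullet> V t x)) - 2 * (LINT x|?M. mean_field R (v t) \<bullet> V t x)) / 2) (at t)"
    by (intro DERIV_cdivide DERIV_diff J(2) mean)
  have eq: "((LINT x|?M. 2 * (v t x \<bullet> V t x)) - 2 * (LINT x|?M. mean_field R (v t) \<bullet> V t x)) / 2
     = (LINT x|?M. (v t x - mean_field R (v t)) \<bullet> vt x)"
    unfolding vV inn using iv ic by simp
  show "((\<lambda>s. fluctuation_energy R (v s)) has_real_derivative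
       (LINT x|?M. (v t x - mean_field R (v t)) \<bullet> vt x)) (at t)"
  proof (rule has_field_derivative_transform_within_open[OF *[unfolded eq]])
    show "open {a<..<b}" "t \<in> {a<..<b}" using ab by auto
    show "((LINT x|?M. (norm (v s x))\<^sup>2) - ?m * (norm (mean_field R (v s)))\<^sup>2) / 2 = fluctuation_energy R (v s)"
      if "s \<in> {a<..<b}" for s
      using pos[of s] that
      by (simp add: fluctuation_energy_def integral_norm_diff_mean_field[OF R regular_fields_integrable[OF reg R]])
  qed
qed

lemma solution_velocity_field:
  assumes sol: "half_equation_solution R \<nu> \<mu> \<kappa> L f v0 ts ks \<tau> v q k"
    and R: "valid_region R" and t: "t \<in> model_times ts"
  shows "velocity_field R (v t)" "lip_field R (q t)"
proof -
  have t0: "t > 0" using t by (simp add: model_times_def)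
  have reg: "regular_fields R ts v q" and bc: "boundary_conditions R v q"
    and div: "\<And>x. x \<in> field_domain R \<Longrightarrow> divergence (v t) x = 0"
    using sol t unfolding half_equation_solution_def by blast+
  obtain C where C: "C-lipschitz_on (field_domain R) (grad_matrix (v t))"
    using reg t unfolding regular_fields_def by blast
  obtain C' where C': "C'-lipschitz_on (field_domain R) (q t)"
    using reg t unfolding regular_fields_def by blast
  have diff: "v t differentiable at x" if "x \<in> field_domain R" for x
    using reg t that unfolding regular_fields_def by blast
  have "continuous_on ({0..} \<times> closure (field_domain R)) (\<lambda>(t, x). v t x)"
    using reg unfolding regular_fields_def by blast
  moreover have "continuous_on (closure (field_domain R)) (\<lambda>x. (t, x))" by (intro continuous_intros)
  moreover have "(\<lambda>x. (t, x)) ` closure (field_domain R) \<subseteq> {0..} \<times> closure (field_domain R)" using t0 by auto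
  ultimately have cont: "continuous_on (closure (field_domain R)) (v t)"
    using continuous_on_compose2[of "{0..} \<times> closure (field_domain R)" "\<lambda>(t, x). v t x" "closure (field_domain R)" "\<lambda>x. (t, x)"] by simp
  have per: "periodic_field R (v t)" "periodic_field R (q t)"
    using bc t0 by (cases R; simp)+
  have wall: "v t x = 0" if "R = No_Slip \<Omega>" "x \<in> frontier \<Omega>" for \<Omega> x
    using bc t0 that by simp
  show "velocity_field R (v t)" by (rule velocity_fieldI[OF R diff div C cont per(1) wall])
  show "lip_field R (q t)" by (rule lip_fieldI[OF R C' per(2)])
qed

lemma eddy_viscosity_lip_field:
  assumes "valid_region R"
  shows "lip_field R (\<lambda>x. 2 * \<nu> + eddy_viscosity R \<mu> \<kappa> L \<tau> k t x)"
  unfolding eddy_viscosity_eq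
  by (intro lip_field_add lip_field_const lip_field_cmult lip_field_weight assms)

text \<open>The total viscosity is at least \<nu>. Young's inequality splits the work of the force
  so that, after Poincare, half of this dissipation is spent and \<open>\<nu> / 2\<close> of it is
  left over.\<close>

lemma energy_inequality:
  fixes R :: "'n::finite flow_region"
  assumes sol: "half_equation_solution R \<nu> \<mu> \<kappa> L f v0 ts ks \<tau> v q k"
    and R: "valid_region R" and t: "t \<in> model_times ts" and \<nu>: "\<nu> > 0" and C: "C > 0"
    and poincare: "(LINT x|lebesgue_on (flow_domain R). (norm (v t x - mean_field R (v t)))\<^sup>2)
        \<le> C * (LINT x|lebesgue_on (flow_domain R). (norm (sym_grad (v t) x))\<^sup>2)"
    and f: "f t \<in> borel_measurable (lebesgue_on (flow_domain R))"
      "integrable (lebesgue_on (flow_domain R)) (\<lambda>x. (norm (f t x))\<^sup>2)"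
      "(LINT x|lebesgue_on (flow_domain R). (norm (f t x))\<^sup>2) \<le> M"
    and eddy: "\<And>x. x \<in> flow_domain R \<Longrightarrow> eddy_viscosity R \<mu> \<kappa> L \<tau> k t x \<ge> - \<nu>"
  obtains D where "((\<lambda>s. fluctuation_energy R (v s)) has_real_derivative D) (at t)"
    "D + \<nu> / 2 * (LINT x|lebesgue_on (flow_domain R). (norm (sym_grad (v t) x))\<^sup>2) \<le> C * M / (2 * \<nu>)"
proof
  let ?M = "lebesgue_on (flow_domain R)"
  define u where "u = v t"
  define c where "c = mean_field R u"
  define N where "N x = 2 * \<nu> + eddy_viscosity R \<mu> \<kappa> L \<tau> k t x" for x
  define vt where "vt x = vector_derivative (\<lambda>s. v s x) (at t)" for x
  have reg: "regular_fields R ts v q" using sol unfolding half_equation_solution_def by blast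
  note der = fluctuation_energy_derivative[OF reg R t, folded vt_def u_def, folded c_def]
  show "((\<lambda>s. fluctuation_energy R (v s)) has_real_derivative (LINT x|?M. (u x - c) \<bullet> vt x)) (at t)"
    using der(3) .
  have vf: "velocity_field R u" using solution_velocity_field(1)[OF sol R t] by (simp add: u_def)
  have q: "lip_field R (q t)" by (rule solution_velocity_field(2)[OF sol R t])
  have N: "lip_field R N" unfolding N_def by (rule eddy_viscosity_lip_field[OF R])
  have uj: "\<And>j. lip_field R (\<lambda>x. u x $ j)" and G: "\<And>i j. lip_field R (\<lambda>x. grad_matrix u x $ i $ j)"
    and wall: "\<And>j. wall_zero R (\<lambda>x. u x $ j - c $ j)"
    and diff: "\<And>x. x \<in> field_domain R \<Longrightarrow> u differentiable at x"
    and div: "\<And>x. x \<in> field_domain R \<Longrightarrow> divergence u x = 0"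
    using vf unfolding velocity_field_def c_def by auto
  have [measurable]: "vt \<in> borel_measurable ?M" "f t \<in> borel_measurable ?M" using der(1) f(1) by auto
  have meas: "(\<lambda>x. vt x - f t x) \<in> borel_measurable ?M" by measurable
  have "AE x in ?M.
      (\<lambda>z. N z *\<^sub>R sym_grad u z) differentiable at x \<and> q t differentiable at x \<and>
      vt x + grad_matrix u x *v u x - tensor_divergence (\<lambda>z. N z *\<^sub>R sym_grad u z) x + scalar_grad (q t) x = f t x"
    using sol t unfolding half_equation_solution_def momentum_equation_def u_def N_def vt_def by force
  then have AE: "AE x in ?M.
      (\<lambda>z. N z *\<^sub>R sym_grad u z) differentiable at x \<and> q t differentiable at x \<and>
      (vt x - f t x) + grad_matrix u x *v u x - tensor_divergence (\<lambda>z. N z *\<^sub>R sym_grad u z) x + scalar_grad (q t) x = 0"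
    by eventually_elim (auto simp: algebra_simps)
  note bal = momentum_balance[OF R uj G N q wall diff div meas AE]
  have [measurable]: "u \<in> borel_measurable ?M"
    by (rule borel_measurable_vec_nthI) (rule lip_field_measurable[OF R uj])
  have iw: "integrable ?M (\<lambda>x. (norm (u x - c))\<^sup>2)"
  proof -
    have "t \<ge> 0" using t by (simp add: model_times_def)
    then show ?thesis
      unfolding u_def using flow_domain_lmeasurable[OF R] regular_fields_integrable[OF reg R]
      by (intro integral_norm_diff_const(1)) auto
  qed
  have lNS: "lip_field R (\<lambda>x. N x * (norm (sym_grad u x))\<^sup>2)"
    by (intro lip_field_mult N lip_field_norm_sym_grad G)
  have iNS: "integrable ?M (\<lambda>x. N x * (norm (sym_grad u x))\<^sup>2)" by (rule lip_field_integrable[OF R lNS])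
  have iS: "integrable ?M (\<lambda>x. (norm (sym_grad u x))\<^sup>2)"
    by (rule lip_field_integrable[OF R lip_field_norm_sym_grad[OF G]])
  \<comment> \<open>The weight \<open>\<nu> / (2 * C)\<close> is chosen so that the Poincare
    constant \<open>C\<close> cancels and leaves \<open>\<nu> / 2\<close>.\<close>
  have young: "(u x - c) \<bullet> f t x \<le> \<nu> / (2 * C) * (norm (u x - c))\<^sup>2 + C / (2 * \<nu>) * (norm (f t x))\<^sup>2" for x
  proof -
    define A B where "A = norm (u x - c)" and "B = norm (f t x)"
    have "0 \<le> (\<nu> * A - C * B)\<^sup>2 / (2 * C * \<nu>)" using C \<nu> by simp
    also have "\<dots> = \<nu> / (2 * C) * A\<^sup>2 + C / (2 * \<nu>) * B\<^sup>2 - A * B"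
      using C \<nu> by (simp add: power2_eq_square field_simps)
    finally have "A * B \<le> \<nu> / (2 * C) * A\<^sup>2 + C / (2 * \<nu>) * B\<^sup>2" by simp
    moreover have "(u x - c) \<bullet> f t x \<le> A * B" unfolding A_def B_def by (rule norm_cauchy_schwarz)
    ultimately show ?thesis unfolding A_def B_def by linarith
  qed
  \<comment> \<open>Read off from the balance: the work of the force is a difference of expressions
    already known to be integrable.\<close>
  have wf: "integrable ?M (\<lambda>x. (u x - c) \<bullet> f t x)"
  proof -
    have "(\<lambda>x. (u x - c) \<bullet> f t x) = (\<lambda>x. (u x - c) \<bullet> vt x + N x * (norm (sym_grad u x))\<^sup>2
       - ((u x - c) \<bullet> (vt x - f t x) + N x * (norm (sym_grad u x))\<^sup>2))"
      by (simp add: inner_diff_right)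
    then show ?thesis
      by (subst \<open>(\<lambda>x. (u x - c) \<bullet> f t x) = _\<close>)
        (rule Bochner_Integration.integrable_diff[OF Bochner_Integration.integrable_add[OF der(2) iNS] bal(1)])
  qed
  have "(LINT x|?M. (u x - c) \<bullet> vt x) = (LINT x|?M. (u x - c) \<bullet> f t x) - (LINT x|?M. N x * (norm (sym_grad u x))\<^sup>2)"
  proof -
    have "(LINT x|?M. (u x - c) \<bullet> vt x - (u x - c) \<bullet> f t x + N x * (norm (sym_grad u x))\<^sup>2) = 0"
      using bal(2) by (simp add: inner_diff_right)
    then show ?thesis using der(2) wf iNS by simp
  qed
  moreover have "(LINT x|?M. (u x - c) \<bullet> f t x)
      \<le> \<nu> / (2 * C) * (LINT x|?M. (norm (u x - c))\<^sup>2) + C / (2 * \<nu>) * (LINT x|?M. (norm (f t x))\<^sup>2)"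
  proof -
    have "(LINT x|?M. (u x - c) \<bullet> f t x) \<le> (LINT x|?M. \<nu> / (2 * C) * (norm (u x - c))\<^sup>2 + C / (2 * \<nu>) * (norm (f t x))\<^sup>2)"
      using wf iw f(2) young by (intro integral_mono) auto
    then show ?thesis using iw f(2) by simp
  qed
  moreover have "\<nu> / (2 * C) * (LINT x|?M. (norm (u x - c))\<^sup>2) \<le> \<nu> / 2 * (LINT x|?M. (norm (sym_grad u x))\<^sup>2)"
  proof -
    have "\<nu> / (2 * C) * (LINT x|?M. (norm (u x - c))\<^sup>2) \<le> \<nu> / (2 * C) * (C * (LINT x|?M. (norm (sym_grad u x))\<^sup>2))"
      using poincare C \<nu> unfolding u_def c_def by (intro mult_left_mono) auto
    then show ?thesis using C by simp
  qed
  moreover have "C / (2 * \<nu>) * (LINT x|?M. (norm (f t x))\<^sup>2) \<le> C * M / (2 * \<nu>)"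
    using mult_left_mono[OF f(3), of "C / (2 * \<nu>)"] C \<nu> by simp
  moreover have "\<nu> * (LINT x|?M. (norm (sym_grad u x))\<^sup>2) \<le> (LINT x|?M. N x * (norm (sym_grad u x))\<^sup>2)"
  proof -
    have "(LINT x|?M. \<nu> * (norm (sym_grad u x))\<^sup>2) \<le> (LINT x|?M. N x * (norm (sym_grad u x))\<^sup>2)"
    proof (rule integral_mono)
      fix x assume "x \<in> space ?M"
      then have "x \<in> flow_domain R" by (simp add: space_restrict_space)
      then have "\<nu> \<le> N x" unfolding N_def using eddy[of x] by linarith
      then show "\<nu> * (norm (sym_grad u x))\<^sup>2 \<le> N x * (norm (sym_grad u x))\<^sup>2" by (rule mult_right_mono) simp
    qed (use iS iNS in auto)
    then show ?thesis by simp
  qed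
  ultimately show "(LINT x|?M. (u x - c) \<bullet> vt x) + \<nu> / 2 * (LINT x|?M. (norm (sym_grad (v t) x))\<^sup>2) \<le> C * M / (2 * \<nu>)"
    unfolding u_def[symmetric] by linarith
qed

subsection \<open>The equation for \<open>k\<close>\<close>

lemma solution_k_derivative:
  fixes R :: "'n::finite flow_region"
  assumes sol: "half_equation_solution R \<nu> \<mu> \<kappa> L f v0 ts ks \<tau> v q k" and t: "t > ts"
  shows "(k has_real_derivative
    (sqrt 2 * \<mu> * \<tau> * ((LINT x|lebesgue_on (flow_domain R). weight R \<kappa> L x * (norm (sym_grad (v t) x))\<^sup>2) / measure lebesgue (flow_domain R))
       - sqrt 2 / 2 * inverse \<tau>) * k t) (at t)"
proof -
  have "k differentiable at t" and eq: "deriv k t + sqrt 2 / 2 * inverse \<tau> * k t =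
          dissipation_rate R (eddy_viscosity R \<mu> \<kappa> L \<tau> k t) (v t)"
    using sol t unfolding half_equation_solution_def by blast+
  then have "(k has_real_derivative deriv k t) (at t)"
    by (simp add: DERIV_deriv_iff_real_differentiable)
  moreover have "dissipation_rate R (eddy_viscosity R \<mu> \<kappa> L \<tau> k t) (v t)
     = sqrt 2 * \<mu> * \<tau> * k t * (LINT x|lebesgue_on (flow_domain R). weight R \<kappa> L x * (norm (sym_grad (v t) x))\<^sup>2) / measure lebesgue (flow_domain R)"
    unfolding dissipation_rate_def eddy_viscosity_eq by (simp add: mult.assoc)
  ultimately show ?thesis
    using eq by (simp add: algebra_simps) (metis add_diff_cancel_right')
qed

text \<open>As long as \<open>y\<close> is positive, \<open>y t * exp (a * t)\<close> is
  nondecreasing, so \<open>y\<close> cannot come down to zero. The coefficient \<open>G\<close> is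
  known only to be nonnegative, hence no exponential of its integral is formed.\<close>

lemma linear_ode_positive:
  fixes y :: "real \<Rightarrow> real"
  assumes cont: "continuous_on {ts..} y" and y0: "y ts > 0"
    and der: "\<And>t. t > ts \<Longrightarrow> (y has_real_derivative (G t - a) * y t) (at t)" and G: "\<And>t. G t \<ge> 0"
    and T: "T \<ge> ts"
  shows "y T > 0"
proof (rule ccontr)
  assume "\<not> y T > 0"
  \<comment> \<open>Compactness provides the first time at which \<open>y\<close> is not positive;
    monotonicity holds on the open interval before it.\<close>
  define Z where "Z = {t \<in> {ts..T}. y t \<le> 0}"
  have c: "continuous_on {ts..T} y" using cont by (rule continuous_on_subset) auto
  have "closed Z" unfolding Z_def by (intro continuous_on_closed_Collect_le c continuous_intros)
  then have "compact Z" unfolding compact_eq_bounded_closed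
    by (auto simp: Z_def intro: bounded_subset[of "{ts..T}"])
  moreover have "Z \<noteq> {}" using \<open>\<not> y T > 0\<close> T by (auto simp: Z_def)
  ultimately obtain t1 where t1: "t1 \<in> Z" "\<And>t. t \<in> Z \<Longrightarrow> t1 \<le> t" using compact_attains_inf by metis
  have ts: "ts \<le> t1" "t1 \<le> T" "y t1 \<le> 0" using t1(1) by (auto simp: Z_def)
  have "y ts * exp (a * ts) \<le> y t1 * exp (a * t1)"
  proof (rule DERIV_nonneg_imp_increasing_open[OF ts(1)])
    fix t assume t: "ts < t" "t < t1"
    have "t \<notin> Z" using t1(2)[of t] t by auto
    then have "y t > 0" using t ts by (auto simp: Z_def)
    moreover have "((\<lambda>t. y t * exp (a * t)) has_real_derivative ((G t - a) * y t * exp (a * t) + y t * (a * exp (a * t)))) (at t)"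
      using der[OF t(1)] by (auto intro!: derivative_eq_intros)
    moreover have "(G t - a) * y t * exp (a * t) + y t * (a * exp (a * t)) = G t * y t * exp (a * t)" by (simp add: algebra_simps)
    ultimately show "\<exists>d. ((\<lambda>t. y t * exp (a * t)) has_real_derivative d) (at t) \<and> d \<ge> 0"
      using G[of t] by auto
  next
    show "continuous_on {ts..t1} (\<lambda>t. y t * exp (a * t))"
      using ts by (intro continuous_intros continuous_on_subset[OF cont]) auto
  qed
  moreover have "y t1 * exp (a * t1) \<le> 0" using ts(3) by (simp add: mult_le_0_iff)
  ultimately show False using y0 by (smt (verit) exp_gt_zero mult_pos_pos)
qed

text \<open>The bound \<open>y \<le> 2 y(ts)\<close>, under which \<open>y\<close> decays, can not be left because the decay estimate
  is stronger than this bound.\<close>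

lemma coupled_decay:
  fixes y E :: "real \<Rightarrow> real"
  assumes cy: "continuous_on {ts..} y" and cE: "continuous_on {ts..} E"
    and y0: "y ts > 0" and ypos: "\<And>t. t \<ge> ts \<Longrightarrow> y t > 0" and E: "\<And>t. E t \<ge> 0" "E ts \<le> E1"
    and \<beta>: "\<beta> \<ge> 0" "exp (\<beta> * E1) < 2" and \<rho>: "\<rho> > 0"
    and step: "\<And>t. t > ts \<Longrightarrow> y t \<le> 2 * y ts \<Longrightarrow> \<exists>y' E'. (y has_real_derivative y') (at t) \<and>
        (E has_real_derivative E') (at t) \<and> y' + y t * (\<beta> * E' + \<rho>) \<le> 0"
    and T: "T \<ge> ts"
  shows "y T \<le> y ts * exp (\<beta> * E1 + \<rho> * ts) * exp (- \<rho> * T)"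
proof -
  have decay: "y T \<le> y ts * exp (\<beta> * E1) * exp (- \<rho> * (T - ts))"
    if T: "T \<ge> ts" and bd: "\<And>t. ts < t \<Longrightarrow> t < T \<Longrightarrow> y t \<le> 2 * y ts" for T
  proof -
    \<comment> \<open>The derivative of \<Phi> is the exponential times the expression in
      \<open>step\<close>, so \<open>step\<close> says exactly that \<Phi> decreases.\<close>
    define \<Phi> where "\<Phi> t = y t * exp (\<beta> * E t + \<rho> * t)" for t
    have "\<Phi> T \<le> \<Phi> ts"
    proof (rule DERIV_nonpos_imp_decreasing_open[OF T])
      fix t assume t: "ts < t" "t < T"
      obtain y' E' where d: "(y has_real_derivative y') (at t)" "(E has_real_derivative E') (at t)"
        "y' + y t * (\<beta> * E' + \<rho>) \<le> 0" using step[OF t(1) bd[OF t]] by blast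
      have "(\<Phi> has_real_derivative (y' + y t * (\<beta> * E' + \<rho>)) * exp (\<beta> * E t + \<rho> * t)) (at t)"
        unfolding \<Phi>_def using d by (auto intro!: derivative_eq_intros simp: algebra_simps)
      moreover have "(y' + y t * (\<beta> * E' + \<rho>)) * exp (\<beta> * E t + \<rho> * t) \<le> 0"
        using d(3) by (simp add: mult_le_0_iff)
      ultimately show "\<exists>d. (\<Phi> has_real_derivative d) (at t) \<and> d \<le> 0" by blast
    next
      show "continuous_on {ts..T} \<Phi>"
        unfolding \<Phi>_def
        by (intro continuous_intros continuous_on_subset[OF cy] continuous_on_subset[OF cE]) auto
    qed
    have "y T * exp (\<rho> * T) \<le> \<Phi> T"
      unfolding \<Phi>_def using ypos[OF T] \<beta>(1) E(1)[of T] by (intro mult_left_mono) auto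
    also have "\<dots> \<le> \<Phi> ts" by fact
    also have "\<dots> \<le> y ts * exp (\<beta> * E1 + \<rho> * ts)"
      unfolding \<Phi>_def using y0 \<beta>(1) E(2) by (intro mult_left_mono) (auto intro: mult_left_mono)
    finally have "y T \<le> y ts * exp (\<beta> * E1 + \<rho> * ts) / exp (\<rho> * T)"
      by (simp add: pos_le_divide_eq)
    also have "\<dots> = y ts * exp (\<beta> * E1) * exp (- \<rho> * (T - ts))"
      by (simp add: exp_add[symmetric] exp_minus[symmetric] divide_inverse algebra_simps)
    finally show ?thesis .
  qed
  have strict: "y t < 2 * y ts" if t: "t \<ge> ts" for t
  proof (rule ccontr)
    assume "\<not> y t < 2 * y ts"
    define Z where "Z = {s \<in> {ts..t}. 2 * y ts \<le> y s}"
    have c: "continuous_on {ts..t} y" using cy by (rule continuous_on_subset) auto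
    have "closed Z" unfolding Z_def by (intro continuous_on_closed_Collect_le c continuous_intros)
    then have "compact Z" unfolding compact_eq_bounded_closed
      by (auto simp: Z_def intro: bounded_subset[of "{ts..t}"])
    moreover have "Z \<noteq> {}" using \<open>\<not> y t < 2 * y ts\<close> t by (auto simp: Z_def)
    ultimately obtain t1 where t1: "t1 \<in> Z" "\<And>s. s \<in> Z \<Longrightarrow> t1 \<le> s" using compact_attains_inf by metis
    have ts: "ts \<le> t1" "t1 \<le> t" "2 * y ts \<le> y t1" using t1(1) by (auto simp: Z_def)
    have "y s \<le> 2 * y ts" if "ts < s" "s < t1" for s
      using t1(2)[of s] that ts by (cases "2 * y ts \<le> y s") (auto simp: Z_def)
    \<comment> \<open>\<open>decay\<close> needs the bound only strictly before its final time, so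
      it applies at the first time \<open>t1\<close> itself, where
      \<open>exp (\<beta> * E1) < 2\<close> contradicts having reached
      \<open>2 * y ts\<close>.\<close>
    then have "y t1 \<le> y ts * exp (\<beta> * E1) * exp (- \<rho> * (t1 - ts))" by (rule decay[OF ts(1)])
    also have "\<dots> \<le> y ts * exp (\<beta> * E1) * 1"
      using y0 \<rho> ts by (intro mult_left_mono) auto
    also have "\<dots> < y ts * 2" using y0 \<beta>(2) by simp
    finally show False using ts(3) by simp
  qed
  have "y T \<le> y ts * exp (\<beta> * E1) * exp (- \<rho> * (T - ts))"
    using strict by (intro decay[OF T]) (auto simp: less_imp_le)
  also have "\<dots> = y ts * exp (\<beta> * E1 + \<rho> * ts) * exp (- \<rho> * T)"
    by (simp add: exp_add[symmetric] algebra_simps)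
  finally show ?thesis .
qed

lemma weighted_dissipation_bounds:
  assumes R: "valid_region R" and u: "velocity_field R u"
    and W: "\<And>x. x \<in> flow_domain R \<Longrightarrow> weight R \<kappa> L x \<le> W"
  shows "0 \<le> (LINT x|lebesgue_on (flow_domain R). weight R \<kappa> L x * (norm (sym_grad u x))\<^sup>2)"
    "(LINT x|lebesgue_on (flow_domain R). weight R \<kappa> L x * (norm (sym_grad u x))\<^sup>2)
      \<le> W * (LINT x|lebesgue_on (flow_domain R). (norm (sym_grad u x))\<^sup>2)"
proof -
  let ?M = "lebesgue_on (flow_domain R)"
  have G: "\<And>i j. lip_field R (\<lambda>x. grad_matrix u x $ i $ j)" using u unfolding velocity_field_def by blast
  note S = lip_field_norm_sym_grad[OF G]
  show "0 \<le> (LINT x|?M. weight R \<kappa> L x * (norm (sym_grad u x))\<^sup>2)"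
    by (intro Bochner_Integration.integral_nonneg mult_nonneg_nonneg weight_nonneg) simp
  have "(LINT x|?M. weight R \<kappa> L x * (norm (sym_grad u x))\<^sup>2) \<le> (LINT x|?M. W * (norm (sym_grad u x))\<^sup>2)"
  proof (rule integral_mono)
    show "integrable ?M (\<lambda>x. weight R \<kappa> L x * (norm (sym_grad u x))\<^sup>2)"
      by (intro lip_field_integrable[OF R] lip_field_mult lip_field_weight R S)
    show "integrable ?M (\<lambda>x. W * (norm (sym_grad u x))\<^sup>2)"
      by (intro lip_field_integrable[OF R] lip_field_cmult S)
    show "weight R \<kappa> L x * (norm (sym_grad u x))\<^sup>2 \<le> W * (norm (sym_grad u x))\<^sup>2" if "x \<in> space ?M" for x
      using W[of x] that by (intro mult_right_mono) (auto simp: space_restrict_space)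
  qed
  then show "(LINT x|?M. weight R \<kappa> L x * (norm (sym_grad u x))\<^sup>2) \<le> W * (LINT x|?M. (norm (sym_grad u x))\<^sup>2)"
    by simp
qed

text \<open>The factor \<open>s\<close> treats both signs at once: it is 1 for the positivity claim
  and \<open>sgn ks\<close> in the decay estimate.\<close>

lemma solution_k_sign:
  fixes R :: "'n::finite flow_region"
  assumes sol: "half_equation_solution R \<nu> \<mu> \<kappa> L f v0 ts ks \<tau> v q k"
    and "\<mu> > 0" "\<tau> > 0" and s: "s * k ts > 0" and t: "t \<ge> ts"
  shows "s * k t > 0"
proof -
  let ?G = "\<lambda>t. sqrt 2 * \<mu> * \<tau> * ((LINT x|lebesgue_on (flow_domain R). weight R \<kappa> L x * (norm (sym_grad (v t) x))\<^sup>2) / measure lebesgue (flow_domain R))"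
  show ?thesis
  proof (rule linear_ode_positive[where y="\<lambda>t. s * k t" and G="?G" and a="sqrt 2 / 2 * inverse \<tau>"])
    show "continuous_on {ts..} (\<lambda>t. s * k t)"
      using sol unfolding half_equation_solution_def by (intro continuous_intros) blast
    show "((\<lambda>t. s * k t) has_real_derivative (?G t - sqrt 2 / 2 * inverse \<tau>) * (s * k t)) (at t)" if "t > ts" for t
      using DERIV_cmult[OF solution_k_derivative[OF sol that], of s] by (simp only: mult.left_commute)
    show "?G t \<ge> 0" for t
      using assms by (intro mult_nonneg_nonneg divide_nonneg_nonneg Bochner_Integration.integral_nonneg weight_nonneg) auto
  qed (use s t in auto)
qed

text \<open>\<open>E1\<close> bounds the fluctuation energy at time \<open>ts\<close> by data. Of
  the three smallness conditions, the first keeps the modulus of \<open>k\<close> below twice its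
  initial value, the second makes the rate positive, and the third turns that bound on
  \<open>k\<close> into a total viscosity of at least \<nu>.\<close>

lemma solution_k_decay:
  fixes R :: "'n::finite flow_region"
  assumes R: "valid_region R" and sol: "half_equation_solution R \<nu> \<mu> \<kappa> L f v0 ts ks \<tau> v q k"
    and pos: "\<nu> > 0" "\<mu> > 0" "\<tau> > 0" "C > 0" "ts \<ge> 0" "ks \<noteq> 0" "W > 0"
    and W: "\<And>x. x \<in> flow_domain R \<Longrightarrow> weight R \<kappa> L x \<le> W"
    and poincare: "\<And>u. velocity_field R u \<Longrightarrow>
      (LINT x|lebesgue_on (flow_domain R). (norm (u x - mean_field R u))\<^sup>2)
        \<le> C * (LINT x|lebesgue_on (flow_domain R). (norm (sym_grad u x))\<^sup>2)"
    and f: "\<And>t. t \<ge> 0 \<Longrightarrow> f t \<in> borel_measurable (lebesgue_on (flow_domain R))"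
      "\<And>t. t \<ge> 0 \<Longrightarrow> integrable (lebesgue_on (flow_domain R)) (\<lambda>x. (norm (f t x))\<^sup>2)"
      "\<And>t. t \<ge> 0 \<Longrightarrow> (LINT x|lebesgue_on (flow_domain R). (norm (f t x))\<^sup>2) \<le> M"
  defines "K \<equiv> C * M / (2 * \<nu>)"
    and "E1 \<equiv> (LINT x|lebesgue_on (flow_domain R). (norm (v0 x))\<^sup>2) / 2 + C * M / (2 * \<nu>) * ts"
    and "\<beta> \<equiv> \<tau> * (2 * sqrt 2 * \<mu> * W / (\<nu> * measure lebesgue (flow_domain R)))"
    and "a \<equiv> sqrt 2 / 2 * inverse \<tau>"
  assumes small: "exp (\<beta> * E1) < 2" "\<beta> * K < a" "sqrt 2 * \<mu> * \<tau> * (2 * \<bar>ks\<bar>) * W \<le> \<nu>"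
    and t: "t \<ge> ts"
  shows "\<bar>k t\<bar> \<le> \<bar>ks\<bar> * exp (\<beta> * E1 + (a - \<beta> * K) * ts) * exp (- (a - \<beta> * K) * t)"
proof -
  let ?M = "lebesgue_on (flow_domain R)"
  define m where "m = measure lebesgue (flow_domain R)"
  have m: "m > 0" unfolding m_def by (rule flow_domain_measure_pos[OF R])
  define b where "b = sqrt 2 * \<mu> * \<tau>"
  have b: "b > 0" using pos by (simp add: b_def)
  \<comment> \<open>The identity that fixes \<open>\<beta>\<close>: the dissipation left in the
    energy inequality, multiplied by \<open>\<beta>\<close>, dominates \<open>b\<close> times the
    weighted mean.\<close>
  have \<beta>_eq: "\<beta> * (\<nu> / 2) = b * W / m"
    using pos m by (simp add: \<beta>_def b_def m_def field_simps)
  have \<beta>: "\<beta> \<ge> 0" unfolding \<beta>_def using pos by simp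
  have reg: "regular_fields R ts v q" and kts: "k ts = ks" and ck: "continuous_on {ts..} k"
    and kpos: "\<And>t. 0 \<le> t \<Longrightarrow> t < ts \<Longrightarrow> 0 \<le> k t" and init: "\<And>x. x \<in> flow_domain R \<Longrightarrow> v 0 x = v0 x"
    using sol unfolding half_equation_solution_def by blast+
  define E where "E s = fluctuation_energy R (v s)" for s
  have E0: "E s \<ge> 0" for s unfolding E_def by (rule fluctuation_energy_nonneg)
  have cE: "continuous_on {0..} E" unfolding E_def by (rule fluctuation_energy_continuous[OF reg R])
  define S where "S s = (LINT x|?M. (norm (sym_grad (v s) x))\<^sup>2)" for s
  have S: "S s \<ge> 0" for s unfolding S_def by simp
  have energy: "\<exists>D. (E has_real_derivative D) (at s) \<and> D + \<nu> / 2 * S s \<le> K"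
    if s: "s \<in> model_times ts" and ge: "\<And>x. x \<in> flow_domain R \<Longrightarrow> eddy_viscosity R \<mu> \<kappa> L \<tau> k s x \<ge> - \<nu>" for s
  proof -
    have "s \<ge> 0" using s by (simp add: model_times_def)
    then obtain D where "((\<lambda>s. fluctuation_energy R (v s)) has_real_derivative D) (at s)"
      "D + \<nu> / 2 * (LINT x|?M. (norm (sym_grad (v s) x))\<^sup>2) \<le> C * M / (2 * \<nu>)"
      using energy_inequality[OF sol R s pos(1,4) poincare[OF solution_velocity_field(1)[OF sol R s]] f ge] by blast
    then show ?thesis unfolding E_def S_def K_def by blast
  qed
  have Ets: "E ts \<le> E1"
  proof -
    \<comment> \<open>Before \<open>ts\<close> the value of \<open>k\<close> is only known to be
      nonnegative, which suffices for the energy inequality.\<close>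
    have "E ts - K * ts \<le> E 0 - K * 0"
    proof (rule DERIV_nonpos_imp_decreasing_open[OF pos(5)])
      fix s assume s: "0 < s" "s < ts"
      have "eddy_viscosity R \<mu> \<kappa> L \<tau> k s x \<ge> - \<nu>" for x
      proof -
        have "0 \<le> eddy_viscosity R \<mu> \<kappa> L \<tau> k s x"
          unfolding eddy_viscosity_eq using pos kpos[of s] s by (intro mult_nonneg_nonneg weight_nonneg) auto
        then show ?thesis using pos by linarith
      qed
      then obtain D where D: "(E has_real_derivative D) (at s)" "D + \<nu> / 2 * S s \<le> K"
        using energy[of s] s by (auto simp: model_times_def)
      have "((\<lambda>s. E s - K * s) has_real_derivative D - K) (at s)"
        using D(1) by (auto intro!: derivative_eq_intros)
      moreover have "0 \<le> \<nu> / 2 * S s" using pos S by simp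
      ultimately show "\<exists>y. ((\<lambda>s. E s - K * s) has_real_derivative y) (at s) \<and> y \<le> 0"
        using D(2) by (intro exI[of _ "D - K"]) auto
    next
      show "continuous_on {0..ts} (\<lambda>s. E s - K * s)"
        by (intro continuous_intros continuous_on_subset[OF cE]) auto
    qed
    moreover have "E 0 \<le> (LINT x|?M. (norm (v0 x))\<^sup>2) / 2"
    proof -
      have "(LINT x|?M. (norm (v 0 x))\<^sup>2) = (LINT x|?M. (norm (v0 x))\<^sup>2)"
        by (intro Bochner_Integration.integral_cong) (auto simp: space_restrict_space init)
      then show ?thesis using fluctuation_energy_le[OF reg R, of 0] by (simp add: E_def)
    qed
    ultimately show ?thesis unfolding E1_def K_def by simp
  qed
  define y where "y s = sgn ks * k s" for s
  have y: "y s = \<bar>k s\<bar>" "y s > 0" if "s \<ge> ts" for s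
  proof -
    have "sgn ks * k ts > 0" using pos kts by (simp add: sgn_if)
    then show "y s > 0" unfolding y_def by (rule solution_k_sign[OF sol pos(2,3) _ that])
    then show "y s = \<bar>k s\<bar>" unfolding y_def by (auto simp: sgn_if split: if_splits)
  qed
  have yts: "y ts = \<bar>ks\<bar>" using y(1)[of ts] kts by simp
  have "y t \<le> y ts * exp (\<beta> * E1 + (a - \<beta> * K) * ts) * exp (- (a - \<beta> * K) * t)"
  proof (rule coupled_decay[where E=E])
    show "continuous_on {ts..} y" unfolding y_def by (intro continuous_intros ck)
    show "continuous_on {ts..} E" using pos by (intro continuous_on_subset[OF cE]) auto
    show "y ts > 0" "\<And>t. ts \<le> t \<Longrightarrow> y t > 0" using y by auto
    show "a - \<beta> * K > 0" using small by simp
    fix s assume s: "ts < s" and ys: "y s \<le> 2 * y ts"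
    have sm: "s \<in> model_times ts" using s pos by (simp add: model_times_def)
    \<comment> \<open>The bound is two-sided in \<open>k\<close>; for negative \<open>k\<close> it
      is the point where diffusion could otherwise be lost.\<close>
    have "eddy_viscosity R \<mu> \<kappa> L \<tau> k s x \<ge> - \<nu>" if x: "x \<in> flow_domain R" for x
    proof -
      have "\<bar>eddy_viscosity R \<mu> \<kappa> L \<tau> k s x\<bar> = b * (\<bar>k s\<bar> * weight R \<kappa> L x)"
        unfolding eddy_viscosity_eq using b weight_nonneg[of R \<kappa> L x] by (simp add: b_def[symmetric] abs_mult)
      also have "\<dots> \<le> b * ((2 * \<bar>ks\<bar>) * W)"
        using ys y(1)[of s] s yts W[OF x] weight_nonneg[of R \<kappa> L x] b
        by (intro mult_left_mono mult_mono) auto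
      also have "\<dots> \<le> \<nu>" using small(3) by (simp add: b_def mult.assoc)
      finally show ?thesis by linarith
    qed
    then obtain D where D: "(E has_real_derivative D) (at s)" "D + \<nu> / 2 * S s \<le> K"
      using energy[OF sm] by blast
    define g where "g = (LINT x|?M. weight R \<kappa> L x * (norm (sym_grad (v s) x))\<^sup>2) / m"
    have "g \<le> W * S s / m"
      unfolding g_def S_def using m
      by (intro divide_right_mono weighted_dissipation_bounds(2)[OF R solution_velocity_field(1)[OF sol R sm] W]) auto
    then have "b * g \<le> b * (W * S s / m)" using b by (intro mult_left_mono) auto
    also have "\<dots> = b * W / m * S s" by simp
    also have "\<dots> = \<beta> * (\<nu> / 2 * S s)" by (simp only: \<beta>_eq[symmetric] mult.assoc)
    also have "\<dots> \<le> \<beta> * (K - D)" using D(2) \<beta> by (intro mult_left_mono) auto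
    \<comment> \<open>The unknown dissipation has dropped out. After multiplication by the positive
      \<open>y s\<close> this is the hypothesis \<open>step\<close> of
      \<open>coupled_decay\<close>.\<close>
    finally have bg: "b * g - a + (\<beta> * D + (a - \<beta> * K)) \<le> 0" by (simp add: algebra_simps)
    have "(y has_real_derivative (b * g - a) * y s) (at s)"
      using DERIV_cmult[OF solution_k_derivative[OF sol s], of "sgn ks"]
      unfolding y_def a_def b_def g_def m_def by (simp only: mult.left_commute)
    moreover have "(b * g - a) * y s + y s * (\<beta> * D + (a - \<beta> * K)) \<le> 0"
    proof -
      have "y s * (b * g - a + (\<beta> * D + (a - \<beta> * K))) \<le> 0"
        using bg y(2)[of s] s by (simp add: mult_le_0_iff)
      then show ?thesis by (simp add: algebra_simps)
    qed
    ultimately show "\<exists>y' E'. (y has_real_derivative y') (at s) \<and> (E has_real_derivative E') (at s) \<and>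
        y' + y s * (\<beta> * E' + (a - \<beta> * K)) \<le> 0"
      using D(1) by blast
  qed (use E0 Ets \<beta> small t in auto)
  then show ?thesis using y(1)[OF t] yts by simp
qed

section \<open>Choice of the threshold for the time window\<close>

theorem proposition1:
  fixes R :: "'n::finite flow_region"
    and \<nu> \<mu> \<kappa> L ts ks :: real
    and f :: "real \<Rightarrow> real^'n \<Rightarrow> real^'n"
    and v0 :: "real^'n \<Rightarrow> real^'n"
  assumes "valid_region R"
    and "\<nu> > 0" and "\<mu> > 0" and "\<kappa> > 0" and "L > 0"
    and "ts \<ge> 0" and "ks \<noteq> 0"
  shows
    "(\<forall>\<tau>>0. \<forall>v q k. half_equation_solution R \<nu> \<mu> \<kappa> L f v0 ts ks \<tau> v q k \<longrightarrow>
        k ts > 0 \<longrightarrow> (\<forall>t\<ge>ts. k t > 0)) \<and>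
     (bounded_force R f \<longrightarrow>
       (\<exists>\<tau>0>0. \<forall>\<tau>. 0 < \<tau> \<and> \<tau> < \<tau>0 \<longrightarrow>
         (\<forall>v q k. half_equation_solution R \<nu> \<mu> \<kappa> L f v0 ts ks \<tau> v q k \<longrightarrow>
           (\<exists>C r. r > 0 \<and> (\<forall>t\<ge>ts. \<bar>k t\<bar> \<le> C * exp (- r * t))) \<and>
           (\<exists>C r. r > 0 \<and> (\<forall>t\<ge>ts. \<forall>x\<in>flow_domain R.
              \<bar>eddy_viscosity R \<mu> \<kappa> L \<tau> k t x\<bar> \<le> C * exp (- r * t))))))"
proof (intro conjI impI)
  show "\<forall>\<tau>>0. \<forall>v q k. half_equation_solution R \<nu> \<mu> \<kappa> L f v0 ts ks \<tau> v q k \<longrightarrow>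
        k ts > 0 \<longrightarrow> (\<forall>t\<ge>ts. k t > 0)"
    using solution_k_sign[of R \<nu> \<mu> \<kappa> L f v0 ts ks _ _ _ _ 1] assms by simp
next
  assume "bounded_force R f"
  let ?M = "lebesgue_on (flow_domain R)"
  let ?m = "measure lebesgue (flow_domain R)"
  obtain M where f: "\<And>t. t \<ge> 0 \<Longrightarrow> f t \<in> borel_measurable ?M"
      "\<And>t. t \<ge> 0 \<Longrightarrow> integrable ?M (\<lambda>x. (norm (f t x))\<^sup>2)"
      "\<And>t. t \<ge> 0 \<Longrightarrow> (LINT x|?M. (norm (f t x))\<^sup>2) \<le> M"
    using \<open>bounded_force R f\<close> unfolding bounded_force_def by blast
  have "0 \<le> (LINT x|?M. (norm (f 0 x))\<^sup>2)" by simp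
  then have M: "M \<ge> 0" using f(3)[of 0] by linarith
  obtain C where C: "C > 0" and poincare: "\<And>u. velocity_field R u \<Longrightarrow>
      (LINT x|?M. (norm (u x - mean_field R u))\<^sup>2) \<le> C * (LINT x|?M. (norm (sym_grad u x))\<^sup>2)"
    using poincare_velocity_field[OF assms(1)] by blast
  obtain W0 where W0: "\<And>x. x \<in> field_domain R \<Longrightarrow> \<bar>weight R \<kappa> L x\<bar> \<le> W0"
    using lip_field_weight[OF assms(1)] unfolding lip_field_def by blast
  \<comment> \<open>The summand 1 makes the bound on the weight strictly positive, as the decay
    estimate requires.\<close>
  define W where "W = \<bar>W0\<bar> + 1"
  have Wpos: "W > 0" by (simp add: W_def)
  have W: "weight R \<kappa> L x \<le> W" if "x \<in> flow_domain R" for x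
    using W0[of x] that flow_domain_subset[of R] unfolding W_def by fastforce
  define K where "K = C * M / (2 * \<nu>)"
  define E1 where "E1 = (LINT x|?M. (norm (v0 x))\<^sup>2) / 2 + K * ts"
  define c where "c = 2 * sqrt 2 * \<mu> * W / (\<nu> * ?m)"
  define d where "d = sqrt 2 * \<mu> * (2 * \<bar>ks\<bar>) * W"
  have nonneg: "K \<ge> 0" "c \<ge> 0" "d \<ge> 0" "E1 \<ge> 0"
    using assms M C Wpos by (auto simp: K_def c_def d_def E1_def)
  \<comment> \<open>The four bounds give, in this order, \<open>1 / 2 < a\<close>,
    \<open>exp (\<beta> * E1) < 2\<close>, \<open>\<beta> * K < 1 / 2\<close> and a sufficiently
    small eddy viscosity, with \<open>\<beta> = \<tau> * c\<close>. Each \<open>+ 1\<close> keeps a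
    denominator positive when its nonnegative constant is zero. Only data enter.\<close>
  define \<tau>0 where "\<tau>0 = min (min 1 (ln 2 / (c * E1 + 1))) (min (1 / 2 / (c * K + 1)) (\<nu> / (d + 1)))"
  have quot: "\<tau> * Y < X" if "0 < \<tau>" "\<tau> < X / (Y + 1)" "Y \<ge> 0" for \<tau> X Y :: real
  proof -
    have "\<tau> * (Y + 1) < X" using that by (simp add: pos_less_divide_eq)
    then show ?thesis using that(1) by (simp add: distrib_left)
  qed
  show "\<exists>\<tau>0>0. \<forall>\<tau>. 0 < \<tau> \<and> \<tau> < \<tau>0 \<longrightarrow>
         (\<forall>v q k. half_equation_solution R \<nu> \<mu> \<kappa> L f v0 ts ks \<tau> v q k \<longrightarrow>
           (\<exists>C r. r > 0 \<and> (\<forall>t\<ge>ts. \<bar>k t\<bar> \<le> C * exp (- r * t))) \<and>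
           (\<exists>C r. r > 0 \<and> (\<forall>t\<ge>ts. \<forall>x\<in>flow_domain R.
              \<bar>eddy_viscosity R \<mu> \<kappa> L \<tau> k t x\<bar> \<le> C * exp (- r * t))))"
  proof (rule exI[of _ \<tau>0], intro conjI[of "\<tau>0 > 0"] allI impI)
    show "\<tau>0 > 0" using nonneg assms by (simp add: \<tau>0_def add_nonneg_pos)
  next
    fix \<tau> v q k
    assume "0 < \<tau> \<and> \<tau> < \<tau>0" and sol: "half_equation_solution R \<nu> \<mu> \<kappa> L f v0 ts ks \<tau> v q k"
    then have \<tau>: "0 < \<tau>" "\<tau> < \<tau>0" by auto
    define a where "a = sqrt 2 / 2 * inverse \<tau>"
    define r where "r = a - \<tau> * c * K"
    have "\<tau> * (c * E1) < ln 2" "\<tau> * (c * K) < 1 / 2" "\<tau> * d < \<nu>" "\<tau> < 1"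
      using \<tau> nonneg quot[of \<tau> "ln 2" "c * E1"] quot[of \<tau> "1 / 2" "c * K"] quot[of \<tau> \<nu> d]
      unfolding \<tau>0_def min_less_iff_conj by simp_all
    then have small: "exp (\<tau> * c * E1) < 2" "\<tau> * c * K < 1 / 2" "sqrt 2 * \<mu> * \<tau> * (2 * \<bar>ks\<bar>) * W \<le> \<nu>" "\<tau> < 1"
      using exp_less_cancel_iff[of "\<tau> * (c * E1)" "ln 2"] by (auto simp: d_def mult_ac)
    \<comment> \<open>The value \<open>1 / 2\<close> separates the two rates: \<open>a\<close> lies
      above it because \<open>\<tau> < 1\<close>, and \<open>\<tau> * c * K\<close> lies below
      it.\<close>
    have "1 / 2 < a"
    proof -
      have "1 < inverse \<tau>" using \<tau>(1) small(4) by (simp add: one_less_inverse)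
      moreover have "1 \<le> sqrt 2" by simp
      ultimately have "1 * 1 < sqrt 2 * inverse \<tau>" by (intro mult_le_less_imp_less) auto
      then show ?thesis by (simp add: a_def)
    qed
    then have r: "r > 0" and aK: "\<tau> * c * K < a" using small(2) by (auto simp: r_def)
    define A where "A = \<bar>ks\<bar> * exp (\<tau> * c * E1 + r * ts)"
    have decay: "\<bar>k t\<bar> \<le> A * exp (- r * t)" if "t \<ge> ts" for t
      using solution_k_decay[OF assms(1) sol assms(2,3) \<tau>(1) C assms(6,7) Wpos W poincare f _ _ _ that]
        small(1,3) aK
      unfolding A_def r_def a_def c_def E1_def K_def by blast
    have "\<exists>C r. r > 0 \<and> (\<forall>t\<ge>ts. \<bar>k t\<bar> \<le> C * exp (- r * t))"
      using r decay by blast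
    moreover have "\<bar>eddy_viscosity R \<mu> \<kappa> L \<tau> k t x\<bar> \<le> (sqrt 2 * \<mu> * \<tau> * W * A) * exp (- r * t)"
      if "t \<ge> ts" "x \<in> flow_domain R" for t x
    proof -
      have "\<bar>eddy_viscosity R \<mu> \<kappa> L \<tau> k t x\<bar> = sqrt 2 * \<mu> * \<tau> * (weight R \<kappa> L x * \<bar>k t\<bar>)"
        unfolding eddy_viscosity_eq using assms \<tau> weight_nonneg[of R \<kappa> L x] by (simp add: abs_mult)
      also have "\<dots> \<le> sqrt 2 * \<mu> * \<tau> * (W * (A * exp (- r * t)))"
        using W[OF that(2)] decay[OF that(1)] weight_nonneg[of R \<kappa> L x] Wpos assms \<tau>
        by (intro mult_left_mono mult_mono) auto
      finally show ?thesis by (simp only: mult.assoc)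
    qed
    ultimately show "(\<exists>C r. r > 0 \<and> (\<forall>t\<ge>ts. \<bar>k t\<bar> \<le> C * exp (- r * t))) \<and>
       (\<exists>C r. r > 0 \<and> (\<forall>t\<ge>ts. \<forall>x\<in>flow_domain R.
        \<bar>eddy_viscosity R \<mu> \<kappa> L \<tau> k t x\<bar> \<le> C * exp (- r * t)))"
      using r by blast
  qed
qed

end
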